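(* Let $\mathcal{B}\subseteq\omega^\omega$ be a mass problem, let $\mathcal{E}\subseteq\omega^\omega$ be a countable mass problem such that $\mathcal{E}\not\geq_{\mathcal{M}}\mathcal{B}$, and let $\mathcal{D} = \mathcal{E}\to\mathcal{B}$ (implication in the Medvedev lattice; so $\mathcal{D}\leq_{\mathcal{M}}\mathcal{B}$). Let $A\subseteq\omega$ be a computably independent set such that $A\not\geq_T f$ for all $f\in\mathcal{E}$. Then $$\mathrm{Th}\left(\mathcal{M}\big/\left(\left\{\, i^\frown g \;\middle|\; i\in\omega,\ g\in\omega^\omega,\ \text{and } g\geq_T A^{[i]} \text{ or } g\in C(\mathcal{E})\right\}\otimes\mathcal{D}\right)\right) = \mathrm{IPC}.$$
   Context: Upper cones: for $X\subseteq\omega^\omega$, $C(X) = \{f\in\omega^\omega\mid\exists g\in X\,(f\geq_T g)\}$. Computably independent sets: fix a computable pairing function $\langle\cdot,\cdot\rangle:\omega^2\to\omega$. For $A \subseteq \omega$ (identified with its characteristic function) the $i$-th column $A^{[i]}$ is given by $A^{[i]}(n) = A(\langle i,n\rangle)$. $A$ is computably independent if for every $i \in \omega$ we have $\bigoplus_{j\neq i} A^{[j]} \not\geq_T A^{[i]}$. Concatenation: $i^\frown f$ is the function with first value $i$ followed by the values of $f$. Medvedev lattice: mass problems are subsets of $\omega^\omega$. $\mathcal{X} \leq_{\mathcal{M}} \mathcal{Y}$ iff there is a Turing functional $\Phi$ with $\Phi(\mathcal{Y}) \subseteq \mathcal{X}$ (i.e. for every $f\in\mathcal{Y}$, $\Phi(f)$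 is total and belongs to $\mathcal{X}$). $\equiv_{\mathcal{M}}$ is the induced equivalence, its classes are the Medvedev degrees, and $\mathcal{M}$ is the ordered set of Medvedev degrees; a mass problem is also used to denote its degree. $\mathcal{M}$ is a bounded distributive lattice with join $\mathcal{X}\oplus\mathcal{Y} = \{f\oplus g \mid f\in\mathcal{X}, g\in\mathcal{Y}\}$, meet $\mathcal{X}\otimes\mathcal{Y} = \{0^\frown f\mid f\in\mathcal{X}\}\cup\{1^\frown g\mid g\in\mathcal{Y}\}$, bottom $0$ = degree of $\omega^\omega$, top $1$ = degree of $\emptyset$. Brouwer algebras: a Brouwer algebra is a bounded distributive lattice (join $\oplus$, meet $\otimes$) with a binary operation $\to$ such that $a\oplus c\geq b$ iff $c\geq a\to b$. $\mathcal{M}$ is a Brouwer algebra with $\mathcal{X}\to\mathcal{Y} = \{n^\frown f \mid \forall g\in\mathcal{X}\,(\Phi_n(f\oplus g)\in\mathcal{Y})\}$, where $\Phi_n$ is the $n$-th Turing functional. For a Brouwer algebra $\mathscr{B}$ and $x\in\mathscr{B}$, $\mathscr{B}/x$ denotes the quotient of $\mathscr{B}$ by the principal filter $\{z\mid z\geq x\}$; it is isomorphic to the interval $[0,x]_{\mathscr{B}}$ (with the operations $\oplus,\otimes,\to$ of $\mathscr{B}$, bottom $0$ and top $x$) and is a Brouwer algebra. Theories: a propositional formula $\varphi(x_1,\dots,x_n)$ is evaluated at $b_1,\dots,b_n$ in a Brouwer algebra $\mathscr{B}$ by interpreting $\vee$ as $\otimes$, $\wedge$ as $\oplus$, implication as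 $\to$, and $\bot$ as $1$ (with $\neg\alpha$ being $\alpha\to\bot$). $\mathrm{Th}(\mathscr{B})$ is the set of formulas evaluating to $0$ under all valuations. $\mathrm{IPC}$ is the set of formulas provable in intuitionistic propositional logic. *)

theory Defs
  imports Main "HOL-Library.Nat_Bijection" "HOL-Library.Countable_Set"
begin

section \<open>Turing functionals\<close>

text \<open>
  Kleene's schemata relativised to an oracle. All functions are unary; several arguments are
  passed through the Cantor pairing function \<^const>\<open>prod_encode\<close>.
\<close>

datatype code =
    Zero
  | Succ
  | Fst
  | Snd
  | Oracle
  | Tuple code code
  | Comp code code
  | Prec code code
  | Mu code

primrec eval :: "code \<Rightarrow> (nat \<Rightarrow> nat) \<Rightarrow> nat \<Rightarrow> nat option" where
  "eval Zero f x = Some 0"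
| "eval Succ f x = Some (Suc x)"
| "eval Fst f x = Some (fst (prod_decode x))"
| "eval Snd f x = Some (snd (prod_decode x))"
| "eval Oracle f x = Some (f x)"
| "eval (Tuple c d) f x =
     Option.bind (eval c f x) (\<lambda>a. Option.bind (eval d f x) (\<lambda>b. Some (prod_encode (a, b))))"
| "eval (Comp c d) f x = Option.bind (eval d f x) (eval c f)"
| "eval (Prec c d) f x =
     rec_nat (eval c f (fst (prod_decode x)))
       (\<lambda>k r. Option.bind r (\<lambda>y. eval d f (prod_encode (fst (prod_decode x), prod_encode (k, y)))))
       (snd (prod_decode x))"
| "eval (Mu c) f x =
     (let P = \<lambda>n. eval c f (prod_encode (x, n)) = Some 0
                   \<and> (\<forall>m<n. eval c f (prod_encode (x, m)) \<noteq> None)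
      in if \<exists>n. P n then Some (LEAST n. P n) else None)"

text \<open>
  The index of a functional has to be handled effectively (indices occur inside the elements of
  \<open>mp_imp\<close> below), hence an explicit numbering of the codes rather than a choice-based
  enumeration such as \<open>from_nat\<close>.
\<close>

function code_of :: "nat \<Rightarrow> code" where
  "code_of n =
     (if n = 0 then Zero else if n = 1 then Succ else if n = 2 then Fst else if n = 3 then Snd
      else if n = 4 then Oracle
      else let m = (n - 5) div 4; a = fst (prod_decode m); b = snd (prod_decode m) in
        if (n - 5) mod 4 = 0 then Tuple (code_of a) (code_of b)
        else if (n - 5) mod 4 = 1 then Comp (code_of a) (code_of b)
        else if (n - 5) mod 4 = 2 then Prec (code_of a) (code_of b)
        else Mu (code_of m))"
  by pat_completeness auto

lemma fst_prod_decode_le: "fst (prod_decode m) \<le> m"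
  by (metis le_prod_encode_1 prod.collapse prod_decode_inverse)

lemma snd_prod_decode_le: "snd (prod_decode m) \<le> m"
  by (metis le_prod_encode_2 prod.collapse prod_decode_inverse)

termination code_of
proof -
  have le: "(n - 5) div 4 < n" if "n \<noteq> 0" for n :: nat
    using that by linarith
  show ?thesis
    by (relation "measure id")
      (auto intro: le_less_trans[OF fst_prod_decode_le le] le_less_trans[OF snd_prod_decode_le le] le)
qed

declare code_of.simps [simp del]

lemma surj_code_of: "surj code_of"
proof -
  have "\<exists>n. code_of n = c" for c
  proof (induction c)
    case Zero show ?case by (rule exI[of _ 0]) (simp add: code_of.simps)
  next
    case Succ show ?case by (rule exI[of _ 1]) (simp add: code_of.simps)
  next
    case Fst show ?case by (rule exI[of _ 2]) (simp add: code_of.simps)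
  next
    case Snd show ?case by (rule exI[of _ 3]) (simp add: code_of.simps)
  next
    case Oracle show ?case by (rule exI[of _ 4]) (simp add: code_of.simps)
  next
    case (Tuple c d)
    then obtain a b where ab: "code_of a = c" "code_of b = d" by blast
    show ?case
      by (rule exI[of _ "4 * prod_encode (a, b) + 5"]) (subst code_of.simps, simp add: ab)
  next
    case (Comp c d)
    then obtain a b where ab: "code_of a = c" "code_of b = d" by blast
    have "(4 * m + 1) div 4 = m" "(4 * m + 1) mod 4 = 1" for m :: nat by presburger+
    then show ?case
      by (intro exI[of _ "4 * prod_encode (a, b) + 1 + 5"]) (subst code_of.simps, simp add: ab)
  next
    case (Prec c d)
    then obtain a b where ab: "code_of a = c" "code_of b = d" by blast
    have "(4 * m + 2) div 4 = m" "(4 * m + 2) mod 4 = 2" for m :: nat by presburger+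
    then show ?case
      by (intro exI[of _ "4 * prod_encode (a, b) + 2 + 5"]) (subst code_of.simps, simp add: ab)
  next
    case (Mu c)
    then obtain a where a: "code_of a = c" by blast
    have "(4 * m + 3) div 4 = m" "(4 * m + 3) mod 4 = 3" for m :: nat by presburger+
    then show ?case
      by (intro exI[of _ "4 * a + 3 + 5"]) (subst code_of.simps, simp add: a)
  qed
  then show ?thesis by (metis surjI)
qed

definition Phi :: "nat \<Rightarrow> (nat \<Rightarrow> nat) \<Rightarrow> nat \<Rightarrow> nat option" where
  "Phi n = eval (code_of n)"

text \<open>\<open>Phi n f = Some \<circ> g\<close> says that the \<open>n\<close>-th functional is total on \<open>f\<close> with value \<open>g\<close>.\<close>

definition turing_le :: "(nat \<Rightarrow> nat) \<Rightarrow> (nat \<Rightarrow> nat) \<Rightarrow> bool" (infix "\<le>\<^sub>T" 50) where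
  "g \<le>\<^sub>T f \<longleftrightarrow> (\<exists>n. Phi n f = Some \<circ> g)"

definition upper_cone :: "(nat \<Rightarrow> nat) set \<Rightarrow> (nat \<Rightarrow> nat) set" where
  "upper_cone X = {f. \<exists>g\<in>X. g \<le>\<^sub>T f}"

section \<open>Computably independent sets\<close>

definition char_fun :: "nat set \<Rightarrow> nat \<Rightarrow> nat" where
  "char_fun A n = of_bool (n \<in> A)"

definition column :: "nat set \<Rightarrow> nat \<Rightarrow> nat \<Rightarrow> nat" where
  "column A i n = char_fun A (prod_encode (i, n))"

text \<open>The effective join of \<open>F j\<close> for \<open>j \<in> J\<close>; columns with index outside \<open>J\<close> are filled with 0.\<close>

definition Join :: "nat set \<Rightarrow> (nat \<Rightarrow> nat \<Rightarrow> nat) \<Rightarrow> nat \<Rightarrow> nat" where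
  "Join J F m = (case prod_decode m of (j, n) \<Rightarrow> if j \<in> J then F j n else 0)"

definition computably_independent :: "nat set \<Rightarrow> bool" where
  "computably_independent A \<longleftrightarrow> (\<forall>i. \<not> column A i \<le>\<^sub>T Join (- {i}) (column A))"

section \<open>Brouwer algebras\<close>

record 'a brouwer =
  carrier :: "'a set"
  join :: "'a \<Rightarrow> 'a \<Rightarrow> 'a"
  meet :: "'a \<Rightarrow> 'a \<Rightarrow> 'a"
  imp :: "'a \<Rightarrow> 'a \<Rightarrow> 'a"
  zero :: 'a
  one :: 'a

definition le :: "'a brouwer \<Rightarrow> 'a \<Rightarrow> 'a \<Rightarrow> bool" where
  "le B a b \<longleftrightarrow> join B a b = b"

locale brouwer_algebra =
  fixes B :: "'a brouwer"
  assumes closed [simp, intro]: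
      "\<lbrakk>a \<in> carrier B; b \<in> carrier B\<rbrakk> \<Longrightarrow> join B a b \<in> carrier B"
      "\<lbrakk>a \<in> carrier B; b \<in> carrier B\<rbrakk> \<Longrightarrow> meet B a b \<in> carrier B"
      "\<lbrakk>a \<in> carrier B; b \<in> carrier B\<rbrakk> \<Longrightarrow> imp B a b \<in> carrier B"
      "zero B \<in> carrier B" "one B \<in> carrier B"
    and join_commute: "\<lbrakk>a \<in> carrier B; b \<in> carrier B\<rbrakk> \<Longrightarrow> join B a b = join B b a"
    and meet_commute: "\<lbrakk>a \<in> carrier B; b \<in> carrier B\<rbrakk> \<Longrightarrow> meet B a b = meet B b a"
    and join_assoc: "\<lbrakk>a \<in> carrier B; b \<in> carrier B; c \<in> carrier B\<rbrakk>
      \<Longrightarrow> join B (join B a b) c = join B a (join B b c)"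
    and meet_assoc: "\<lbrakk>a \<in> carrier B; b \<in> carrier B; c \<in> carrier B\<rbrakk>
      \<Longrightarrow> meet B (meet B a b) c = meet B a (meet B b c)"
    and join_absorb: "\<lbrakk>a \<in> carrier B; b \<in> carrier B\<rbrakk> \<Longrightarrow> join B a (meet B a b) = a"
    and meet_absorb: "\<lbrakk>a \<in> carrier B; b \<in> carrier B\<rbrakk> \<Longrightarrow> meet B a (join B a b) = a"
    and distrib: "\<lbrakk>a \<in> carrier B; b \<in> carrier B; c \<in> carrier B\<rbrakk>
      \<Longrightarrow> meet B (join B a b) c = join B (meet B a c) (meet B b c)"
    and zero_least: "a \<in> carrier B \<Longrightarrow> le B (zero B) a"
    and one_greatest: "a \<in> carrier B \<Longrightarrow> le B a (one B)"
    and residuation: "\<lbrakk>a \<in> carrier B; b \<in> carrier B; c \<in> carrier B\<rbrakk>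
      \<Longrightarrow> le B b (join B a c) \<longleftrightarrow> le B (imp B a b) c"

text \<open>
  The union ranges over all representatives, so no choice is involved; it is a single class
  whenever \<open>h\<close> is compatible with \<open>R\<close>.
\<close>

definition lift2 :: "('a \<times> 'a) set \<Rightarrow> ('a \<Rightarrow> 'a \<Rightarrow> 'a) \<Rightarrow> 'a set \<Rightarrow> 'a set \<Rightarrow> 'a set" where
  "lift2 R h P Q = (\<Union>a\<in>P. \<Union>b\<in>Q. R `` {h a b})"

text \<open>The lattice congruence generated by collapsing the principal filter \<open>{z. x \<le> z}\<close>.\<close>

definition filter_rel :: "'a brouwer \<Rightarrow> 'a \<Rightarrow> ('a \<times> 'a) set" where
  "filter_rel B x = {(a, b). a \<in> carrier B \<and> b \<in> carrier B
     \<and> (\<exists>z\<in>carrier B. le B x z \<and> meet B a z = meet B b z)}"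

text \<open>
  The lattice congruence \<^const>\<open>filter_rel\<close> is in general not compatible with \<^const>\<open>imp\<close>:
  the implication of the quotient is the one of the interval \<open>[zero, x]\<close>, with which the
  quotient is identified via \<open>a \<mapsto> meet B a x\<close>. Hence \<open>a\<close> and \<open>b\<close> are first moved into
  that interval. By \<open>brouwer_algebra_quotient\<close> below, this is the unique implication turning the
  quotient lattice into a Brouwer algebra.
\<close>

definition quotient :: "'a brouwer \<Rightarrow> 'a \<Rightarrow> 'a set brouwer" (infixl "'/\<^sub>B" 70) where
  "B /\<^sub>B x = (let R = filter_rel B x in
     \<lparr>carrier = carrier B // R,
      join = lift2 R (join B),
      meet = lift2 R (meet B),
      imp = lift2 R (\<lambda>a b. imp B (meet B a x) (meet B b x)),
      zero = R `` {zero B},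
      one = R `` {one B}\<rparr>)"

context brouwer_algebra
begin

lemma meet_idem: "a \<in> carrier B \<Longrightarrow> meet B a a = a"
  by (metis closed(2) join_absorb meet_absorb)

lemma join_idem: "a \<in> carrier B \<Longrightarrow> join B a a = a"
  by (metis closed(1) join_absorb meet_absorb)

lemma le_iff_meet: "\<lbrakk>a \<in> carrier B; b \<in> carrier B\<rbrakk> \<Longrightarrow> le B a b \<longleftrightarrow> meet B a b = a"
  unfolding le_def by (metis join_absorb join_commute meet_absorb meet_commute)

lemma filter_rel_iff:
  assumes x: "x \<in> carrier B"
  shows "(a, b) \<in> filter_rel B x \<longleftrightarrow> a \<in> carrier B \<and> b \<in> carrier B \<and> meet B a x = meet B b x"
proof -
  have "meet B a x = meet B b x"
    if "a \<in> carrier B" "b \<in> carrier B" "z \<in> carrier B" "le B x z" "meet B a z = meet B b z" for z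
    using that x by (metis le_iff_meet meet_assoc meet_commute)
  then show ?thesis
    unfolding filter_rel_def using x join_idem by (auto simp: le_def)
qed

lemma equiv_filter_rel:
  assumes x: "x \<in> carrier B"
  shows "equiv (carrier B) (filter_rel B x)"
  by (rule equivI) (auto simp: refl_on_def sym_def trans_def filter_rel_iff[OF x])

lemma imp_le: "\<lbrakk>a \<in> carrier B; b \<in> carrier B\<rbrakk> \<Longrightarrow> le B (imp B a b) b"
proof -
  assume ab: "a \<in> carrier B" "b \<in> carrier B"
  have "le B b (join B a b)"
    using ab by (metis closed(1) join_commute le_iff_meet meet_absorb)
  then show ?thesis using ab residuation by blast
qed

lemma lift2_class:
  assumes x: "x \<in> carrier B" and a: "a \<in> carrier B" and b: "b \<in> carrier B"
    and h: "\<And>a b. \<lbrakk>a \<in> carrier B; b \<in> carrier B\<rbrakk> \<Longrightarrow> h a b \<in> carrier B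
      \<and> meet B (h a b) x = k (meet B a x) (meet B b x)"
  shows "lift2 (filter_rel B x) h (filter_rel B x `` {a}) (filter_rel B x `` {b})
         = filter_rel B x `` {h a b}"
proof -
  have R: "equiv (carrier B) (filter_rel B x)" by (rule equiv_filter_rel[OF x])
  have *: "filter_rel B x `` {h a' b'} = filter_rel B x `` {h a b}"
    if "(a, a') \<in> filter_rel B x" "(b, b') \<in> filter_rel B x" for a' b'
    using that h a b by (intro equiv_class_eq[OF R]) (auto simp: filter_rel_iff[OF x])
  have "(a, a) \<in> filter_rel B x" "(b, b) \<in> filter_rel B x"
    using a b by (auto simp: filter_rel_iff[OF x])
  then show ?thesis unfolding lift2_def using * by blast
qed

lemma brouwer_algebra_quotient:
  assumes x: "x \<in> carrier B"
  shows "brouwer_algebra (B /\<^sub>B x)"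
proof -
  define R where "R = filter_rel B x"
  define r where "r = (\<lambda>a. meet B a x)"
  define i where "i = (\<lambda>a b. imp B (r a) (r b))"
  let ?C = "carrier B"
  have r: "r a \<in> ?C" if "a \<in> ?C" for a using that x by (auto simp: r_def)
  have eq: "R `` {a} = R `` {b} \<longleftrightarrow> r a = r b" if "a \<in> ?C" "b \<in> ?C" for a b
    using eq_equiv_class_iff[OF equiv_filter_rel[OF x] that] that
    by (auto simp: filter_rel_iff[OF x] R_def r_def)
  have rj: "r (join B a b) = join B (r a) (r b)" if "a \<in> ?C" "b \<in> ?C" for a b
    using that x by (simp add: r_def distrib)
  have rm: "r (meet B a b) = meet B (r a) (r b)" if "a \<in> ?C" "b \<in> ?C" for a b
    using that x unfolding r_def by (metis closed(2) meet_assoc meet_commute meet_idem)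
  have ri: "r (i a b) = i a b" if "a \<in> ?C" "b \<in> ?C" for a b
  proof -
    have "meet B (i a b) (r b) = i a b"
      using that r imp_le le_iff_meet by (auto simp: i_def)
    moreover have "meet B (r b) x = r b"
      using that x by (simp add: r_def meet_assoc meet_idem)
    ultimately show ?thesis
      using that r x meet_assoc unfolding i_def r_def by (metis closed(3))
  qed
  have rr: "r (r a) = r a" if "a \<in> ?C" for a
    using that x by (simp add: r_def meet_assoc meet_idem)
  have i: "i a b \<in> ?C" if "a \<in> ?C" "b \<in> ?C" for a b
    using that r by (auto simp: i_def)
  have cl [simp]: "R `` {a} \<in> ?C // R" if "a \<in> ?C" for a using that by (rule quotientI)
  have J: "lift2 R (join B) (R `` {a}) (R `` {b}) = R `` {join B a b}" if "a \<in> ?C" "b \<in> ?C" for a b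
    unfolding R_def using rj
    by (intro lift2_class[OF x that, where k = "join B"]) (auto simp: r_def)
  have M: "lift2 R (meet B) (R `` {a}) (R `` {b}) = R `` {meet B a b}" if "a \<in> ?C" "b \<in> ?C" for a b
    unfolding R_def using rm
    by (intro lift2_class[OF x that, where k = "meet B"]) (auto simp: r_def)
  have I: "lift2 R i (R `` {a}) (R `` {b}) = R `` {i a b}" if "a \<in> ?C" "b \<in> ?C" for a b
    unfolding R_def using i ri
    by (intro lift2_class[OF x that, where k = "imp B"]) (auto simp: r_def i_def)
  have Q: "B /\<^sub>B x = \<lparr>carrier = ?C // R, join = lift2 R (join B), meet = lift2 R (meet B),
      imp = lift2 R i, zero = R `` {zero B}, one = R `` {one B}\<rparr>"
    by (simp add: quotient_def Let_def R_def i_def r_def)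
  have L: "le (B /\<^sub>B x) (R `` {a}) (R `` {b}) \<longleftrightarrow> le B (r a) (r b)" if "a \<in> ?C" "b \<in> ?C" for a b
    using that by (simp add: le_def Q J eq rj)
  note rep = quotientE[of _ ?C R]
  show ?thesis
  proof (unfold_locales, goal_cases)
    case (1 P Q) then show ?case by (auto simp: Q J elim!: rep)
  next
    case (2 P Q) then show ?case by (auto simp: Q M elim!: rep)
  next
    case (3 P Q) then show ?case by (auto simp: Q I i elim!: rep)
  next
    case (6 P Q) then show ?case by (auto simp: Q J join_commute elim!: rep)
  next
    case (7 P Q) then show ?case by (auto simp: Q M meet_commute elim!: rep)
  next
    case (8 P Q S) then show ?case by (auto simp: Q J join_assoc elim!: rep)
  next
    case (9 P Q S) then show ?case by (auto simp: Q M meet_assoc elim!: rep)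
  next
    case (10 P Q) then show ?case by (auto simp: Q J M join_absorb elim!: rep)
  next
    case (11 P Q) then show ?case by (auto simp: Q J M meet_absorb elim!: rep)
  next
    case (12 P Q S) then show ?case by (auto simp: Q J M distrib elim!: rep)
  next
    case (13 P)
    then obtain a where a: "a \<in> ?C" "P = R `` {a}" by (auto simp: Q elim: rep)
    have "r (join B (zero B) a) = r a" using zero_least[OF a(1)] by (simp add: le_def)
    then show ?case using a by (simp add: le_def Q J eq)
  next
    case (14 P)
    then obtain a where a: "a \<in> ?C" "P = R `` {a}" by (auto simp: Q elim: rep)
    have "r (join B a (one B)) = r (one B)" using one_greatest[OF a(1)] by (simp add: le_def)
    then show ?case using a by (simp add: le_def Q J eq)
  next
    case (15 P P' S)
    then obtain a b c where a: "a \<in> ?C" "P = R `` {a}" and b: "b \<in> ?C" "P' = R `` {b}"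
      and c: "c \<in> ?C" "S = R `` {c}" by (auto simp: Q elim!: rep)
    have "le (B /\<^sub>B x) P' (join (B /\<^sub>B x) P S) \<longleftrightarrow> le B (r b) (join B (r a) (r c))"
      using a b c L[of b "join B a c"] rj by (simp add: Q J)
    also have "\<dots> \<longleftrightarrow> le B (i a b) (r c)"
      using a b c r residuation by (simp add: i_def)
    also have "\<dots> \<longleftrightarrow> le (B /\<^sub>B x) (imp (B /\<^sub>B x) P P') S"
      using a b c i ri L[of "i a b" c] by (simp add: Q I)
    finally show ?case .
  qed (auto simp: Q)
qed

end

section \<open>The Medvedev lattice\<close>

definition medvedev_le :: "(nat \<Rightarrow> nat) set \<Rightarrow> (nat \<Rightarrow> nat) set \<Rightarrow> bool" (infix "\<le>\<^sub>M" 50) where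
  "X \<le>\<^sub>M Y \<longleftrightarrow> (\<exists>n. \<forall>f\<in>Y. \<exists>g\<in>X. Phi n f = Some \<circ> g)"

definition medvedev_rel :: "((nat \<Rightarrow> nat) set \<times> (nat \<Rightarrow> nat) set) set" where
  "medvedev_rel = {(X, Y). X \<le>\<^sub>M Y \<and> Y \<le>\<^sub>M X}"

primrec subst_oracle :: "code \<Rightarrow> code \<Rightarrow> code" where
  "subst_oracle Zero d = Zero"
| "subst_oracle Succ d = Succ"
| "subst_oracle Fst d = Fst"
| "subst_oracle Snd d = Snd"
| "subst_oracle Oracle d = d"
| "subst_oracle (Tuple a b) d = Tuple (subst_oracle a d) (subst_oracle b d)"
| "subst_oracle (Comp a b) d = Comp (subst_oracle a d) (subst_oracle b d)"
| "subst_oracle (Prec a b) d = Prec (subst_oracle a d) (subst_oracle b d)"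
| "subst_oracle (Mu a) d = Mu (subst_oracle a d)"

lemma eval_subst_oracle:
  assumes "eval d f = Some \<circ> g"
  shows "eval (subst_oracle c d) f = eval c g"
  by (induction c) (rule ext, simp add: assms)+

lemma Phi_compose: "\<exists>k. \<forall>f g h. Phi m f = Some \<circ> g \<longrightarrow> Phi n g = Some \<circ> h \<longrightarrow> Phi k f = Some \<circ> h"
proof -
  obtain k where "code_of k = subst_oracle (code_of n) (code_of m)"
    using surj_code_of by (metis surjD)
  then show ?thesis
    by (intro exI[of _ k]) (simp add: Phi_def eval_subst_oracle)
qed

lemma medvedev_le_refl: "X \<le>\<^sub>M X"
proof -
  have "Phi 4 f = Some \<circ> f" for f
    by (simp add: Phi_def code_of.simps fun_eq_iff)
  then show ?thesis unfolding medvedev_le_def by blast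
qed

lemma medvedev_le_trans:
  assumes "X \<le>\<^sub>M Y" "Y \<le>\<^sub>M Z"
  shows "X \<le>\<^sub>M Z"
proof -
  obtain m n where m: "\<forall>f\<in>Z. \<exists>g\<in>Y. Phi m f = Some \<circ> g" and n: "\<forall>g\<in>Y. \<exists>h\<in>X. Phi n g = Some \<circ> h"
    using assms unfolding medvedev_le_def by blast
  obtain k where "\<forall>f g h. Phi m f = Some \<circ> g \<longrightarrow> Phi n g = Some \<circ> h \<longrightarrow> Phi k f = Some \<circ> h"
    using Phi_compose by blast
  then show ?thesis unfolding medvedev_le_def using m n by metis
qed

lemma equiv_medvedev_rel: "equiv UNIV medvedev_rel"
  by (rule equivI)
    (auto simp: refl_on_def sym_def trans_def medvedev_rel_def
      intro: medvedev_le_refl medvedev_le_trans)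

abbreviation prepend :: "nat \<Rightarrow> (nat \<Rightarrow> nat) \<Rightarrow> nat \<Rightarrow> nat" (infixr "\<^bold>\<frown>" 65) where
  "i \<^bold>\<frown> f \<equiv> case_nat i f"

definition fjoin :: "(nat \<Rightarrow> nat) \<Rightarrow> (nat \<Rightarrow> nat) \<Rightarrow> nat \<Rightarrow> nat" (infixl "\<oplus>" 65) where
  "(f \<oplus> g) n = (if even n then f (n div 2) else g (n div 2))"

definition mp_join :: "(nat \<Rightarrow> nat) set \<Rightarrow> (nat \<Rightarrow> nat) set \<Rightarrow> (nat \<Rightarrow> nat) set" where
  "mp_join X Y = {f \<oplus> g |f g. f \<in> X \<and> g \<in> Y}"

definition mp_meet :: "(nat \<Rightarrow> nat) set \<Rightarrow> (nat \<Rightarrow> nat) set \<Rightarrow> (nat \<Rightarrow> nat) set" where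
  "mp_meet X Y = {0 \<^bold>\<frown> f |f. f \<in> X} \<union> {1 \<^bold>\<frown> g |g. g \<in> Y}"

definition mp_imp :: "(nat \<Rightarrow> nat) set \<Rightarrow> (nat \<Rightarrow> nat) set \<Rightarrow> (nat \<Rightarrow> nat) set" where
  "mp_imp X Y = {n \<^bold>\<frown> f |n f. \<forall>g\<in>X. \<exists>h\<in>Y. Phi n (f \<oplus> g) = Some \<circ> h}"

definition degree :: "(nat \<Rightarrow> nat) set \<Rightarrow> (nat \<Rightarrow> nat) set set" where
  "degree X = medvedev_rel `` {X}"

definition Medvedev :: "(nat \<Rightarrow> nat) set set brouwer" where
  "Medvedev =
     \<lparr>carrier = UNIV // medvedev_rel,
      join = lift2 medvedev_rel mp_join,
      meet = lift2 medvedev_rel mp_meet,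
      imp = lift2 medvedev_rel mp_imp,
      zero = degree UNIV,
      one = degree {}\<rparr>"

section \<open>Propositional logic\<close>

datatype form =
    Var nat
  | Bot
  | Conj form form
  | Disj form form
  | Impl form form

text \<open>Conjunction is read as join, disjunction as meet, and truth as \<^const>\<open>zero\<close>.\<close>

primrec value_of :: "'a brouwer \<Rightarrow> (nat \<Rightarrow> 'a) \<Rightarrow> form \<Rightarrow> 'a" where
  "value_of B v (Var i) = v i"
| "value_of B v Bot = one B"
| "value_of B v (Conj p q) = join B (value_of B v p) (value_of B v q)"
| "value_of B v (Disj p q) = meet B (value_of B v p) (value_of B v q)"
| "value_of B v (Impl p q) = imp B (value_of B v p) (value_of B v q)"

definition Th :: "'a brouwer \<Rightarrow> form set" where
  "Th B = {p. \<forall>v. (\<forall>i. v i \<in> carrier B) \<longrightarrow> value_of B v p = zero B}"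

inductive_set IPC :: "form set" where
  K: "Impl p (Impl q p) \<in> IPC"
| S: "Impl (Impl p (Impl q r)) (Impl (Impl p q) (Impl p r)) \<in> IPC"
| conjE1: "Impl (Conj p q) p \<in> IPC"
| conjE2: "Impl (Conj p q) q \<in> IPC"
| conjI: "Impl p (Impl q (Conj p q)) \<in> IPC"
| disjI1: "Impl p (Disj p q) \<in> IPC"
| disjI2: "Impl q (Disj p q) \<in> IPC"
| disjE: "Impl (Impl p r) (Impl (Impl q r) (Impl (Disj p q) r)) \<in> IPC"
| botE: "Impl Bot p \<in> IPC"
| mp: "\<lbrakk>Impl p q \<in> IPC; p \<in> IPC\<rbrakk> \<Longrightarrow> q \<in> IPC"

end

theory Submission
  imports Defs
begin

text \<open>
  One inclusion is soundness of intuitionistic logic in Brouwer algebras. For the other, a formula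
  outside \<^const>\<open>IPC\<close> is refuted in a finite Kripke model, which is unravelled into a simplicial
  complex: worlds are the finite vertex sets ordered by inclusion, and falsum holds exactly at the
  non-faces, whose generators are sets \<open>e k\<close> of vertices.

  Such a complex is found below the given degree. By a construction in the style of Posner and
  Robinson every vertex \<open>u\<close> gets a function that computes column \<open>k\<close> of \<open>A\<close> for \<open>u \<notin> e k\<close>, while
  for \<open>u \<in> e k\<close> it does not compute column \<open>k\<close> but computes all of \<open>A\<close> when joined with it; it
  computes no element of \<open>\<E>\<close> either. Above these functions, leaving out the functions that compute
  all columns or an element of \<open>\<E>\<close>, the cones are disjoint and the condition imposed by column
  \<open>k\<close> is exactly avoidance of the cones of the vertices in \<open>e k\<close>. The world \<open>J\<close> becomes the mass
  problem of avoiding the cones of the vertices in \<open>J\<close>. These problems are closed upwards under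
  Turing reducibility and contain \<open>\<E>\<close>. Closure upwards makes implications from them distribute over
  meets, since a finite string already determines which component a reduction goes to, and by
  \<open>\<E> \<rightarrow> (\<E> \<rightarrow> \<B>) = \<E> \<rightarrow> \<B>\<close> the component \<open>\<D>\<close> behaves like falsum.
\<close>

text \<open>A finite complex has to serve infinitely many columns, so a non-face is repeated from
  some index on and a vertex can have infinitely many keys; one function must join with each of them
  up to \<open>A\<close>. In the coding a key tells its holder whether a splitting exists. With
  several keys, the questions put to all of them must receive one common answer, and this answer
  must be the truth. Independence supplies such questions for finitely many keys at once; block
  \<open>s\<close> serves the keys below \<open>s\<close>, and a holder has the finitely many other
  blocks wired in.

  The join has to reach all of \<open>A\<close>: then an oracle above a vertex that computes one
  missing column computes every column and falls into the part left out.

  Implications from \<open>b K\<close> rest on self-application: if all \<open>f \<oplus> g\<close>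
  with \<open>g\<close> in \<open>b K\<close> avoid the cone of some \<open>u\<close> outside
  \<open>K\<close>, then \<open>f \<oplus> h\<close> cannot lie in that cone, for it would itself be
  an argument from \<open>b K\<close>. Here \<open>h\<close> has to come from \<open>b {}\<close>.
  Hence everything is compared after joining with \<open>b {}\<close>, which costs nothing: the
  value of a valid formula is below \<open>b {}\<close> anyway.\<close>

type_synonym baire = "nat \<Rightarrow> nat"

section \<open>Total computable functionals\<close>

abbreviation pr :: "nat \<Rightarrow> nat \<Rightarrow> nat" where "pr a b \<equiv> prod_encode (a, b)"
abbreviation p1 :: "nat \<Rightarrow> nat" where "p1 x \<equiv> fst (prod_decode x)"
abbreviation p2 :: "nat \<Rightarrow> nat" where "p2 x \<equiv> snd (prod_decode x)"

lemma pr_inject [simp]: "pr a b = pr c d \<longleftrightarrow> a = c \<and> b = d"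
  by (simp add: prod_encode_eq)

text \<open>One code has to serve all oracles: a Medvedev reduction needs the same code for every
  member of a mass problem, and only so can these functionals be substituted into one another's
  oracles.\<close>

definition cf :: "(baire \<Rightarrow> nat \<Rightarrow> nat) \<Rightarrow> bool" where
  "cf F \<longleftrightarrow> (\<exists>c. \<forall>f x. eval c f x = Some (F f x))"

definition cp :: "(baire \<Rightarrow> nat \<Rightarrow> bool) \<Rightarrow> bool" where
  "cp P \<longleftrightarrow> cf (\<lambda>f x. of_bool (P f x))"

lemma cfE:
  assumes "cf F" obtains c where "\<And>f x. eval c f x = Some (F f x)"
  using assms unfolding cf_def by blast

named_theorems cf_intros

lemma cf_id [cf_intros]: "cf (\<lambda>f x. x)"
  unfolding cf_def by (rule exI[of _ "Tuple Fst Snd"]) simp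

lemma cf_comp: "\<lbrakk>cf G; cf F\<rbrakk> \<Longrightarrow> cf (\<lambda>f x. G f (F f x))"
proof -
  assume "cf G" "cf F"
  then obtain c d where "\<And>f x. eval c f x = Some (G f x)" "\<And>f x. eval d f x = Some (F f x)"
    by (auto elim!: cfE)
  then show ?thesis unfolding cf_def by (intro exI[of _ "Comp c d"]) simp
qed

lemma cf_Suc [cf_intros]: "cf F \<Longrightarrow> cf (\<lambda>f x. Suc (F f x))"
  by (rule cf_comp[of "\<lambda>f x. Suc x"]) (auto simp: cf_def intro: exI[of _ Succ])

lemma cf_p1 [cf_intros]: "cf F \<Longrightarrow> cf (\<lambda>f x. p1 (F f x))"
  by (rule cf_comp[of "\<lambda>f x. p1 x"]) (auto simp: cf_def intro: exI[of _ Fst])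

lemma cf_p2 [cf_intros]: "cf F \<Longrightarrow> cf (\<lambda>f x. p2 (F f x))"
  by (rule cf_comp[of "\<lambda>f x. p2 x"]) (auto simp: cf_def intro: exI[of _ Snd])

lemma cf_oracle [cf_intros]: "cf F \<Longrightarrow> cf (\<lambda>f x. f (F f x))"
  by (rule cf_comp[of "\<lambda>f x. f x"]) (auto simp: cf_def intro: exI[of _ Oracle])

lemma cf_const [cf_intros]: "cf (\<lambda>f x. k)"
proof (induction k)
  case 0 show ?case unfolding cf_def by (rule exI[of _ Zero]) simp
qed (rule cf_Suc)

lemma cf_pair [cf_intros]: "\<lbrakk>cf F; cf G\<rbrakk> \<Longrightarrow> cf (\<lambda>f x. pr (F f x) (G f x))"
proof -
  assume "cf F" "cf G"
  then obtain c d where "\<And>f x. eval c f x = Some (F f x)" "\<And>f x. eval d f x = Some (G f x)"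
    by (auto elim!: cfE)
  then show ?thesis unfolding cf_def by (intro exI[of _ "Tuple c d"]) simp
qed

text \<open>The step function is required to be computable in one packed argument, nested as
  \<open>Prec\<close> hands it over: parameter, counter, previous value.\<close>

lemma cf_rec:
  assumes F: "cf F" and G: "cf (\<lambda>f z. G f (p1 z) (p1 (p2 z)) (p2 (p2 z)))" and N: "cf N"
  shows "cf (\<lambda>f x. rec_nat (F f x) (\<lambda>k r. G f x k r) (N f x))"
proof -
  obtain c d where c: "\<And>f x. eval c f x = Some (F f x)"
    and d: "\<And>f z. eval d f z = Some (G f (p1 z) (p1 (p2 z)) (p2 (p2 z)))"
    using F G by (auto elim!: cfE)
  have "eval (Prec c d) f (pr x n) = Some (rec_nat (F f x) (\<lambda>k r. G f x k r) n)" for f x n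
    by (induction n) (simp_all add: c d)
  then have "cf (\<lambda>f z. rec_nat (F f (p1 z)) (\<lambda>k r. G f (p1 z) k r) (p2 z))"
    unfolding cf_def by (metis prod.collapse prod_decode_inverse)
  from cf_comp[OF this cf_pair[OF cf_id N]] show ?thesis by simp
qed

lemma cf_app1: "cf (\<lambda>f x. G x) \<Longrightarrow> cf F \<Longrightarrow> cf (\<lambda>f x. G (F f x))"
  by (rule cf_comp[of "\<lambda>f. G"])

lemma cf_pred [cf_intros]: "cf F \<Longrightarrow> cf (\<lambda>f x. F f x - 1)"
proof (rule cf_app1[of "\<lambda>x. x - 1"])
  have "cf (\<lambda>f x. rec_nat 0 (\<lambda>k r. k) x)" by (intro cf_rec cf_intros)
  moreover have "rec_nat 0 (\<lambda>k r. k) x = x - 1" for x :: nat by (cases x) auto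
  ultimately show "cf (\<lambda>f x. x - 1)" by simp
qed

lemma cf_add [cf_intros]: "\<lbrakk>cf F; cf G\<rbrakk> \<Longrightarrow> cf (\<lambda>f x. F f x + G f x)"
proof -
  have "rec_nat a (\<lambda>k r. Suc r) b = a + b" for a b :: nat by (induction b) auto
  moreover have "\<lbrakk>cf F; cf G\<rbrakk> \<Longrightarrow> cf (\<lambda>f x. rec_nat (F f x) (\<lambda>k r. Suc r) (G f x))"
    by (intro cf_rec cf_intros)
  ultimately show "\<lbrakk>cf F; cf G\<rbrakk> \<Longrightarrow> ?thesis" by simp
qed

lemma cf_diff [cf_intros]: "\<lbrakk>cf F; cf G\<rbrakk> \<Longrightarrow> cf (\<lambda>f x. F f x - G f x)"
proof -
  have "rec_nat a (\<lambda>k r. r - 1) b = a - b" for a b :: nat by (induction b) auto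
  moreover have "\<lbrakk>cf F; cf G\<rbrakk> \<Longrightarrow> cf (\<lambda>f x. rec_nat (F f x) (\<lambda>k r. r - 1) (G f x))"
    by (intro cf_rec cf_intros)
  ultimately show "\<lbrakk>cf F; cf G\<rbrakk> \<Longrightarrow> ?thesis" by simp
qed

lemma cf_if [cf_intros]: "\<lbrakk>cp P; cf F; cf G\<rbrakk> \<Longrightarrow> cf (\<lambda>f x. if P f x then F f x else G f x)"
proof -
  assume "cp P" "cf F" "cf G"
  then have "cf (\<lambda>f x. rec_nat (G f x) (\<lambda>k r. F f x) (of_bool (P f x)))"
    unfolding cp_def by (intro cf_rec cf_comp[of F "\<lambda>f z. p1 z"] cf_intros)
  moreover have "rec_nat b (\<lambda>k r. a) (of_bool p) = (if p then a else b)" for a b :: nat and p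
    by auto
  ultimately show ?thesis by simp
qed

lemma cf_of_bool [cf_intros]: "cp P \<Longrightarrow> cf (\<lambda>f x. of_bool (P f x))"
  by (simp add: cp_def)

lemma cp_comp: "cp P \<Longrightarrow> cf F \<Longrightarrow> cp (\<lambda>f x. P f (F f x))"
  unfolding cp_def by (rule cf_comp)

lemma cp_const [cf_intros]: "cp (\<lambda>f x. b)"
  unfolding cp_def by (rule cf_const)

lemma cp_not [cf_intros]: "cp P \<Longrightarrow> cp (\<lambda>f x. \<not> P f x)"
proof -
  assume "cp P"
  then have "cf (\<lambda>f x. if P f x then 0 else 1)" by (intro cf_intros)
  moreover have "(if p then 0 else 1) = (of_bool (\<not> p) :: nat)" for p by simp
  ultimately show ?thesis unfolding cp_def by simp
qed

lemma cp_conj [cf_intros]: "\<lbrakk>cp P; cp Q\<rbrakk> \<Longrightarrow> cp (\<lambda>f x. P f x \<and> Q f x)"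
proof -
  assume "cp P" "cp Q"
  then have "cf (\<lambda>f x. if P f x then of_bool (Q f x) else 0)" by (intro cf_intros)
  moreover have "(if p then of_bool q else 0) = (of_bool (p \<and> q) :: nat)" for p q by simp
  ultimately show ?thesis unfolding cp_def by simp
qed

lemma cp_disj [cf_intros]:
  assumes "cp P" "cp Q" shows "cp (\<lambda>f x. P f x \<or> Q f x)"
  using cp_not[OF cp_conj[OF cp_not[OF assms(1)] cp_not[OF assms(2)]]] by simp

lemma cp_imp [cf_intros]:
  assumes "cp P" "cp Q" shows "cp (\<lambda>f x. P f x \<longrightarrow> Q f x)"
  using cp_disj[OF cp_not[OF assms(1)] assms(2)] by simp

lemma cp_less [cf_intros]: "\<lbrakk>cf F; cf G\<rbrakk> \<Longrightarrow> cp (\<lambda>f x. F f x < G f x)"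
proof -
  assume "cf F" "cf G"
  then have "cf (\<lambda>f x. (1::nat) - (1 - (G f x - F f x)))" by (intro cf_intros)
  moreover have "1 - (1 - (b - a)) = (of_bool (a < b) :: nat)" for a b :: nat by auto
  ultimately show ?thesis unfolding cp_def by simp
qed

lemma cp_le [cf_intros]:
  assumes "cf F" "cf G" shows "cp (\<lambda>f x. F f x \<le> G f x)"
  using cp_not[OF cp_less[OF assms(2,1)]] by (simp add: not_less)

lemma cp_eq [cf_intros]:
  assumes "cf F" "cf G" shows "cp (\<lambda>f x. F f x = G f x)"
  using cp_conj[OF cp_le[OF assms] cp_le[OF assms(2,1)]] by (simp add: eq_iff)

lemma cp_ball:
  assumes P: "cp (\<lambda>f z. P f (p1 z) (p2 z))" and N: "cf N"
  shows "cp (\<lambda>f x. \<forall>k<N f x. P f x k)"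
proof -
  have "cf (\<lambda>f x. rec_nat 1 (\<lambda>k r. if P f x k then r else 0) (N f x))"
  proof (intro cf_rec cf_intros N)
    show "cp (\<lambda>f z. P f (p1 z) (p1 (p2 z)))"
      using cp_comp[OF P, of "\<lambda>f z. pr (p1 z) (p1 (p2 z))"] by (simp add: cf_intros)
  qed
  moreover have "rec_nat 1 (\<lambda>k r. if Q k then r else 0) n = (of_bool (\<forall>k<n. Q k) :: nat)" for Q n
    by (induction n) (auto simp: less_Suc_eq)
  ultimately show ?thesis unfolding cp_def by simp
qed

text \<open>Success is shifted by one so that 0 can stand for failure. This is the format of
  \<open>enc_opt\<close>, in which \<open>cf_beval\<close> needs the bounded search for
  \<open>Mu\<close>.\<close>

lemma cf_bounded_least:
  assumes P: "cp (\<lambda>f z. P f (p1 z) (p2 z))" and N: "cf N"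
  shows "cf (\<lambda>f x. if \<exists>k<N f x. P f x k then Suc (LEAST k. P f x k) else 0)"
proof -
  have P': "cp (\<lambda>f z. P f (p1 z) (p1 (p2 z)))"
    using cp_comp[OF P, of "\<lambda>f z. pr (p1 z) (p1 (p2 z))"] by (simp add: cf_intros)
  have "cf (\<lambda>f x. rec_nat 0 (\<lambda>k r. if r = 0 then (if P f x k then Suc k else 0) else r) (N f x))"
    by (intro cf_rec cf_intros N P')
  moreover have "rec_nat 0 (\<lambda>k r. if r = 0 then (if Q k then Suc k else 0) else r) n
      = (if \<exists>k<n. Q k then Suc (LEAST k. Q k) else 0)" for Q n
  proof (induction n)
    case (Suc n)
    show ?case
    proof (cases "\<exists>k<n. Q k")
      case False
      then have "(LEAST k. Q k) = n" if "Q n" using that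
        by (intro Least_equality) (auto simp: not_less[symmetric])
      then show ?thesis using Suc False by (auto simp: less_Suc_eq)
    next
      case True then show ?thesis using Suc by (auto simp: less_Suc_eq)
    qed
  qed simp
  ultimately show ?thesis by simp
qed

text \<open>The predicate is total, so the definedness clause in the semantics of \<open>Mu\<close>
  is always met and \<open>Mu\<close> stops at the first witness.\<close>

lemma search_code:
  assumes P: "cp (\<lambda>f z. P f (p1 z) (p2 z))"
  obtains c where
    "\<And>f x. eval c f x = (if \<exists>n. P f x n then Some (LEAST n. P f x n) else None)"
proof -
  obtain d where d: "\<And>f z. eval d f z = Some (of_bool (\<not> P f (p1 z) (p2 z)))"
    using cp_not[OF P] unfolding cp_def cf_def by blast
  have "eval (Mu d) f x = (if \<exists>n. P f x n then Some (LEAST n. P f x n) else None)" for f x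
    by (simp add: d Let_def)
  with that show thesis by blast
qed

lemma cf_mod_const [cf_intros]: "cf F \<Longrightarrow> m > 0 \<Longrightarrow> cf (\<lambda>f x. F f x mod m)"
proof (rule cf_app1[of "\<lambda>x. x mod m"])
  assume m: "m > 0"
  have "cf (\<lambda>f x. rec_nat 0 (\<lambda>k r. if Suc r = m then 0 else Suc r) x)"
    by (intro cf_rec cf_intros)
  moreover have "rec_nat 0 (\<lambda>k r. if Suc r = m then 0 else Suc r) x = x mod m" for x
    by (induction x) (use m in \<open>auto simp: mod_Suc\<close>)
  ultimately show "cf (\<lambda>f x. x mod m)" by simp
qed

lemma cf_div_const [cf_intros]: "cf F \<Longrightarrow> m > 0 \<Longrightarrow> cf (\<lambda>f x. F f x div m)"
proof (rule cf_app1[of "\<lambda>x. x div m"])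
  assume m: "m > 0"
  have "cf (\<lambda>f x. rec_nat 0 (\<lambda>k r. if Suc (k mod m) = m then Suc r else r) x)"
    using m by (intro cf_rec cf_intros)
  moreover have "rec_nat 0 (\<lambda>k r. if Suc (k mod m) = m then Suc r else r) x = x div m" for x
    by (induction x) (use m in \<open>auto simp: div_Suc mod_Suc dvd_eq_mod_eq_0\<close>)
  ultimately show "cf (\<lambda>f x. x div m)" by simp
qed

lemma cp_even [cf_intros]: "cf F \<Longrightarrow> cp (\<lambda>f x. even (F f x))"
  by (simp add: even_iff_mod_2_eq_zero) (intro cf_intros; simp)

text \<open>A lookup table with a default value from \<open>m\<close> on, built entry by entry. All
  finite data enter programs in this way: the complex, its coding and the first bits of
  \<open>A\<close>.\<close>

lemma cf_eventually_const:
  assumes "\<And>n. n \<ge> m \<Longrightarrow> h n = h m"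
  shows "cf F \<Longrightarrow> cf (\<lambda>f x. h (F f x))"
proof (rule cf_app1[of h])
  have "cf (\<lambda>f x. if x < k then h x else h m)" for k
  proof (induction k)
    case (Suc k)
    have "cf (\<lambda>f x. if x = k then h k else if x < k then h x else h m)"
      by (intro cf_intros Suc)
    moreover have "(if x = k then h k else if x < k then h x else h m)
        = (if x < Suc k then h x else h m)" for x by auto
    ultimately show ?case by simp
  qed (auto intro: cf_intros)
  from this[of m] show "cf (\<lambda>f x. h x)"
  proof (rule back_subst[of cf], intro ext)
    show "(if x < m then h x else h m) = h x" for x
      using assms[of x] by (cases "x < m") auto
  qed
qed

text \<open>Substitution of an oracle that depends on a parameter, which is carried along in the input.\<close>

primrec psub :: "code \<Rightarrow> code \<Rightarrow> code" where
  "psub Zero d = Zero"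
| "psub Succ d = Comp Succ Snd"
| "psub Fst d = Comp Fst Snd"
| "psub Snd d = Comp Snd Snd"
| "psub Oracle d = d"
| "psub (Tuple a b) d = Tuple (psub a d) (psub b d)"
| "psub (Comp a b) d = Comp (psub a d) (Tuple Fst (psub b d))"
| "psub (Prec a b) d =
     Comp (Prec (psub a d) (Comp (psub b d) (Tuple (Comp Fst Fst) (Tuple (Comp Snd Fst) Snd))))
       (Tuple (Tuple Fst (Comp Fst Snd)) (Comp Snd Snd))"
| "psub (Mu a) d = Mu (Comp (psub a d) (Tuple (Comp Fst Fst) (Tuple (Comp Snd Fst) Snd)))"

lemma eval_psub:
  assumes "\<And>q. eval d f (pr p q) = Some (g q)"
  shows "eval (psub c d) f (pr p x) = eval c g x"
proof (induction c arbitrary: x)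
  case (Prec a b)
  \<comment> \<open>A recursion passes on its own parameter only, so \<open>p\<close> travels paired
    with \<open>y\<close>; the tupling in \<open>psub\<close> restores the nesting
    \<open>pr p (pr y (pr k r))\<close> that \<open>psub b d\<close> expects.\<close>
  have "eval (Prec (psub a d) (Comp (psub b d) (Tuple (Comp Fst Fst) (Tuple (Comp Snd Fst) Snd)))) f
      (pr (pr p y) n) = eval (Prec a b) g (pr y n)" for y n
    by (induction n) (simp_all add: Prec)
  from this[of "p1 x" "p2 x"] show ?case by simp
qed (simp_all add: assms)

lemma eval_param:
  assumes "cf (\<lambda>f z. D f (p1 z) (p2 z))"
  shows "\<exists>d. \<forall>f p x. eval d f (pr p x) = eval c (D f p) x"
proof -
  obtain d where d: "\<forall>f z. eval d f z = Some (D f (p1 z) (p2 z))"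
    using assms unfolding cf_def ..
  have "eval (psub c d) f (pr p x) = eval c (D f p) x" for f p x
    by (rule eval_psub) (simp add: d)
  then show ?thesis by blast
qed

text \<open>For bounded runs whose oracle is assembled from the input, for instance from a string
  that a search has produced.\<close>

lemma cf_param:
  assumes H: "cf H" and D: "cf (\<lambda>f z. D f (p1 z) (p2 z))" and E: "cf E"
  shows "cf (\<lambda>f x. H (\<lambda>q. D f x q) (E f x))"
proof -
  obtain c where c: "\<forall>f x. eval c f x = Some (H f x)" using H unfolding cf_def ..
  obtain d where d: "\<forall>f p x. eval d f (pr p x) = eval c (D f p) x"
    using eval_param[OF D] ..
  obtain e where e: "\<forall>f x. eval e f x = Some (E f x)" using E unfolding cf_def ..
  have "eval (Comp d (Tuple (Tuple Fst Snd) e)) f x = Some (H (\<lambda>q. D f x q) (E f x))" for f x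
    by (simp add: c d e)
  then show ?thesis unfolding cf_def by (intro exI allI)
qed

lemma cf_subst:
  assumes "cf H" "cf D" shows "cf (\<lambda>f x. H (D f) x)"
proof -
  obtain c where c: "\<forall>f x. eval c f x = Some (H f x)" using assms(1) unfolding cf_def ..
  obtain d where d: "\<forall>f x. eval d f x = Some (D f x)" using assms(2) unfolding cf_def ..
  have "eval (subst_oracle c d) f x = Some (H (D f) x)" for f x
    using eval_subst_oracle[of d f "D f" c] by (simp add: c d fun_eq_iff)
  then show ?thesis unfolding cf_def by (intro exI allI)
qed

lemma cp_subst:
  assumes "cp H" "cf D" shows "cp (\<lambda>f x. H (D f) x)"
  using cf_subst[of "\<lambda>f x. of_bool (H f x)" D] assms unfolding cp_def by blast

section \<open>Bounded evaluation\<close>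

text \<open>The bound \<open>s\<close> limits both the searches and the oracle queries, so that \<open>beval c f s x\<close>
  depends on finitely many values of \<open>f\<close> only.\<close>

primrec beval :: "code \<Rightarrow> baire \<Rightarrow> nat \<Rightarrow> nat \<Rightarrow> nat option" where
  "beval Zero f s x = Some 0"
| "beval Succ f s x = Some (Suc x)"
| "beval Fst f s x = Some (p1 x)"
| "beval Snd f s x = Some (p2 x)"
| "beval Oracle f s x = (if x < s then Some (f x) else None)"
| "beval (Tuple c d) f s x =
     Option.bind (beval c f s x) (\<lambda>a. Option.bind (beval d f s x) (\<lambda>b. Some (pr a b)))"
| "beval (Comp c d) f s x = Option.bind (beval d f s x) (beval c f s)"
| "beval (Prec c d) f s x =
     rec_nat (beval c f s (p1 x))
       (\<lambda>k r. Option.bind r (\<lambda>y. beval d f s (pr (p1 x) (pr k y)))) (p2 x)"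
| "beval (Mu c) f s x =
     (let P = \<lambda>n. beval c f s (pr x n) = Some 0 \<and> (\<forall>m<n. beval c f s (pr x m) \<noteq> None)
      in if \<exists>n<s. P n then Some (LEAST n. P n) else None)"

text \<open>Up to its first zero \<open>a\<close> is defined everywhere, so an extension
  \<open>b\<close> takes the same values there and has no earlier zero. Monotonicity, soundness and
  completeness of \<open>beval\<close> all need this for \<open>Mu\<close>.\<close>

lemma least_zero_mono:
  fixes a b :: "nat \<Rightarrow> nat option"
  assumes ab: "\<And>n y. a n = Some y \<Longrightarrow> b n = Some y"
    and n: "a n = Some 0" "\<forall>m<n. a m \<noteq> None"
  shows "(LEAST n. a n = Some 0 \<and> (\<forall>m<n. a m \<noteq> None)) = (LEAST n. b n = Some 0 \<and> (\<forall>m<n. b m \<noteq> None))"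
    and "b n = Some 0 \<and> (\<forall>m<n. b m \<noteq> None)"
proof -
  define P where "P = (\<lambda>n. a n = Some 0 \<and> (\<forall>m<n. a m \<noteq> None))"
  define Q where "Q = (\<lambda>n. b n = Some 0 \<and> (\<forall>m<n. b m \<noteq> None))"
  have nn: "b m \<noteq> None" if "a m \<noteq> None" for m
    using that ab by (metis not_None_eq)
  have PQ: "Q n" if "P n" for n
    using that ab[of n 0] nn unfolding P_def Q_def by blast
  have Pn: "P n" using n unfolding P_def by blast
  obtain p where p: "P p" "\<And>l. P l \<Longrightarrow> p \<le> l" "(LEAST n. P n) = p"
    using LeastI[of P, OF Pn] Least_le[of P] by blast
  have "(LEAST n. Q n) = p"
  proof (rule Least_equality)
    show "Q p" using p(1) by (rule PQ)
    fix l assume l: "Q l"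
    show "p \<le> l"
    proof (rule ccontr)
      assume less: "\<not> p \<le> l"
      have k: "\<forall>m<p. a m \<noteq> None" using p(1) unfolding P_def by blast
      with less obtain y where y: "a l = Some y" by (metis not_None_eq not_le)
      from ab[OF y] l have "y = 0" by (simp add: Q_def)
      moreover have "\<forall>m<l. a m \<noteq> None" using k less by simp
      ultimately have "P l" using y by (simp add: P_def)
      then have "p \<le> l" by (rule p(2))
      with less show False by simp
    qed
  qed
  with p(3) have "(LEAST n. P n) = (LEAST n. Q n)" by simp
  then show "(LEAST n. a n = Some 0 \<and> (\<forall>m<n. a m \<noteq> None)) = (LEAST n. b n = Some 0 \<and> (\<forall>m<n. b m \<noteq> None))"
    unfolding P_def Q_def .
  show "b n = Some 0 \<and> (\<forall>m<n. b m \<noteq> None)" using PQ[OF Pn] by (simp add: Q_def)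
qed

lemma rec_option_mono:
  fixes a b :: "nat option"
  assumes "\<And>y. a = Some y \<Longrightarrow> b = Some y"
    and "\<And>k u y. g k u = Some y \<Longrightarrow> h k u = Some y"
  shows "rec_nat a (\<lambda>k r. Option.bind r (g k)) n = Some y
    \<Longrightarrow> rec_nat b (\<lambda>k r. Option.bind r (h k)) n = Some y"
proof (induction n arbitrary: y)
  case 0 then show ?case using assms(1) by simp
next
  case (Suc n)
  then obtain u where "rec_nat a (\<lambda>k r. Option.bind r (g k)) n = Some u" "g n u = Some y"
    by (auto simp: bind_eq_Some_conv)
  from Suc.IH[OF this(1)] assms(2)[OF this(2)] show ?case by simp
qed

lemma beval_mono: "\<lbrakk>beval c f s x = Some y; s \<le> t\<rbrakk> \<Longrightarrow> beval c f t x = Some y"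
proof (induction c arbitrary: x y)
  case (Prec c d)
  then show ?case by (auto elim!: rec_option_mono[rotated 2])
next
  case (Mu c)
  from Mu.prems(1) obtain n where n: "n < s" "beval c f s (pr x n) = Some 0"
      "\<forall>m<n. beval c f s (pr x m) \<noteq> None"
    and y: "y = (LEAST n. beval c f s (pr x n) = Some 0 \<and> (\<forall>m<n. beval c f s (pr x m) \<noteq> None))"
    by (auto simp: Let_def split: if_splits)
  have *: "\<And>n y. beval c f s (pr x n) = Some y \<Longrightarrow> beval c f t (pr x n) = Some y"
    using Mu by blast
  note L = least_zero_mono[where a = "\<lambda>n. beval c f s (pr x n)" and b = "\<lambda>n. beval c f t (pr x n)", OF * n(2,3)]
  have "n < t" using n(1) Mu.prems(2) by simp
  then have "\<exists>n<t. beval c f t (pr x n) = Some 0 \<and> (\<forall>m<n. beval c f t (pr x m) \<noteq> None)"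
    using L(2) by blast
  then show ?case using L(1) y by (simp add: Let_def)
qed (fastforce simp: bind_eq_Some_conv split: if_splits)+

lemma beval_sound: "beval c f s x = Some y \<Longrightarrow> eval c f x = Some y"
proof (induction c arbitrary: x y)
  case (Prec c d)
  then show ?case by (auto elim!: rec_option_mono[rotated 2])
next
  case (Mu c)
  from Mu.prems obtain n where n: "beval c f s (pr x n) = Some 0"
      "\<forall>m<n. beval c f s (pr x m) \<noteq> None"
    and y: "y = (LEAST n. beval c f s (pr x n) = Some 0 \<and> (\<forall>m<n. beval c f s (pr x m) \<noteq> None))"
    by (auto simp: Let_def split: if_splits)
  have *: "\<And>n y. beval c f s (pr x n) = Some y \<Longrightarrow> eval c f (pr x n) = Some y"
    using Mu by blast
  note L = least_zero_mono[where a = "\<lambda>n. beval c f s (pr x n)" and b = "\<lambda>n. eval c f (pr x n)", OF * n]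
  have "\<exists>n. eval c f (pr x n) = Some 0 \<and> (\<forall>m<n. eval c f (pr x m) \<noteq> None)"
    using L(2) by blast
  then show ?case using L(1) y by (simp add: Let_def)
qed (fastforce simp: bind_eq_Some_conv split: if_splits)+

lemma common_bound:
  assumes "\<And>i s t. \<lbrakk>i < n; P i s; s \<le> t\<rbrakk> \<Longrightarrow> P i t" "\<And>i. i < n \<Longrightarrow> \<exists>s. P i s"
  shows "\<exists>s::nat. \<forall>i<(n::nat). P i s"
  using assms
proof (induction n)
  case (Suc n)
  then obtain s where "\<forall>i<n. P i s" by (meson less_Suc_eq)
  moreover obtain t where "P n t" using Suc.prems(2) by blast
  ultimately have "\<forall>i<Suc n. P i (max s t)"
    using Suc.prems(1) by (metis less_Suc_eq max.cobounded1 max.cobounded2)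
  then show ?case ..
qed simp

lemma beval_complete: "eval c f x = Some y \<Longrightarrow> \<exists>s. beval c f s x = Some y"
proof (induction c arbitrary: x y)
  case Oracle then show ?case by (auto intro: exI[of _ "Suc x"])
next
  case (Tuple c d)
  then obtain a b where "eval c f x = Some a" "eval d f x = Some b" "y = pr a b"
    by (auto simp: bind_eq_Some_conv)
  then obtain s t where "beval c f s x = Some a" "beval d f t x = Some b" using Tuple.IH by blast
  then have "beval (Tuple c d) f (max s t) x = Some y"
    using beval_mono[of _ f _ x _ "max s t"] \<open>y = pr a b\<close> by simp
  then show ?case ..
next
  case (Comp c d)
  then obtain a where "eval d f x = Some a" "eval c f a = Some y"
    by (auto simp: bind_eq_Some_conv)
  then obtain s t where "beval d f s x = Some a" "beval c f t a = Some y" using Comp.IH by blast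
  then have "beval (Comp c d) f (max s t) x = Some y"
    using beval_mono[of d f s x a "max s t"] beval_mono[of c f t a y "max s t"] by simp
  then show ?case ..
next
  case (Prec c d)
  have "\<exists>s. beval (Prec c d) f s (pr u n) = Some y" if "eval (Prec c d) f (pr u n) = Some y" for u n y
    using that
  proof (induction n arbitrary: y)
    case 0 then show ?case using Prec.IH(1) by simp
  next
    case (Suc n)
    then obtain a where a: "eval (Prec c d) f (pr u n) = Some a" "eval d f (pr u (pr n a)) = Some y"
      by (auto simp: bind_eq_Some_conv)
    then obtain s t where st: "beval (Prec c d) f s (pr u n) = Some a" "beval d f t (pr u (pr n a)) = Some y"
      using Suc.IH Prec.IH(2) by blast
    have "beval (Prec c d) f (max s t) (pr u (Suc n)) = Some y"
      using beval_mono[OF st(1), of "max s t"] beval_mono[OF st(2), of "max s t"] by simp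
    then show ?case ..
  qed
  from this[of "p1 x" "p2 x" y] Prec.prems show ?case by (simp del: beval.simps eval.simps)
next
  case (Mu c)
  let ?P = "\<lambda>n. eval c f (pr x n) = Some 0 \<and> (\<forall>m<n. eval c f (pr x m) \<noteq> None)"
  from Mu.prems have ex: "\<exists>n. ?P n" and y: "y = (LEAST n. ?P n)"
    by (auto simp: Let_def split: if_splits)
  have P: "?P y" unfolding y using ex by (rule LeastI_ex)
  have def: "\<exists>v. eval c f (pr x i) = Some v" if "i < Suc y" for i
    using that P by (cases "i = y") auto
  have "\<exists>s. beval c f s (pr x i) = eval c f (pr x i)" if "i < Suc y" for i
    using def[OF that] Mu.IH by metis
  moreover have up: "beval c f t (pr x i) = eval c f (pr x i)"
    if "i < Suc y" "beval c f s (pr x i) = eval c f (pr x i)" "s \<le> t" for i s t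
    using def[OF that(1)] that(2,3) beval_mono by metis
  ultimately obtain s where s: "\<forall>i<Suc y. beval c f s (pr x i) = eval c f (pr x i)"
    using common_bound[of "Suc y" "\<lambda>i s. beval c f s (pr x i) = eval c f (pr x i)"] by blast
  \<comment> \<open>The bound limits the search as well as the runs, so it must also exceed the
    result \<open>y\<close>.\<close>
  define t where "t = max s (Suc y)"
  have t: "beval c f t (pr x i) = eval c f (pr x i)" if "i < Suc y" for i
    using up[OF that _ max.cobounded1] s that unfolding t_def by blast
  have Pt: "beval c f t (pr x y) = Some 0 \<and> (\<forall>m<y. beval c f t (pr x m) \<noteq> None)"
    using t P by simp
  have "y < t" by (simp add: t_def less_max_iff_disj)
  with Pt have ex': "\<exists>n<t. beval c f t (pr x n) = Some 0 \<and> (\<forall>m<n. beval c f t (pr x m) \<noteq> None)" by blast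
  have "(LEAST n. beval c f t (pr x n) = Some 0 \<and> (\<forall>m<n. beval c f t (pr x m) \<noteq> None)) = y"
    using least_zero_mono(1)[where a = "\<lambda>n. beval c f t (pr x n)" and b = "\<lambda>n. eval c f (pr x n)" and n = y]
      Pt beval_sound y by blast
  with ex' have "beval (Mu c) f t x = Some y" by (simp add: Let_def)
  then show ?case ..
qed auto

lemma beval_cong: "(\<And>k. k < s \<Longrightarrow> f k = g k) \<Longrightarrow> beval c f s x = beval c g s x"
proof -
  assume *: "\<And>k. k < s \<Longrightarrow> f k = g k"
  have "beval c f s = beval c g s" by (induction c) (rule ext, simp add: *)+
  then show ?thesis by simp
qed

definition enc_opt :: "nat option \<Rightarrow> nat" where
  "enc_opt r = (case r of None \<Rightarrow> 0 | Some y \<Rightarrow> Suc y)"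

lemma enc_opt_simps [simp]:
  "enc_opt None = 0" "enc_opt (Some y) = Suc y" "enc_opt r = 0 \<longleftrightarrow> r = None"
  "enc_opt r = Suc y \<longleftrightarrow> r = Some y" "0 < enc_opt r \<longleftrightarrow> r \<noteq> None"
  by (auto simp: enc_opt_def split: option.splits)

lemma enc_opt_inject [simp]: "enc_opt r = enc_opt r' \<longleftrightarrow> r = r'"
  by (cases r; cases r') auto

text \<open>Convergence of a bounded run is decidable, uniformly in oracle, bound and argument. This
  turns the forcing of a value by a finite string into a condition that a program can search
  for.\<close>

lemma cf_beval: "cf (\<lambda>f z. enc_opt (beval c f (p1 z) (p2 z)))"
proof (induction c)
  case Oracle
  have "cf (\<lambda>f z. if p2 z < p1 z then Suc (f (p2 z)) else 0)" by (intro cf_intros)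
  then show ?case by (simp add: if_distrib cong: if_cong)
next
  case (Tuple c d)
  have "cf (\<lambda>f z. if enc_opt (beval c f (p1 z) (p2 z)) = 0 \<or> enc_opt (beval d f (p1 z) (p2 z)) = 0 then 0
     else Suc (pr (enc_opt (beval c f (p1 z) (p2 z)) - 1) (enc_opt (beval d f (p1 z) (p2 z)) - 1)))"
    by (intro cf_intros Tuple)
  moreover have "(if enc_opt (beval c f s x) = 0 \<or> enc_opt (beval d f s x) = 0 then 0
      else Suc (pr (enc_opt (beval c f s x) - 1) (enc_opt (beval d f s x) - 1)))
      = enc_opt (beval (Tuple c d) f s x)" for f s x
    by (cases "beval c f s x"; cases "beval d f s x") auto
  ultimately show ?case by simp
next
  case (Comp c d)
  have "cf (\<lambda>f z. enc_opt (beval c f (p1 z) (enc_opt (beval d f (p1 z) (p2 z)) - 1)))"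
    using cf_comp[OF Comp(1) cf_pair[OF cf_p1[OF cf_id] cf_pred[OF Comp(2)]]] by simp
  then have "cf (\<lambda>f z. if enc_opt (beval d f (p1 z) (p2 z)) = 0 then 0
      else enc_opt (beval c f (p1 z) (enc_opt (beval d f (p1 z) (p2 z)) - 1)))"
    by (intro cf_intros Comp)
  moreover have "(if enc_opt (beval d f s x) = 0 then 0
      else enc_opt (beval c f s (enc_opt (beval d f s x) - 1))) = enc_opt (beval (Comp c d) f s x)" for f s x
    by (cases "beval d f s x") auto
  ultimately show ?case by simp
next
  case (Prec c d)
  have 1: "cf (\<lambda>f z. enc_opt (beval c f (p1 z) (p1 (p2 z))))"
    using cf_comp[OF Prec(1) cf_pair[OF cf_p1[OF cf_id] cf_p1[OF cf_p2[OF cf_id]]]] by simp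
  have "cf (\<lambda>f z. pr (p1 (p1 z)) (pr (p1 (p2 (p1 z))) (pr (p1 (p2 z)) (p2 (p2 z) - 1))))"
    by (intro cf_intros)
  from cf_comp[OF Prec(2) this]
  have 2: "cf (\<lambda>f z. enc_opt (beval d f (p1 (p1 z)) (pr (p1 (p2 (p1 z))) (pr (p1 (p2 z)) (p2 (p2 z) - 1)))))"
    by simp
  have "cf (\<lambda>f z. rec_nat (enc_opt (beval c f (p1 z) (p1 (p2 z))))
     (\<lambda>k r. if r = 0 then 0 else enc_opt (beval d f (p1 z) (pr (p1 (p2 z)) (pr k (r - 1))))) (p2 (p2 z)))"
    by (intro cf_rec cf_intros 1 2)
  moreover have "rec_nat (enc_opt (beval c f s u))
     (\<lambda>k r. if r = 0 then 0 else enc_opt (beval d f s (pr u (pr k (r - 1))))) n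
     = enc_opt (beval (Prec c d) f s (pr u n))" for f s u n
  proof (induction n)
    case (Suc n)
    then show ?case by (cases "beval (Prec c d) f s (pr u n)") auto
  qed simp
  ultimately show ?case by (simp del: beval.simps)
next
  case (Mu c)
  let ?E = "\<lambda>f s x n. enc_opt (beval c f s (pr x n))"
  have "cf (\<lambda>f z. pr (p1 (p1 z)) (pr (p2 (p1 z)) (p2 z)))" by (intro cf_intros)
  from cf_comp[OF Mu this] have 1: "cf (\<lambda>f z. ?E f (p1 (p1 z)) (p2 (p1 z)) (p2 z))" by simp
  have "cf (\<lambda>f z. pr (p1 (p1 (p1 z))) (pr (p2 (p1 (p1 z))) (p2 z)))" by (intro cf_intros)
  from cf_comp[OF Mu this] have 2: "cf (\<lambda>f z. ?E f (p1 (p1 (p1 z))) (p2 (p1 (p1 z))) (p2 z))" by simp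
  have "cf (\<lambda>f z. if \<exists>n<p1 z. ?E f (p1 z) (p2 z) n = 1 \<and> (\<forall>m<n. ?E f (p1 z) (p2 z) m \<noteq> 0)
     then Suc (LEAST n. ?E f (p1 z) (p2 z) n = 1 \<and> (\<forall>m<n. ?E f (p1 z) (p2 z) m \<noteq> 0)) else 0)"
    by (intro cf_bounded_least cp_ball cf_intros 1 2)
  then show ?case
    by (simp add: Let_def if_distrib[of enc_opt] cong: if_cong)
qed (simp_all, (intro cf_intros)+)

section \<open>A universal functional\<close>

text \<open>A stack machine on numbers. \<open>EV n x K\<close> evaluates code \<open>n\<close> at \<open>x\<close> with continuation stack
  \<open>K\<close>; \<open>RT y K\<close> returns \<open>y\<close> to the stack.\<close>

abbreviation EV :: "nat \<Rightarrow> nat \<Rightarrow> nat \<Rightarrow> nat" where "EV n x K \<equiv> pr 0 (pr n (pr x K))"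
abbreviation RT :: "nat \<Rightarrow> nat \<Rightarrow> nat" where "RT y K \<equiv> pr (Suc 0) (pr y K)"
abbreviation push :: "nat \<Rightarrow> nat \<Rightarrow> nat" where "push fr K \<equiv> Suc (pr fr K)"
abbreviation frame_tuple1 :: "nat \<Rightarrow> nat \<Rightarrow> nat" where "frame_tuple1 b x \<equiv> pr 0 (pr b x)"
abbreviation frame_comp :: "nat \<Rightarrow> nat" where "frame_comp a \<equiv> pr (Suc 0) a"
abbreviation frame_prec :: "nat \<Rightarrow> nat \<Rightarrow> nat \<Rightarrow> nat \<Rightarrow> nat" where
  "frame_prec b u k N \<equiv> pr 2 (pr (pr b u) (pr k N))"
abbreviation frame_mu :: "nat \<Rightarrow> nat \<Rightarrow> nat \<Rightarrow> nat" where "frame_mu m x k \<equiv> pr 3 (pr m (pr x k))"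
abbreviation frame_tuple2 :: "nat \<Rightarrow> nat" where "frame_tuple2 y \<equiv> pr 4 y"

definition step_eval :: "baire \<Rightarrow> nat \<Rightarrow> nat \<Rightarrow> nat \<Rightarrow> nat" where
  "step_eval f n x K =
    (if n = 0 then RT 0 K else if n = 1 then RT (Suc x) K else if n = 2 then RT (p1 x) K
     else if n = 3 then RT (p2 x) K else if n = 4 then RT (f x) K
     else if (n - 5) mod 4 = 0
       then EV (p1 ((n - 5) div 4)) x (push (frame_tuple1 (p2 ((n - 5) div 4)) x) K)
     else if (n - 5) mod 4 = 1
       then EV (p2 ((n - 5) div 4)) x (push (frame_comp (p1 ((n - 5) div 4))) K)
     else if (n - 5) mod 4 = 2
       then EV (p1 ((n - 5) div 4)) (p1 x) (push (frame_prec (p2 ((n - 5) div 4)) (p1 x) 0 (p2 x)) K)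
     else EV ((n - 5) div 4) (pr x 0) (push (frame_mu ((n - 5) div 4) x 0) K))"

definition step_frame :: "nat \<Rightarrow> nat \<Rightarrow> nat \<Rightarrow> nat" where
  "step_frame y fr K =
    (if p1 fr = 0 then EV (p1 (p2 fr)) (p2 (p2 fr)) (push (frame_tuple2 y) K)
     else if p1 fr = 1 then EV (p2 fr) y K
     else if p1 fr = 2 then
       (if p1 (p2 (p2 fr)) = p2 (p2 (p2 fr)) then RT y K
        else EV (p1 (p1 (p2 fr))) (pr (p2 (p1 (p2 fr))) (pr (p1 (p2 (p2 fr))) y))
          (push (frame_prec (p1 (p1 (p2 fr))) (p2 (p1 (p2 fr))) (Suc (p1 (p2 (p2 fr)))) (p2 (p2 (p2 fr)))) K))
     else if p1 fr = 3 then
       (if y = 0 then RT (p2 (p2 (p2 fr))) K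
        else EV (p1 (p2 fr)) (pr (p1 (p2 (p2 fr))) (Suc (p2 (p2 (p2 fr)))))
          (push (frame_mu (p1 (p2 fr)) (p1 (p2 (p2 fr))) (Suc (p2 (p2 (p2 fr))))) K))
     else RT (pr (p2 fr) y) K)"

definition step :: "baire \<Rightarrow> nat \<Rightarrow> nat" where
  "step f st =
    (if p1 st = 0 then step_eval f (p1 (p2 st)) (p1 (p2 (p2 st))) (p2 (p2 (p2 st)))
     else if p2 (p2 st) = 0 then st
     else step_frame (p1 (p2 st)) (p1 (p2 (p2 st) - 1)) (p2 (p2 (p2 st) - 1)))"

lemma step_simps [simp]:
  "step f (EV n x K) = step_eval f n x K"
  "step f (RT y 0) = RT y 0"
  "step f (RT y (push fr K)) = step_frame y fr K"
  by (simp_all add: step_def)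

lemma step_frame_simps [simp]:
  "step_frame y (frame_tuple1 b x) K = EV b x (push (frame_tuple2 y) K)"
  "step_frame y (frame_tuple2 a) K = RT (pr a y) K"
  "step_frame y (frame_comp a) K = EV a y K"
  "step_frame y (frame_prec b u k N) K =
     (if k = N then RT y K else EV b (pr u (pr k y)) (push (frame_prec b u (Suc k) N) K))"
  "step_frame y (frame_mu m x k) K =
     (if y = 0 then RT k K else EV m (pr x (Suc k)) (push (frame_mu m x (Suc k)) K))"
  by (simp_all add: step_frame_def)

lemma cf_step_eval:
  "cf (\<lambda>f z. step_eval f (p1 (p2 z)) (p1 (p2 (p2 z))) (p2 (p2 (p2 z))))"
  unfolding step_eval_def by (intro cf_intros; simp)

lemma cf_step_frame:
  "cf (\<lambda>f z. step_frame (p1 (p2 z)) (p1 (p2 (p2 z) - 1)) (p2 (p2 (p2 z) - 1)))"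
  unfolding step_frame_def by (intro cf_intros)

lemma cf_step: "cf F \<Longrightarrow> cf (\<lambda>f x. step f (F f x))"
proof (rule cf_comp[of step])
  show "cf step"
    unfolding step_def by (intro cf_intros cf_step_eval cf_step_frame)
qed

lemma cf_run: "cf F \<Longrightarrow> cf N \<Longrightarrow> cf (\<lambda>f x. (step f ^^ N f x) (F f x))"
proof -
  assume "cf F" "cf N"
  then have "cf (\<lambda>f x. rec_nat (F f x) (\<lambda>k r. step f r) (N f x))"
    by (intro cf_rec cf_step cf_intros)
  moreover have "rec_nat s (\<lambda>k r. step f r) n = (step f ^^ n) s" for s n f
    by (induction n) auto
  ultimately show ?thesis by simp
qed

text \<open>Pairs each clause of \<open>code_of\<close> with the machine instruction for it. The
  strict bounds on the components serve the inductions over code numbers in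
  \<open>reach_eval\<close> and \<open>halts_eval\<close>.\<close>

lemma code_of_cases:
  obtains "n = 0" "code_of n = Zero" | "n = 1" "code_of n = Succ" | "n = 2" "code_of n = Fst"
  | "n = 3" "code_of n = Snd" | "n = 4" "code_of n = Oracle"
  | (Tuple) a b where "a < n" "b < n" "code_of n = Tuple (code_of a) (code_of b)"
      "\<And>f x K. step_eval f n x K = EV a x (push (frame_tuple1 b x) K)"
  | (Comp) a b where "a < n" "b < n" "code_of n = Comp (code_of a) (code_of b)"
      "\<And>f x K. step_eval f n x K = EV b x (push (frame_comp a) K)"
  | (Prec) a b where "a < n" "b < n" "code_of n = Prec (code_of a) (code_of b)"
      "\<And>f x K. step_eval f n x K = EV a (p1 x) (push (frame_prec b (p1 x) 0 (p2 x)) K)"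
  | (Mu) m where "m < n" "code_of n = Mu (code_of m)"
      "\<And>f x K. step_eval f n x K = EV m (pr x 0) (push (frame_mu m x 0) K)"
proof (cases "n < 5")
  case True
  then have "n = 0 \<or> n = 1 \<or> n = 2 \<or> n = 3 \<or> n = 4" by auto
  then show thesis using that(1-5) by (auto simp: code_of.simps)
next
  case False
  define m where "m = (n - 5) div 4"
  have m: "m < n" using False unfolding m_def by linarith
  have ab: "p1 m < n" "p2 m < n"
    using m fst_prod_decode_le[of m] snd_prod_decode_le[of m] by linarith+
  have c: "code_of n = (if (n - 5) mod 4 = 0 then Tuple (code_of (p1 m)) (code_of (p2 m))
        else if (n - 5) mod 4 = 1 then Comp (code_of (p1 m)) (code_of (p2 m))
        else if (n - 5) mod 4 = 2 then Prec (code_of (p1 m)) (code_of (p2 m))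
        else Mu (code_of m))"
    using False by (subst code_of.simps) (simp add: Let_def m_def)
  consider "(n - 5) mod 4 = 0" | "(n - 5) mod 4 = 1" | "(n - 5) mod 4 = 2" | "(n - 5) mod 4 = 3"
    by linarith
  then show thesis
  proof cases
    case 1 then show thesis using False c that(6)[OF ab] by (auto simp: step_eval_def m_def)
  next
    case 2 then show thesis using False c that(7)[OF ab] by (auto simp: step_eval_def m_def)
  next
    case 3 then show thesis using False c that(8)[OF ab] by (auto simp: step_eval_def m_def)
  next
    case 4 then show thesis using False c that(9)[OF m] by (auto simp: step_eval_def m_def)
  qed
qed

definition reach :: "baire \<Rightarrow> nat \<Rightarrow> nat \<Rightarrow> bool" where
  "reach f s t \<longleftrightarrow> (\<exists>k. (step f ^^ k) s = t)"

lemma reach_refl: "reach f s s"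
  unfolding reach_def by (rule exI[of _ 0]) simp

lemma reach_step: "reach f (step f s) t \<Longrightarrow> reach f s t"
  unfolding reach_def by (metis comp_apply funpow_Suc_right)

lemma reach_trans: "reach f s t \<Longrightarrow> reach f t u \<Longrightarrow> reach f s u"
  unfolding reach_def by (metis comp_apply funpow_add)

lemma reach_eval:
  "eval (code_of n) f x = Some y \<Longrightarrow> reach f (EV n x K) (RT y K)"
proof (induction n arbitrary: x y K rule: less_induct)
  case (less n)
  show ?case
  proof (cases n rule: code_of_cases)
    case (Tuple a b)
    from less.prems obtain u v where uv: "eval (code_of a) f x = Some u" "eval (code_of b) f x = Some v"
      "y = pr u v" by (auto simp: Tuple bind_eq_Some_conv)
    have "reach f (RT u (push (frame_tuple1 b x) K)) (EV b x (push (frame_tuple2 u) K))"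
      by - (rule reach_step, simp add: reach_refl)
    moreover have "reach f (RT v (push (frame_tuple2 u) K)) (RT y K)"
      by - (rule reach_step, simp add: reach_refl uv(3))
    ultimately have "reach f (RT u (push (frame_tuple1 b x) K)) (RT y K)"
      using less.IH[OF Tuple(2) uv(2)] reach_trans by blast
    from reach_trans[OF less.IH[OF Tuple(1) uv(1)] this]
    show ?thesis by - (rule reach_step, simp add: Tuple)
  next
    case (Comp a b)
    from less.prems obtain u where u: "eval (code_of b) f x = Some u" "eval (code_of a) f u = Some y"
      by (auto simp: Comp bind_eq_Some_conv)
    have "reach f (RT u (push (frame_comp a) K)) (RT y K)"
      using less.IH[OF Comp(1) u(2), of K] by - (rule reach_step, simp)
    from reach_trans[OF less.IH[OF Comp(2) u(1)] this]
    show ?thesis by - (rule reach_step, simp add: Comp)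
  next
    case (Prec a b)
    define R where "R = rec_nat (eval (code_of a) f (p1 x))
      (\<lambda>k r. Option.bind r (\<lambda>y. eval (code_of b) f (pr (p1 x) (pr k y))))"
    have "reach f (EV n x K) (RT z (push (frame_prec b (p1 x) k (p2 x)) K))"
      if "k \<le> p2 x" "R k = Some z" for k z
      using that
    proof (induction k arbitrary: z)
      case 0
      then have "eval (code_of a) f (p1 x) = Some z" by (simp add: R_def)
      from less.IH[OF Prec(1) this] show ?case by - (rule reach_step, simp add: Prec)
    next
      case (Suc k)
      then obtain w where w: "R k = Some w" "eval (code_of b) f (pr (p1 x) (pr k w)) = Some z"
        by (auto simp: R_def bind_eq_Some_conv)
      have "reach f (RT w (push (frame_prec b (p1 x) k (p2 x)) K))
          (RT z (push (frame_prec b (p1 x) (Suc k) (p2 x)) K))"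
        using less.IH[OF Prec(2) w(2)] Suc.prems(1) by - (rule reach_step, simp)
      with Suc.IH[OF _ w(1)] Suc.prems(1) show ?case by (simp add: reach_trans)
    qed
    moreover have "R (p2 x) = Some y" using less.prems by (simp add: R_def Prec)
    ultimately have "reach f (EV n x K) (RT y (push (frame_prec b (p1 x) (p2 x) (p2 x)) K))" by simp
    moreover have "reach f (RT y (push (frame_prec b (p1 x) (p2 x) (p2 x)) K)) (RT y K)"
      by - (rule reach_step, simp add: reach_refl)
    ultimately show ?thesis by (rule reach_trans)
  next
    case (Mu m)
    let ?P = "\<lambda>n. eval (code_of m) f (pr x n) = Some 0
      \<and> (\<forall>l<n. eval (code_of m) f (pr x l) \<noteq> None)"
    from less.prems have ex: "\<exists>n. ?P n" and y: "y = (LEAST n. ?P n)"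
      by (auto simp: Mu Let_def split: if_splits)
    have Py: "?P y" unfolding y using ex by (rule LeastI_ex)
    have nz: "\<exists>z. eval (code_of m) f (pr x l) = Some (Suc z)" if "l < y" for l
    proof -
      have "\<not> ?P l" using not_less_Least[of l ?P] that y by blast
      moreover have "\<forall>i<l. eval (code_of m) f (pr x i) \<noteq> None" using Py that by simp
      moreover have "eval (code_of m) f (pr x l) \<noteq> None" using Py that by simp
      ultimately show ?thesis by (metis not0_implies_Suc not_None_eq)
    qed
    have "reach f (EV n x K) (EV m (pr x l) (push (frame_mu m x l) K))" if "l \<le> y" for l
      using that
    proof (induction l)
      case 0 show ?case by - (rule reach_step, simp add: Mu reach_refl)
    next
      case (Suc l)
      obtain z where "eval (code_of m) f (pr x l) = Some (Suc z)"
        using nz[of l] Suc.prems by auto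
      from less.IH[OF Mu(1) this]
      have "reach f (EV m (pr x l) (push (frame_mu m x l) K)) (RT (Suc z) (push (frame_mu m x l) K))" .
      moreover have "reach f (RT (Suc z) (push (frame_mu m x l) K))
          (EV m (pr x (Suc l)) (push (frame_mu m x (Suc l)) K))"
        by - (rule reach_step, simp add: reach_refl)
      ultimately show ?case using Suc reach_trans by (meson Suc_leD)
    qed
    from this[of y] have "reach f (EV n x K) (EV m (pr x y) (push (frame_mu m x y) K))" by simp
    moreover have "reach f (EV m (pr x y) (push (frame_mu m x y) K)) (RT 0 (push (frame_mu m x y) K))"
      using less.IH[OF Mu(1)] Py by blast
    moreover have "reach f (RT 0 (push (frame_mu m x y) K)) (RT y K)"
      by - (rule reach_step, simp add: reach_refl)
    ultimately show ?thesis using reach_trans by blast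
  qed (rule reach_step; use less.prems in \<open>simp add: step_eval_def reach_refl\<close>)+
qed

definition halts :: "baire \<Rightarrow> nat \<Rightarrow> nat \<Rightarrow> nat \<Rightarrow> bool" where
  "halts f k s y \<longleftrightarrow> (step f ^^ k) s = RT y 0"

lemma halts_step:
  assumes "halts f k s y" "\<And>z. s \<noteq> RT z 0"
  shows "\<exists>k'<k. halts f k' (step f s) y"
proof (cases k)
  case 0 with assms show ?thesis by (simp add: halts_def)
next
  case (Suc l) with assms(1) show ?thesis
    by (auto simp: halts_def funpow_swap1 intro!: exI[of _ l])
qed

text \<open>A run that halts must hand a value to the stack \<open>K\<close> on its way. Run lengths
  are carried along because the number of rounds of a \<open>Mu\<close> search is bounded by nothing
  else: that case is a second induction, over the length of the remaining run.\<close>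

lemma halts_eval:
  "halts f k (EV n x K) y \<Longrightarrow> \<exists>z k'. k' \<le> k \<and> eval (code_of n) f x = Some z \<and> halts f k' (RT z K) y"
proof (induction n arbitrary: x K k y rule: less_induct)
  case (less n)
  from halts_step[OF less.prems] obtain k1 where k1: "k1 < k" "halts f k1 (step_eval f n x K) y"
    by auto
  show ?case
  proof (cases n rule: code_of_cases)
    case (Tuple a b)
    from less.IH[OF Tuple(1) k1(2)[unfolded Tuple(4)]] obtain u k2 where k2: "k2 \<le> k1" "eval (code_of a) f x = Some u"
      "halts f k2 (RT u (push (frame_tuple1 b x) K)) y" by blast
    from halts_step[OF k2(3)] obtain k3 where k3: "k3 < k2" "halts f k3 (EV b x (push (frame_tuple2 u) K)) y"
      by auto
    from less.IH[OF Tuple(2) k3(2)] obtain v k4 where k4: "k4 \<le> k3" "eval (code_of b) f x = Some v"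
      "halts f k4 (RT v (push (frame_tuple2 u) K)) y" by blast
    from halts_step[OF k4(3)] obtain k5 where "k5 < k4" "halts f k5 (RT (pr u v) K) y" by auto
    with k1 k2 k3 k4 show ?thesis
      by (intro exI[of _ "pr u v"] exI[of _ k5]) (auto simp: Tuple)
  next
    case (Comp a b)
    from less.IH[OF Comp(2) k1(2)[unfolded Comp(4)]] obtain u k2 where k2: "k2 \<le> k1" "eval (code_of b) f x = Some u"
      "halts f k2 (RT u (push (frame_comp a) K)) y" by blast
    from halts_step[OF k2(3)] obtain k3 where k3: "k3 < k2" "halts f k3 (EV a u K) y" by auto
    from less.IH[OF Comp(1) k3(2)] obtain v k4 where k4: "k4 \<le> k3" "eval (code_of a) f u = Some v"
      "halts f k4 (RT v K) y" by blast
    with k1 k2 k3 show ?thesis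
      by (intro exI[of _ v] exI[of _ k4]) (auto simp: Comp)
  next
    case (Prec a b)
    define R where "R = rec_nat (eval (code_of a) f (p1 x))
      (\<lambda>k r. Option.bind r (\<lambda>y. eval (code_of b) f (pr (p1 x) (pr k y))))"
    from less.IH[OF Prec(1) k1(2)[unfolded Prec(4)]] obtain u k2 where k2: "k2 \<le> k1" "R 0 = Some u"
      "halts f k2 (RT u (push (frame_prec b (p1 x) 0 (p2 x)) K)) y" unfolding R_def by auto
    have "\<exists>z l'. l' \<le> k1 \<and> R (p2 x) = Some z \<and> halts f l' (RT z K) y"
      if "j \<le> p2 x" "l \<le> k1" "R j = Some u" "halts f l (RT u (push (frame_prec b (p1 x) j (p2 x)) K)) y"
      for j l u
      using that
    proof (induction "p2 x - j" arbitrary: j l u)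
      case 0
      then have "j = p2 x" by simp
      with halts_step[OF 0(5)] obtain l' where "l' < l" "halts f l' (RT u K) y" by auto
      with 0 \<open>j = p2 x\<close> show ?case by (intro exI[of _ u] exI[of _ l']) auto
    next
      case (Suc d)
      then have j: "j < p2 x" "d = p2 x - Suc j" by auto
      with halts_step[OF Suc.prems(4)] obtain l' where l': "l' < l"
        "halts f l' (EV b (pr (p1 x) (pr j u)) (push (frame_prec b (p1 x) (Suc j) (p2 x)) K)) y" by auto
      from less.IH[OF Prec(2) l'(2)] obtain v l'' where v: "l'' \<le> l'"
        "eval (code_of b) f (pr (p1 x) (pr j u)) = Some v"
        "halts f l'' (RT v (push (frame_prec b (p1 x) (Suc j) (p2 x)) K)) y" by blast
      have "R (Suc j) = Some v" using Suc.prems(3) v(2) by (simp add: R_def)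
      with Suc.hyps(1)[OF j(2) _ _ this v(3)] j(1) v(1) l'(1) Suc.prems(2) show ?case by simp
    qed
    from this[OF _ k2] k1(1) obtain z l' where "l' \<le> k" "R (p2 x) = Some z" "halts f l' (RT z K) y"
      by (metis less_imp_le_nat le_trans zero_le)
    then show ?thesis by (auto simp: Prec R_def)
  next
    case (Mu m)
    note IH_m = less.IH[OF Mu(1)]
    have "\<exists>z l'. l' \<le> l \<and> eval (code_of n) f x = Some z \<and> halts f l' (RT z K) y"
      if "halts f l (EV m (pr x j) (push (frame_mu m x j) K)) y"
        "\<forall>i<j. \<exists>z. eval (code_of m) f (pr x i) = Some (Suc z)" for j l
      using that
    proof (induction l arbitrary: j rule: less_induct)
      case (less l)
      from IH_m[OF less.prems(1)] obtain z l1 where z: "l1 \<le> l" "eval (code_of m) f (pr x j) = Some z"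
        "halts f l1 (RT z (push (frame_mu m x j) K)) y" by blast
      from halts_step[OF z(3)] obtain l2 where l2: "l2 < l1"
        "halts f l2 (step_frame z (frame_mu m x j) K) y" by auto
      show ?case
      proof (cases z)
        case 0
        have nn: "\<forall>i<j. eval (code_of m) f (pr x i) \<noteq> None" using less.prems(2) by auto
        have "(LEAST n. eval (code_of m) f (pr x n) = Some 0
            \<and> (\<forall>l<n. eval (code_of m) f (pr x l) \<noteq> None)) = j"
        proof (rule Least_equality)
          show "eval (code_of m) f (pr x j) = Some 0 \<and> (\<forall>l<j. eval (code_of m) f (pr x l) \<noteq> None)"
            using z(2) 0 nn by simp
          show "j \<le> i" if "eval (code_of m) f (pr x i) = Some 0
            \<and> (\<forall>l<i. eval (code_of m) f (pr x l) \<noteq> None)" for i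
            using that less.prems(2) by (metis not_le option.inject nat.distinct(1))
        qed
        moreover have "\<exists>n. eval (code_of m) f (pr x n) = Some 0
            \<and> (\<forall>l<n. eval (code_of m) f (pr x l) \<noteq> None)"
          using z(2) 0 nn by blast
        ultimately have "eval (code_of n) f x = Some j" by (simp add: Mu Let_def)
        with l2 0 z(1) show ?thesis by (intro exI[of _ j] exI[of _ l2]) simp
      next
        case (Suc w)
        have "halts f l2 (EV m (pr x (Suc j)) (push (frame_mu m x (Suc j)) K)) y"
          using l2(2) Suc by simp
        moreover have "\<forall>i<Suc j. \<exists>z. eval (code_of m) f (pr x i) = Some (Suc z)"
          using less.prems(2) z(2) Suc by (auto simp: less_Suc_eq)
        ultimately obtain v l3 where "l3 \<le> l2" "eval (code_of n) f x = Some v" "halts f l3 (RT v K) y"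
          using less.IH[of l2 "Suc j"] l2(1) z(1) by (meson less_le_trans)
        with l2(1) z(1) show ?thesis by (intro exI[of _ v] exI[of _ l3]) simp
      qed
    qed
    from this[of k1 0] k1 show ?thesis
      by (simp add: Mu(3) del: eval.simps) (meson less_imp_le_nat le_trans)
  qed (use k1 in \<open>auto simp: step_eval_def intro!: exI[of _ k1]\<close>)+
qed

text \<open>An element of \<open>mp_imp\<close> carries an index as its first value, so one fixed
  code must accept the index as an input. The code searches for the first time at which the machine
  has halted and reads off the value.\<close>

lemma universal_code: "\<exists>c. \<forall>f n x. eval c f (pr n x) = Phi n f x"
proof -
  define st where "st = (\<lambda>f z k. (step f ^^ k) (EV (p1 z) (p2 z) 0))"
  define final where "final = (\<lambda>f z k. p1 (st f z k) = 1 \<and> p2 (p2 (st f z k)) = 0)"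
  have cst: "cf (\<lambda>f z. st f (p1 z) (p2 z))"
    unfolding st_def by (intro cf_run cf_intros)
  have "cp (\<lambda>f z. final f (p1 z) (p2 z))"
    unfolding final_def by (intro cf_intros cst)
  from search_code[OF this] obtain c where c:
    "\<And>f z. eval c f z = (if \<exists>k. final f z k then Some (LEAST k. final f z k) else None)" by blast
  have "cf (\<lambda>f z. p1 (p2 (st f (p1 z) (p2 z))))"
    by (intro cf_intros cst)
  then obtain d where d: "\<forall>f z. eval d f z = Some (p1 (p2 (st f (p1 z) (p2 z))))"
    unfolding cf_def ..
  have final_halts: "final f z k \<longleftrightarrow> halts f k (EV (p1 z) (p2 z) 0) (p1 (p2 (st f z k)))" for f z k
  proof -
    have "s = RT (p1 (p2 s)) 0 \<longleftrightarrow> p1 s = 1 \<and> p2 (p2 s) = 0" for s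
    proof -
      have "s = pr (p1 s) (pr (p1 (p2 s)) (p2 (p2 s)))" by simp
      then show ?thesis by (metis One_nat_def fst_conv snd_conv prod_encode_inverse)
    qed
    then show ?thesis unfolding final_def halts_def st_def by blast
  qed
  have "eval (Comp d (Tuple (Tuple Fst Snd) c)) f (pr n x) = Phi n f x" for f n x
  proof (cases "Phi n f x")
    case (Some y)
    then have "reach f (EV n x 0) (RT y 0)" by (simp add: Phi_def reach_eval)
    then obtain k where "st f (pr n x) k = RT y 0" by (auto simp: reach_def st_def)
    then have ex: "\<exists>k. final f (pr n x) k" by (auto simp: final_def intro!: exI[of _ k])
    define k where "k = (LEAST k. final f (pr n x) k)"
    have "final f (pr n x) k" unfolding k_def using ex by (rule LeastI_ex)
    then have "halts f k (EV n x 0) (p1 (p2 (st f (pr n x) k)))" by (simp add: final_halts)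
    from halts_eval[OF this] obtain z k' where z: "Phi n f x = Some z"
      "halts f k' (RT z 0) (p1 (p2 (st f (pr n x) k)))" by (auto simp: Phi_def)
    have "(step f ^^ k') (RT z 0) = RT z 0" by (induction k') auto
    with z(2) have "p1 (p2 (st f (pr n x) k)) = z" by (simp add: halts_def)
    with z(1) ex show ?thesis by (simp add: c d k_def)
  next
    case None
    have "\<not> final f (pr n x) k" for k
      using None halts_eval[of f k n x 0] by (auto simp: final_halts Phi_def)
    with None show ?thesis by (simp add: c)
  qed
  then show ?thesis by blast
qed

section \<open>Reductions\<close>

lemma turing_le_iff: "g \<le>\<^sub>T f \<longleftrightarrow> (\<exists>c. eval c f = Some \<circ> g)"
  unfolding turing_le_def Phi_def using surj_code_of by (metis surjD)

lemma medvedev_le_iff: "X \<le>\<^sub>M Y \<longleftrightarrow> (\<exists>c. \<forall>f\<in>Y. \<exists>g\<in>X. eval c f = Some \<circ> g)"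
  unfolding medvedev_le_def Phi_def using surj_code_of by (metis surjD)

lemma turing_le_refl: "f \<le>\<^sub>T f"
  unfolding turing_le_iff by (rule exI[of _ Oracle]) (simp add: fun_eq_iff)

lemma turing_le_trans: "f \<le>\<^sub>T g \<Longrightarrow> g \<le>\<^sub>T h \<Longrightarrow> f \<le>\<^sub>T h"
  unfolding turing_le_iff by (metis eval_subst_oracle)

lemma turing_le_cf: "cf F \<Longrightarrow> F f \<le>\<^sub>T f"
  unfolding turing_le_iff cf_def by (force simp: fun_eq_iff)

lemma medvedev_le_cf: "cf F \<Longrightarrow> (\<And>f. f \<in> Y \<Longrightarrow> F f \<in> X) \<Longrightarrow> X \<le>\<^sub>M Y"
proof -
  assume "cf F" and FX: "\<And>f. f \<in> Y \<Longrightarrow> F f \<in> X"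
  from \<open>cf F\<close> obtain c where "\<forall>f x. eval c f x = Some (F f x)" unfolding cf_def ..
  then have "eval c f = Some \<circ> F f" for f by (simp add: fun_eq_iff)
  with FX show ?thesis unfolding medvedev_le_iff by blast
qed

lemma medvedev_le_subset: "Y \<subseteq> X \<Longrightarrow> X \<le>\<^sub>M Y"
  by (rule medvedev_le_cf[of "\<lambda>f x. f x"]) (auto intro: cf_intros)

definition fleft :: "baire \<Rightarrow> nat \<Rightarrow> nat" where "fleft f x = f (x + x)"
definition fright :: "baire \<Rightarrow> nat \<Rightarrow> nat" where "fright f x = f (Suc (x + x))"
definition ftail :: "baire \<Rightarrow> nat \<Rightarrow> nat" where "ftail f x = f (Suc x)"

lemma fparts_simps [simp]: "fleft (f \<oplus> g) = f" "fright (f \<oplus> g) = g" "ftail (n \<^bold>\<frown> f) = f"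
proof -
  have "Suc (x + x) div 2 = x" "(x + x) div 2 = x" for x :: nat by simp_all
  then show "fleft (f \<oplus> g) = f" "fright (f \<oplus> g) = g" "ftail (n \<^bold>\<frown> f) = f"
    by (simp_all add: fun_eq_iff fleft_def fright_def ftail_def fjoin_def del: div_mult_self_is_m)
qed

named_theorems cff

lemma cff_id [cff]: "cf (\<lambda>f. f)"
  using cf_oracle[OF cf_id] .

lemma cff_fleft [cff]: "cf D \<Longrightarrow> cf (\<lambda>f. fleft (D f))"
  by (rule cf_subst[of fleft]) (unfold fleft_def, intro cf_intros)

lemma cff_fright [cff]: "cf D \<Longrightarrow> cf (\<lambda>f. fright (D f))"
  by (rule cf_subst[of fright]) (unfold fright_def, intro cf_intros)

lemma cff_ftail [cff]: "cf D \<Longrightarrow> cf (\<lambda>f. ftail (D f))"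
  by (rule cf_subst[of ftail]) (unfold ftail_def, intro cf_intros)

lemma cff_fjoin [cff]:
  assumes "cf D" "cf E" shows "cf (\<lambda>f. D f \<oplus> E f)"
proof -
  have h: "cf (\<lambda>f x. x div 2)" by (intro cf_intros) simp
  have "cf (\<lambda>f x. if even x then D f (x div 2) else E f (x div 2))"
    by (intro cf_if cp_even cf_id cf_comp[OF assms(1) h] cf_comp[OF assms(2) h])
  then show ?thesis by (simp add: fjoin_def[abs_def])
qed

lemma cff_prepend [cff]:
  assumes "cf (\<lambda>f x. N f)" "cf D" shows "cf (\<lambda>f. N f \<^bold>\<frown> D f)"
proof -
  have "cf (\<lambda>f x. if x = 0 then N f else D f (x - 1))"
    by (intro cf_if cp_eq cf_id cf_const assms(1) cf_comp[OF assms(2) cf_pred[OF cf_id]])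
  moreover have "(if x = 0 then n else g (x - 1)) = (n \<^bold>\<frown> g) x" for n g and x :: nat
    by (cases x) auto
  ultimately show ?thesis by simp
qed

lemma cff_if [cff]:
  assumes "cp (\<lambda>f x. P f)" "cf D" "cf E" shows "cf (\<lambda>f. if P f then D f else E f)"
proof -
  have "(\<lambda>f. if P f then D f else E f) = (\<lambda>f x. if P f then D f x else E f x)" by auto
  with cf_if[OF assms] show ?thesis by simp
qed

lemma cff_value: "cf D \<Longrightarrow> cf (\<lambda>f x. D f k)"
  using cf_comp[OF _ cf_const[of k]] .

lemma fjoin_code:
  "\<exists>j. \<forall>f g h. eval c f = Some \<circ> g \<longrightarrow> eval d f = Some \<circ> h \<longrightarrow> eval j f = Some \<circ> (g \<oplus> h)"
proof -
  have "cf (\<lambda>f x. if even (p1 x) then p1 (p2 x) else p2 (p2 x))" by (intro cf_intros)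
  then obtain e where e: "\<forall>f x. eval e f x = Some (if even (p1 x) then p1 (p2 x) else p2 (p2 x))"
    unfolding cf_def ..
  have "cf (\<lambda>f x. x div 2)" by (intro cf_intros) simp
  then obtain t where t: "\<forall>f x. eval t f x = Some (x div 2)" unfolding cf_def ..
  have "eval (Comp e (Tuple (Tuple Fst Snd) (Tuple (Comp c t) (Comp d t)))) f = Some \<circ> (g \<oplus> h)"
    if "eval c f = Some \<circ> g" "eval d f = Some \<circ> h" for f g h
    using that by (simp add: fun_eq_iff e t fjoin_def)
  then show ?thesis by blast
qed

text \<open>Composing functionals discards the first oracle. Keeping it beside the computed function
  lets the second stage read both.\<close>

lemma join_code: "\<exists>d. \<forall>f g. eval c f = Some \<circ> g \<longrightarrow> eval d f = Some \<circ> (g \<oplus> f)"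
proof -
  have "eval Oracle f = Some \<circ> f" for f by (simp add: fun_eq_iff)
  with fjoin_code[of c Oracle] show ?thesis by blast
qed

lemma turing_le_fjoin: "f \<le>\<^sub>T h \<Longrightarrow> g \<le>\<^sub>T h \<Longrightarrow> f \<oplus> g \<le>\<^sub>T h"
  unfolding turing_le_iff using fjoin_code by blast

lemma turing_le_fjoin1: "f \<le>\<^sub>T f \<oplus> g" and turing_le_fjoin2: "g \<le>\<^sub>T f \<oplus> g"
  using turing_le_cf[OF cff_fleft[OF cff_id], of "f \<oplus> g"]
    turing_le_cf[OF cff_fright[OF cff_id], of "f \<oplus> g"] by simp_all

lemma turing_le_prepend: "g \<le>\<^sub>T n \<^bold>\<frown> g"
  using turing_le_cf[OF cff_ftail[OF cff_id], of "n \<^bold>\<frown> g"] by simp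

lemma subst_code: "cf D \<Longrightarrow> \<exists>d. \<forall>f. eval d f = eval c (D f)"
proof -
  assume "cf D"
  then obtain r where r: "\<forall>f x. eval r f x = Some (D f x)" unfolding cf_def ..
  have "eval (subst_oracle c r) f = eval c (D f)" for f
    by (rule eval_subst_oracle) (simp add: fun_eq_iff r)
  then show ?thesis by blast
qed

text \<open>The form in which elements of \<open>mp_imp\<close> are run: index and oracle of the run
  are both read off \<open>f\<close>.\<close>

lemma phi_code:
  assumes D: "cf D" and N: "cf (\<lambda>f x. N f)"
  shows "\<exists>c. \<forall>f. eval c f = Phi (N f) (D f)"
proof -
  obtain u where u: "\<forall>f n x. eval u f (pr n x) = Phi n f x" using universal_code ..
  obtain d where d: "\<forall>f. eval d f = eval u (D f)" using subst_code[OF D] ..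
  obtain n where n: "\<forall>f x. eval n f x = Some (N f)" using N unfolding cf_def ..
  have "eval (Comp d (Tuple n (Tuple Fst Snd))) f = Phi (N f) (D f)" for f
    by (simp add: fun_eq_iff n u d)
  then show ?thesis by blast
qed

lemma index_code: "\<exists>n. \<forall>f. Phi n f = eval c f"
  unfolding Phi_def using surj_code_of by (metis surjD)

section \<open>The Medvedev lattice is a Brouwer algebra\<close>

lemma mp_join_ub1: "X \<le>\<^sub>M mp_join X Y"
  by (rule medvedev_le_cf[OF cff_fleft[OF cff_id]]) (auto simp: mp_join_def)

lemma mp_join_ub2: "Y \<le>\<^sub>M mp_join X Y"
  by (rule medvedev_le_cf[OF cff_fright[OF cff_id]]) (auto simp: mp_join_def)

lemma mp_join_least:
  assumes "X \<le>\<^sub>M Z" "Y \<le>\<^sub>M Z" shows "mp_join X Y \<le>\<^sub>M Z"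
proof -
  obtain c d where c: "\<forall>f\<in>Z. \<exists>g\<in>X. eval c f = Some \<circ> g" and d: "\<forall>f\<in>Z. \<exists>g\<in>Y. eval d f = Some \<circ> g"
    using assms unfolding medvedev_le_iff by blast
  obtain j where j: "\<forall>f g h. eval c f = Some \<circ> g \<longrightarrow> eval d f = Some \<circ> h \<longrightarrow> eval j f = Some \<circ> (g \<oplus> h)"
    using fjoin_code ..
  have "\<exists>h\<in>mp_join X Y. eval j f = Some \<circ> h" if f: "f \<in> Z" for f
  proof -
    obtain g h where "g \<in> X" "h \<in> Y" "eval c f = Some \<circ> g" "eval d f = Some \<circ> h"
      using bspec[OF c f] bspec[OF d f] by blast
    with j show ?thesis unfolding mp_join_def by blast
  qed
  then show ?thesis unfolding medvedev_le_iff by blast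
qed

lemma mp_meet_lb1: "mp_meet X Y \<le>\<^sub>M X"
  by (rule medvedev_le_cf[of "\<lambda>f. 0 \<^bold>\<frown> f"]) (auto simp: mp_meet_def intro!: cff cf_const)

lemma mp_meet_lb2: "mp_meet X Y \<le>\<^sub>M Y"
  by (rule medvedev_le_cf[of "\<lambda>f. 1 \<^bold>\<frown> f"]) (auto simp: mp_meet_def intro!: cff cf_const)

lemma mp_meet_greatest:
  assumes "Z \<le>\<^sub>M X" "Z \<le>\<^sub>M Y" shows "Z \<le>\<^sub>M mp_meet X Y"
proof -
  obtain m n where m: "\<forall>f\<in>X. \<exists>g\<in>Z. Phi m f = Some \<circ> g" and n: "\<forall>f\<in>Y. \<exists>g\<in>Z. Phi n f = Some \<circ> g"
    using assms unfolding medvedev_le_def by blast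
  have "cf (\<lambda>f x. if f 0 = 0 then m else n)" by (intro cf_intros)
  from phi_code[OF cff_ftail[OF cff_id] this]
  obtain c where c: "\<forall>f. eval c f = Phi (if f 0 = 0 then m else n) (ftail f)" ..
  have "\<exists>g\<in>Z. eval c f = Some \<circ> g" if "f \<in> mp_meet X Y" for f
    using that m n by (auto simp: mp_meet_def c)
  then show ?thesis unfolding medvedev_le_iff by blast
qed

text \<open>From left to right the reduction has a fixed index \<open>k\<close> once the halves of
  its oracle are swapped, and \<open>k\<close> is put in front. From right to left the index is
  known only after the given reduction has been run, so the universal functional executes it, with
  the original oracle saved by \<open>join_code\<close>.\<close>

lemma mp_residuation: "Y \<le>\<^sub>M mp_join X Z \<longleftrightarrow> mp_imp X Y \<le>\<^sub>M Z"
proof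
  assume "Y \<le>\<^sub>M mp_join X Z"
  then obtain m where m: "\<forall>f\<in>mp_join X Z. \<exists>g\<in>Y. Phi m f = Some \<circ> g"
    unfolding medvedev_le_def by blast
  have "cf (\<lambda>f. fright f \<oplus> fleft f)" by (intro cff)
  from phi_code[OF this cf_const[of m]]
  obtain c where c: "\<forall>f. eval c f = Phi m (fright f \<oplus> fleft f)" ..
  obtain k where k: "\<forall>f. Phi k f = eval c f" using index_code ..
  have "k \<^bold>\<frown> f \<in> mp_imp X Y" if "f \<in> Z" for f
  proof -
    have "\<exists>h\<in>Y. Phi k (f \<oplus> g) = Some \<circ> h" if "g \<in> X" for g
      using m that \<open>f \<in> Z\<close> by (auto simp: c k mp_join_def)
    then show ?thesis unfolding mp_imp_def by blast
  qed
  then show "mp_imp X Y \<le>\<^sub>M Z"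
    by (intro medvedev_le_cf[of "\<lambda>f. k \<^bold>\<frown> f"]) (auto intro!: cff cf_const)
next
  assume "mp_imp X Y \<le>\<^sub>M Z"
  then obtain c where c: "\<forall>f\<in>Z. \<exists>g\<in>mp_imp X Y. eval c f = Some \<circ> g"
    unfolding medvedev_le_iff by blast
  obtain r where r: "\<forall>f. eval r f = eval c (fright f)" using subst_code[OF cff_fright[OF cff_id]] ..
  obtain d where d: "\<forall>f g. eval r f = Some \<circ> g \<longrightarrow> eval d f = Some \<circ> (g \<oplus> f)"
    using join_code ..
  have "cf (\<lambda>f. ftail (fleft f) \<oplus> fleft (fright f))" "cf (\<lambda>f x. fleft f 0)"
    by (intro cff, rule cff_value[OF cff_fleft[OF cff_id]])
  from phi_code[OF this] obtain e where
    e: "\<forall>f. eval e f = Phi (fleft f 0) (ftail (fleft f) \<oplus> fleft (fright f))" ..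
  have "\<exists>h\<in>Y. eval (subst_oracle e d) f = Some \<circ> h" if "f \<in> mp_join X Z" for f
  proof -
    obtain g h where gh: "g \<in> X" "h \<in> Z" "f = g \<oplus> h" using \<open>f \<in> mp_join X Z\<close> by (auto simp: mp_join_def)
    obtain n k where nk: "eval c h = Some \<circ> (n \<^bold>\<frown> k)" "\<forall>g\<in>X. \<exists>h\<in>Y. Phi n (k \<oplus> g) = Some \<circ> h"
      using c gh(2) unfolding mp_imp_def by blast
    have "eval d f = Some \<circ> ((n \<^bold>\<frown> k) \<oplus> f)" using d r nk(1) gh(3) by simp
    from eval_subst_oracle[OF this, of e]
    have "eval (subst_oracle e d) f = Phi n (k \<oplus> g)" by (simp add: e gh(3))
    with nk(2) gh(1) show ?thesis by simp
  qed
  then show "Y \<le>\<^sub>M mp_join X Z" unfolding medvedev_le_iff by blast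
qed

lemma mp_join_mono: "X \<le>\<^sub>M X' \<Longrightarrow> Y \<le>\<^sub>M Y' \<Longrightarrow> mp_join X Y \<le>\<^sub>M mp_join X' Y'"
  by (meson medvedev_le_trans mp_join_least mp_join_ub1 mp_join_ub2)

lemma mp_meet_mono: "X \<le>\<^sub>M X' \<Longrightarrow> Y \<le>\<^sub>M Y' \<Longrightarrow> mp_meet X Y \<le>\<^sub>M mp_meet X' Y'"
  by (meson medvedev_le_trans mp_meet_greatest mp_meet_lb1 mp_meet_lb2)

lemma mp_join_commute: "mp_join X Y \<le>\<^sub>M mp_join Y X"
  by (simp add: mp_join_least mp_join_ub1 mp_join_ub2)

lemma mp_modus_ponens: "Y \<le>\<^sub>M mp_join X (mp_imp X Y)"
  by (simp add: mp_residuation medvedev_le_refl)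

lemma mp_imp_mono: "X' \<le>\<^sub>M X \<Longrightarrow> Y \<le>\<^sub>M Y' \<Longrightarrow> mp_imp X Y \<le>\<^sub>M mp_imp X' Y'"
  by (meson medvedev_le_refl medvedev_le_trans mp_join_mono mp_modus_ponens mp_residuation)

text \<open>By residuation, joining with a fixed problem preserves meets; distributivity is this
  fact used twice.\<close>

lemma mp_distrib: "mp_meet (mp_join X Y) Z \<le>\<^sub>M mp_join (mp_meet X Z) (mp_meet Y Z)"
proof -
  let ?W = "mp_meet (mp_join X Y) Z"
  have "?W \<le>\<^sub>M mp_join (mp_meet X Z) Y"
  proof -
    have "mp_imp Y ?W \<le>\<^sub>M mp_meet X Z"
    proof (rule mp_meet_greatest; fold mp_residuation)
      show "?W \<le>\<^sub>M mp_join Y X" by (meson medvedev_le_trans mp_meet_lb1 mp_join_commute)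
      show "?W \<le>\<^sub>M mp_join Y Z" by (meson medvedev_le_trans mp_meet_lb2 mp_join_ub2)
    qed
    then show ?thesis by (meson medvedev_le_trans mp_join_commute mp_residuation)
  qed
  moreover have "?W \<le>\<^sub>M mp_join (mp_meet X Z) Z" by (meson medvedev_le_trans mp_meet_lb2 mp_join_ub2)
  ultimately show ?thesis by (simp add: mp_residuation mp_meet_greatest)
qed

lemma mp_distrib_join: "mp_meet (mp_join X Y) (mp_join X Z) \<le>\<^sub>M mp_join X (mp_meet Y Z)"
  unfolding mp_residuation[of _ X] by (intro mp_meet_greatest; fold mp_residuation)
    (rule mp_meet_lb1 mp_meet_lb2)+

lemma degree_eq_iff: "degree X = degree Y \<longleftrightarrow> X \<le>\<^sub>M Y \<and> Y \<le>\<^sub>M X"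
  unfolding degree_def
  using eq_equiv_class_iff[OF equiv_medvedev_rel, of X Y] by (simp add: medvedev_rel_def)

lemma lift2_degree:
  assumes "\<And>X X' Y Y'. \<lbrakk>X \<le>\<^sub>M X'; X' \<le>\<^sub>M X; Y \<le>\<^sub>M Y'; Y' \<le>\<^sub>M Y\<rbrakk> \<Longrightarrow> h X Y \<le>\<^sub>M h X' Y'"
  shows "lift2 medvedev_rel h (degree X) (degree Y) = degree (h X Y)"
proof -
  have "degree (h X' Y') = degree (h X Y)" if "X' \<in> degree X" "Y' \<in> degree Y" for X' Y'
    using that assms by (auto simp: degree_eq_iff) (auto simp: degree_def medvedev_rel_def)
  moreover have "X \<in> degree X" "Y \<in> degree Y"
    by (auto simp: degree_def medvedev_rel_def medvedev_le_refl)
  ultimately show ?thesis unfolding lift2_def degree_def[symmetric] by blast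
qed

lemma Medvedev_simps [simp]:
  "carrier Medvedev = range degree"
  "join Medvedev (degree X) (degree Y) = degree (mp_join X Y)"
  "meet Medvedev (degree X) (degree Y) = degree (mp_meet X Y)"
  "imp Medvedev (degree X) (degree Y) = degree (mp_imp X Y)"
  "zero Medvedev = degree UNIV" "one Medvedev = degree {}"
  by (auto simp: Medvedev_def degree_def Equiv_Relations.quotient_def lift2_degree[unfolded degree_def]
      mp_join_mono mp_meet_mono mp_imp_mono)

lemma le_Medvedev [simp]: "le Medvedev (degree X) (degree Y) \<longleftrightarrow> X \<le>\<^sub>M Y"
  by (auto simp: le_def degree_eq_iff mp_join_ub2 medvedev_le_refl
      intro: mp_join_least medvedev_le_trans[OF mp_join_ub1])

lemma brouwer_algebra_Medvedev: "brouwer_algebra Medvedev"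
proof (unfold_locales, goal_cases)
  case (10 a b)
  then show ?case
    by (clarsimp simp: degree_eq_iff mp_join_least mp_join_ub1 medvedev_le_refl mp_meet_lb1)
next
  case (12 a b c)
  then show ?case
    by (clarsimp simp: degree_eq_iff mp_distrib mp_join_least mp_meet_mono mp_join_ub1 mp_join_ub2 medvedev_le_refl)
next
  case (13 a)
  then show ?case by (auto simp: medvedev_le_subset)
next
  case (14 a)
  then show ?case by (auto simp: medvedev_le_subset)
next
  case (15 a b c)
  then show ?case by (auto simp: mp_residuation)
next
  case (8 a b c)
  then show ?case
    by (clarsimp simp: degree_eq_iff)
      (meson medvedev_le_trans mp_join_least mp_join_ub1 mp_join_ub2)
next
  case (9 a b c)
  then show ?case
    by (clarsimp simp: degree_eq_iff)
      (meson medvedev_le_trans mp_meet_greatest mp_meet_lb1 mp_meet_lb2)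
next
  case (11 a b)
  then show ?case
    by (clarsimp simp: degree_eq_iff mp_meet_greatest mp_join_ub1 medvedev_le_refl mp_meet_lb1)
next
  case (6 a b)
  then show ?case by (clarsimp simp: degree_eq_iff mp_join_commute)
next
  case (7 a b)
  then show ?case by (clarsimp simp: degree_eq_iff mp_meet_greatest mp_meet_lb1 mp_meet_lb2)
qed auto

section \<open>Soundness of intuitionistic logic\<close>

context brouwer_algebra
begin

lemma le_refl: "a \<in> carrier B \<Longrightarrow> le B a a"
  by (simp add: le_def join_idem)

lemma le_trans: "\<lbrakk>le B a b; le B b c; a \<in> carrier B; b \<in> carrier B; c \<in> carrier B\<rbrakk> \<Longrightarrow> le B a c"
  unfolding le_def by (metis join_assoc)

lemma le_antisym: "\<lbrakk>le B a b; le B b a; a \<in> carrier B; b \<in> carrier B\<rbrakk> \<Longrightarrow> a = b"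
  unfolding le_def by (metis join_commute)

lemma join_ub1: "\<lbrakk>a \<in> carrier B; b \<in> carrier B\<rbrakk> \<Longrightarrow> le B a (join B a b)"
  unfolding le_def by (metis join_assoc join_idem)

lemma join_ub2: "\<lbrakk>a \<in> carrier B; b \<in> carrier B\<rbrakk> \<Longrightarrow> le B b (join B a b)"
  using join_ub1[of b a] join_commute by simp

lemma join_least:
  "\<lbrakk>le B a c; le B b c; a \<in> carrier B; b \<in> carrier B; c \<in> carrier B\<rbrakk> \<Longrightarrow> le B (join B a b) c"
  unfolding le_def by (simp add: join_assoc)

lemma meet_lb1: "\<lbrakk>a \<in> carrier B; b \<in> carrier B\<rbrakk> \<Longrightarrow> le B (meet B a b) a"
  by (metis closed(2) join_absorb join_commute le_def)

lemma meet_lb2: "\<lbrakk>a \<in> carrier B; b \<in> carrier B\<rbrakk> \<Longrightarrow> le B (meet B a b) b"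
  using meet_lb1[of b a] meet_commute by simp

lemma meet_greatest:
  "\<lbrakk>le B c a; le B c b; a \<in> carrier B; b \<in> carrier B; c \<in> carrier B\<rbrakk> \<Longrightarrow> le B c (meet B a b)"
  by (metis closed(2) le_iff_meet meet_assoc)

lemma modus_ponens: "\<lbrakk>a \<in> carrier B; b \<in> carrier B\<rbrakk> \<Longrightarrow> le B b (join B a (imp B a b))"
  by (simp add: residuation le_refl)

lemma imp_eq_zero_iff: "\<lbrakk>a \<in> carrier B; b \<in> carrier B\<rbrakk> \<Longrightarrow> imp B a b = zero B \<longleftrightarrow> le B b a"
proof -
  assume ab: "a \<in> carrier B" "b \<in> carrier B"
  have "join B a (zero B) = a" using ab zero_least[of a] join_commute by (simp add: le_def)
  then have "le B b a \<longleftrightarrow> le B (imp B a b) (zero B)" using ab residuation[of a b "zero B"] by simp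
  then show ?thesis using ab le_antisym zero_least le_refl closed by metis
qed

lemma value_closed [simp, intro]: "(\<And>i. v i \<in> carrier B) \<Longrightarrow> value_of B v p \<in> carrier B"
  by (induction p) auto

lemma IPC_sound: "p \<in> IPC \<Longrightarrow> (\<And>i. v i \<in> carrier B) \<Longrightarrow> value_of B v p = zero B"
proof (induction rule: IPC.induct)
  case (K p q)
  then show ?case by (simp add: imp_eq_zero_iff imp_le)
next
  case (S p q r)
  let ?p = "value_of B v p" and ?q = "value_of B v q" and ?r = "value_of B v r"
  note cl = value_closed[OF S]
  let ?pq = "imp B ?p ?q" and ?pqr = "imp B ?p (imp B ?q ?r)"
  let ?j = "join B ?p (join B ?pq ?pqr)"
  have c: "?j \<in> carrier B" using cl by simp
  have 0: "le B ?p ?j" using cl by (simp add: join_ub1)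
  have 1: "le B ?pq ?j"
    using cl by (intro le_trans[OF join_ub1[of ?pq ?pqr] join_ub2]) auto
  have 2: "le B ?pqr ?j"
    using cl by (intro le_trans[OF join_ub2[of ?pq ?pqr] join_ub2]) auto
  have 3: "le B ?q ?j"
    using cl 0 1 by (intro le_trans[OF modus_ponens[of ?p ?q] join_least]) auto
  have 4: "le B (imp B ?q ?r) ?j"
    using cl 0 2 by (intro le_trans[OF modus_ponens[of ?p "imp B ?q ?r"] join_least]) auto
  have "le B ?r ?j"
    using cl 3 4 by (intro le_trans[OF modus_ponens[of ?q ?r] join_least]) auto
  then show ?case using cl by (simp add: imp_eq_zero_iff residuation[symmetric])
next
  case (disjE p r q)
  let ?p = "value_of B v p" and ?q = "value_of B v q" and ?r = "value_of B v r"
  note cl = value_closed[OF disjE]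
  let ?a = "imp B ?p ?r" and ?b = "imp B ?q ?r"
  have 1: "le B ?r (join B ?b (join B ?a ?p))"
    using cl by (intro le_trans[OF modus_ponens[of ?p ?r]])
      (auto intro!: join_least le_trans[OF join_ub1 join_ub2] le_trans[OF join_ub2 join_ub2])
  have 2: "le B ?r (join B ?b (join B ?a ?q))"
    using cl by (intro le_trans[OF modus_ponens[of ?q ?r]])
      (auto intro!: join_least join_ub1 le_trans[OF join_ub2 join_ub2])
  \<comment> \<open>With \<open>?p\<close> and \<open>?q\<close> alone on the right of
    \<open>le\<close>, the two cases can be merged by \<open>meet_greatest\<close>.\<close>
  from 1 2 have "le B (imp B ?a (imp B ?b ?r)) (meet B ?p ?q)"
    using cl by (intro meet_greatest) (auto simp: residuation[symmetric])
  then have "le B ?r (join B ?b (join B ?a (meet B ?p ?q)))"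
    using cl by (simp add: residuation)
  also have "join B ?b (join B ?a (meet B ?p ?q)) = join B (meet B ?p ?q) (join B ?b ?a)"
    using cl join_assoc[of ?b ?a "meet B ?p ?q"] join_commute[of "meet B ?p ?q" "join B ?b ?a"]
    by simp
  finally show ?case using cl by (simp add: imp_eq_zero_iff residuation[symmetric])
next
  case (mp p q)
  then have "imp B (zero B) (value_of B v q) = zero B" by simp
  then have "le B (value_of B v q) (zero B)"
    using imp_eq_zero_iff[of "zero B" "value_of B v q"] mp.prems by simp
  then show ?case using mp.prems by (intro le_antisym zero_least) auto
qed (auto simp: imp_eq_zero_iff residuation[symmetric] join_ub1 join_ub2 meet_lb1 meet_lb2
    one_greatest join_commute le_refl)

end

section \<open>Bounded runs of the universal functional\<close>

definition universal :: code where
  "universal = (SOME c. \<forall>f n x. eval c f (pr n x) = Phi n f x)"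

lemma eval_universal: "eval universal f (pr n x) = Phi n f x"
  using someI_ex[OF universal_code] unfolding universal_def by blast

definition bPhi :: "baire \<Rightarrow> nat \<Rightarrow> nat \<Rightarrow> nat \<Rightarrow> nat option" where
  "bPhi f s n x = beval universal f s (pr n x)"

lemma bPhi_mono: "bPhi f s n x = Some y \<Longrightarrow> s \<le> t \<Longrightarrow> bPhi f t n x = Some y"
  unfolding bPhi_def by (rule beval_mono)

lemma bPhi_sound: "bPhi f s n x = Some y \<Longrightarrow> Phi n f x = Some y"
  unfolding bPhi_def using beval_sound eval_universal by metis

lemma bPhi_complete: "Phi n f x = Some y \<Longrightarrow> \<exists>s. bPhi f s n x = Some y"
  unfolding bPhi_def by (intro beval_complete) (simp add: eval_universal)

lemma bPhi_cong: "(\<And>k. k < s \<Longrightarrow> f k = g k) \<Longrightarrow> bPhi f s n x = bPhi g s n x"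
  unfolding bPhi_def by (rule beval_cong)

lemma cf_bPhi:
  assumes D: "cf (\<lambda>f z. D f (p1 z) (p2 z))" and "cf S" "cf N" "cf X"
  shows "cf (\<lambda>f x. enc_opt (bPhi (D f x) (S f x) (N f x) (X f x)))"
  using cf_param[OF cf_beval[of universal] D cf_pair[OF assms(2) cf_pair[OF assms(3,4)]]]
  by (simp add: bPhi_def)

section \<open>Coded sequences\<close>

text \<open>No length is stored: each number codes an infinite sequence, and a string is such a
  number together with a length given elsewhere. Thus every number is admissible in a
  search.\<close>

definition entry :: "nat \<Rightarrow> nat \<Rightarrow> nat" where "entry r k = p1 ((p2 ^^ k) r)"

lemma entry_simps [simp]: "entry (pr a r) 0 = a" "entry (pr a r) (Suc k) = entry r k"
  by (simp_all add: entry_def funpow_Suc_right del: funpow.simps(2))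

lemma cf_entry [cf_intros]: "cf F \<Longrightarrow> cf G \<Longrightarrow> cf (\<lambda>f x. entry (F f x) (G f x))"
proof -
  assume "cf F" "cf G"
  then have "cf (\<lambda>f x. p1 (rec_nat (F f x) (\<lambda>k r. p2 r) (G f x)))"
    by (intro cf_rec cf_intros)
  moreover have "rec_nat r (\<lambda>k r. p2 r) k = (p2 ^^ k) r" for r k by (induction k) auto
  ultimately show ?thesis by (simp add: entry_def)
qed

primrec lcode :: "nat list \<Rightarrow> nat" where
  "lcode [] = 0"
| "lcode (a # l) = pr a (lcode l)"

lemma entry_lcode [simp]: "k < length l \<Longrightarrow> entry (lcode l) k = l ! k"
  by (induction l arbitrary: k) (auto simp: nth_Cons split: nat.splits)

lemma cf_lcode_snoc: "cf F \<Longrightarrow> cf (\<lambda>f x. lcode (l @ [F f x]))"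
  by (induction l) (auto intro: cf_intros)

lemma cf_lcode_map:
  assumes "cf D" "cf N" shows "cf (\<lambda>f x. lcode (map (D f) [0..<N f x]))"
proof -
  have "cf (\<lambda>f z. D f (N f (p1 z) - 1 - p1 (p2 z)))"
    by (intro cf_comp[OF assms(1)] cf_intros cf_comp[OF assms(2)])
  then have "cf (\<lambda>f x. rec_nat 0 (\<lambda>k r. pr (D f (N f x - 1 - k)) r) (N f x))"
    by (intro cf_rec cf_intros assms(2))
  moreover have "rec_nat 0 (\<lambda>k r. pr (g (n - 1 - k)) r) m = lcode (map g [n - m..<n])"
    if "m \<le> n" for g n m
    using that
  proof (induction m)
    case (Suc m)
    then have "[n - Suc m..<n] = (n - 1 - m) # [n - m..<n]"
      by (subst upt_conv_Cons) (auto simp: Suc_diff_Suc)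
    with Suc show ?case by simp
  qed simp
  ultimately show ?thesis by simp
qed

definition splice :: "nat \<Rightarrow> nat \<Rightarrow> nat \<Rightarrow> nat \<Rightarrow> nat" where
  "splice len a r k = (if k < len then entry a k else entry r (k - len))"

lemma cf_splice [cf_intros]:
  "\<lbrakk>cf L; cf A; cf R; cf E\<rbrakk> \<Longrightarrow> cf (\<lambda>f x. splice (L f x) (A f x) (R f x) (E f x))"
  unfolding splice_def by (intro cf_intros)

lemma bPhi_fjoin_cong:
  assumes "\<And>k. k < s \<Longrightarrow> g k = h k"
  shows "bPhi (f \<oplus> g) s n x = bPhi (f \<oplus> h) s n x"
proof (rule bPhi_cong)
  show "(f \<oplus> g) k = (f \<oplus> h) k" if "k < s" for k
    using assms[of "k div 2"] that by (auto simp: fjoin_def)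
qed

section \<open>Splittings\<close>

text \<open>\<open>good B n len a q\<close>: the number \<open>q\<close> codes two extensions, of the same length, of the string
  coded by \<open>len\<close> and \<open>a\<close> that force different values of the \<open>n\<close>-th functional over \<open>B\<close>.\<close>

definition forced :: "baire \<Rightarrow> nat \<Rightarrow> nat \<Rightarrow> nat \<Rightarrow> nat \<Rightarrow> nat \<Rightarrow> nat \<Rightarrow> nat" where
  "forced B n len a r x s = enc_opt (bPhi (B \<oplus> splice len a r) s n x)"

definition good :: "baire \<Rightarrow> nat \<Rightarrow> nat \<Rightarrow> nat \<Rightarrow> nat \<Rightarrow> bool" where
  "good B n len a q \<longleftrightarrow> (case (p1 q, p1 (p2 q), p1 (p2 (p2 q)), p1 (p2 (p2 (p2 q))), p2 (p2 (p2 (p2 q)))) of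
     (L, r, r', x, s) \<Rightarrow> s \<le> len + L \<and> forced B n len a r x s \<noteq> 0 \<and> forced B n len a r' x s \<noteq> 0
       \<and> forced B n len a r x s \<noteq> forced B n len a r' x s)"

lemma cf_fjoin_splice:
  assumes "cf L" "cf A" "cf R"
  shows "cf (\<lambda>f z. (f \<oplus> splice (L f (p1 z)) (A f (p1 z)) (R f (p1 z))) (p2 z))"
  unfolding fjoin_def by (intro cf_intros cf_comp[OF assms(1)] cf_comp[OF assms(2)] cf_comp[OF assms(3)]) simp_all

lemma cp_good:
  assumes "cf D" "cf N" "cf L" "cf A" "cf Q"
  shows "cp (\<lambda>f x. good (D f) (N f x) (L f x) (A f x) (Q f x))"
proof -
  have "cp (\<lambda>f z. good f (p1 (p1 z)) (p1 (p2 (p1 z))) (p2 (p2 (p1 z))) (p2 z))"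
    unfolding good_def forced_def case_prod_conv by (intro cf_intros cf_bPhi cf_fjoin_splice)
  from cp_comp[OF cp_subst[OF this assms(1)] cf_pair[OF cf_pair[OF assms(2) cf_pair[OF assms(3,4)]] assms(5)]]
  show ?thesis by simp
qed

definition split :: "baire \<Rightarrow> nat \<Rightarrow> nat list \<Rightarrow> bool" where
  "split B n l \<longleftrightarrow> (\<exists>q. good B n (length l) (lcode l) q)"

text \<open>Two different values are forced at one argument, so at least one of them misses
  \<open>t x\<close>. Both halves have the length \<open>p1 q\<close>; this lets a decoder who does
  not know \<open>t\<close> skip whichever half was taken.\<close>

lemma good_diagonalize:
  assumes "good B n (length l) (lcode l) q"
  shows "\<exists>\<rho> x v. length \<rho> = p1 q \<and> v \<noteq> t x
     \<and> (\<forall>h. (\<forall>k<length (l @ \<rho>). h k = (l @ \<rho>) ! k) \<longrightarrow> Phi n (B \<oplus> h) x = Some v)"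
proof -
  let ?x = "p1 (p2 (p2 (p2 q)))" and ?s = "p2 (p2 (p2 (p2 q)))"
  let ?run = "\<lambda>r. bPhi (B \<oplus> splice (length l) (lcode l) r) ?s n ?x"
  from assms obtain v w where vw: "?run (p1 (p2 q)) = Some v" "?run (p1 (p2 (p2 q))) = Some w" "v \<noteq> w"
    and s: "?s \<le> length l + p1 q"
    by (auto simp: good_def forced_def)
  have *: "\<exists>\<rho> x v. length \<rho> = p1 q \<and> v \<noteq> t x
     \<and> (\<forall>h. (\<forall>k<length (l @ \<rho>). h k = (l @ \<rho>) ! k) \<longrightarrow> Phi n (B \<oplus> h) x = Some v)"
    if r: "?run r = Some u" "u \<noteq> t ?x" for r u
  proof -
    define \<rho> where "\<rho> = map (entry r) [0..<p1 q]"
    have "Phi n (B \<oplus> h) ?x = Some u" if h: "\<forall>k<length (l @ \<rho>). h k = (l @ \<rho>) ! k" for h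
    proof -
      \<comment> \<open>\<open>good\<close> bounds the run by the length of the stem plus
        \<open>p1 q\<close>, so it cannot look beyond \<open>l @ \<rho>\<close>.\<close>
      have "splice (length l) (lcode l) r k = h k" if "k < ?s" for k
        using that s h by (auto simp: splice_def \<rho>_def nth_append)
      then have "?run r = bPhi (B \<oplus> h) ?s n ?x"
        by (rule bPhi_fjoin_cong)
      with r(1) show ?thesis by (intro bPhi_sound) simp
    qed
    then show ?thesis using r(2) by (intro exI[of _ \<rho>] exI[of _ ?x] exI[of _ u]) (simp add: \<rho>_def)
  qed
  show ?thesis using vw * by metis
qed

text \<open>Without a splitting, all values forced at an argument above the stem agree, and an
  initial segment of \<open>g\<close> forces the correct one. So \<open>B\<close> computes
  \<open>t\<close> by taking the first value that a search finds forced.\<close>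

lemma no_split_computable:
  assumes ns: "\<not> split B n l" and g: "\<And>k. k < length l \<Longrightarrow> g k = l ! k"
    and t: "Phi n (B \<oplus> g) = Some \<circ> t"
  shows "t \<le>\<^sub>T B"
proof -
  let ?len = "length l" and ?a = "lcode l"
  let ?run = "\<lambda>B x w. bPhi (B \<oplus> splice ?len ?a (p1 (p2 w))) (p2 (p2 w)) n x"
  define P where "P = (\<lambda>B x w. p2 (p2 w) \<le> ?len + p1 w \<and> enc_opt (?run B x w) \<noteq> 0)"
  have crun: "cf (\<lambda>f z. enc_opt (?run f (p1 z) (p2 z)))"
    by (intro cf_bPhi cf_fjoin_splice cf_intros)
  have "cp (\<lambda>f z. P f (p1 z) (p2 z))" unfolding P_def by (intro cf_intros crun)
  from search_code[OF this] obtain c where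
    c: "\<And>f x. eval c f x = (if \<exists>w. P f x w then Some (LEAST w. P f x w) else None)" by blast
  have "cf (\<lambda>f z. enc_opt (?run f (p1 z) (p2 z)) - 1)" by (intro cf_intros crun)
  then obtain d where d: "\<forall>f z. eval d f z = Some (enc_opt (?run f (p1 z) (p2 z)) - 1)"
    unfolding cf_def ..
  have "eval (Comp d (Tuple (Tuple Fst Snd) c)) B x = Some (t x)" for x
  proof -
    from t have "Phi n (B \<oplus> g) x = Some (t x)" by simp
    then obtain s where s: "bPhi (B \<oplus> g) s n x = Some (t x)" using bPhi_complete by blast
    define r where "r = lcode (map (\<lambda>k. g (?len + k)) [0..<s])"
    have "splice ?len ?a r k = g k" if "k < ?len + s" for k
      using that g by (auto simp: splice_def r_def)
    then have "bPhi (B \<oplus> splice ?len ?a r) s n x = bPhi (B \<oplus> g) s n x"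
      by (intro bPhi_fjoin_cong) simp
    with s have r: "bPhi (B \<oplus> splice ?len ?a r) s n x = Some (t x)" by simp
    then have "P B x (pr s (pr r s))" by (simp add: P_def)
    then have ex: "\<exists>w. P B x w" ..
    define w where "w = (LEAST w. P B x w)"
    have "P B x w" unfolding w_def using ex by (rule LeastI_ex)
    then obtain y where w: "?run B x w = Some y" "p2 (p2 w) \<le> ?len + p1 w" by (auto simp: P_def)
    have "y = t x"
    proof (rule ccontr)
      assume "y \<noteq> t x"
      define m where "m = max s (p2 (p2 w))"
      have "bPhi (B \<oplus> splice ?len ?a (p1 (p2 w))) m n x = Some y"
        "bPhi (B \<oplus> splice ?len ?a r) m n x = Some (t x)"
        using w(1) r by (auto intro: bPhi_mono simp: m_def)
      \<comment> \<open>A splitting needs one bound and one length for both halves; by monotonicity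
        the two runs are raised to the bound \<open>m\<close>, and the longer of the two extensions
        fixes the length.\<close>
      then have "good B n ?len ?a (pr (max s (p1 w)) (pr (p1 (p2 w)) (pr r (pr x m))))"
        using \<open>y \<noteq> t x\<close> w(2) by (auto simp: good_def forced_def m_def)
      with ns show False by (auto simp: split_def)
    qed
    then show ?thesis using ex w(1) by (simp add: c d w_def)
  qed
  then have "eval (Comp d (Tuple (Tuple Fst Snd) c)) B = Some \<circ> t" by (simp add: fun_eq_iff)
  then show ?thesis unfolding turing_le_iff by blast
qed

section \<open>Simultaneous keys\<close>

abbreviation others :: "nat set \<Rightarrow> nat set \<Rightarrow> nat \<Rightarrow> nat" where
  "others A K \<equiv> Join (- K) (column A)"

text \<open>Membership in \<open>X \<oplus> -X\<close> for the column \<open>X\<close> with index \<open>l\<close>.\<close>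

definition star :: "nat set \<Rightarrow> nat \<Rightarrow> nat \<Rightarrow> bool" where
  "star A l a \<longleftrightarrow> column A l (a div 2) = of_bool (even a)"

text \<open>If no such \<open>j\<close> existed, then, by induction on the number of keys, membership of \<open>a\<close> in
  \<^term>\<open>star A s\<close> would be enumerable from the other columns.\<close>

lemma key_choice:
  assumes A: "computably_independent A" and K: "cf (\<lambda>f x. of_bool (x \<in> K))"
    and H: "cp H"
  shows "\<exists>j. (\<forall>l<m. s + l \<in> K \<longrightarrow> star A (s + l) (entry j l))
                \<and> \<not> (\<exists>q. H (others A K) (pr j q))
           \<or> (\<forall>l<m. s + l \<in> K \<longrightarrow> \<not> star A (s + l) (entry j l))
                \<and> (\<exists>q. H (others A K) (pr j q))"
  using H
proof (induction m arbitrary: s H)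
  case 0
  show ?case by auto
next
  case (Suc m)
  let ?B = "others A K"
  let ?yes = "\<lambda>j. \<forall>l<m. Suc s + l \<in> K \<longrightarrow> star A (Suc s + l) (entry j l)"
  let ?no = "\<lambda>j. \<forall>l<m. Suc s + l \<in> K \<longrightarrow> \<not> star A (Suc s + l) (entry j l)"
  have IH: "\<exists>j. ?yes j \<and> \<not> (\<exists>q. H ?B (pr (pr a j) q)) \<or> ?no j \<and> (\<exists>q. H ?B (pr (pr a j) q))" for a
  proof -
    have "cf (\<lambda>f z. pr (pr a (p1 z)) (p2 z))" by (intro cf_intros)
    from cp_comp[OF Suc.prems this] Suc.IH[of "\<lambda>f z. H f (pr (pr a (p1 z)) (p2 z))" "Suc s"]
    show ?thesis by simp
  qed
  show ?case
  proof (rule ccontr)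
    assume neg: "\<not> ?case"
    have no: "\<not> ((s \<in> K \<longrightarrow> star A s a) \<and> ?yes j \<and> \<not> (\<exists>q. H ?B (pr (pr a j) q)))"
      "\<not> ((s \<in> K \<longrightarrow> \<not> star A s a) \<and> ?no j \<and> (\<exists>q. H ?B (pr (pr a j) q)))" for a j
    proof -
      have "(\<forall>l<Suc m. s + l \<in> K \<longrightarrow> star A (s + l) (entry (pr a j) l))
            \<longleftrightarrow> (s \<in> K \<longrightarrow> star A s a) \<and> ?yes j"
        "(\<forall>l<Suc m. s + l \<in> K \<longrightarrow> \<not> star A (s + l) (entry (pr a j) l))
            \<longleftrightarrow> (s \<in> K \<longrightarrow> \<not> star A s a) \<and> ?no j"
        by (subst All_less_Suc2; simp)+
      with neg show "\<not> ((s \<in> K \<longrightarrow> star A s a) \<and> ?yes j \<and> \<not> (\<exists>q. H ?B (pr (pr a j) q)))"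
        "\<not> ((s \<in> K \<longrightarrow> \<not> star A s a) \<and> ?no j \<and> (\<exists>q. H ?B (pr (pr a j) q)))"
        by blast+
    qed
    have sK: "s \<in> K" using no IH by blast
    \<comment> \<open>For each \<open>a\<close> one alternative of \<open>IH\<close> holds;
      \<open>no\<close> excludes the first if \<open>star A s a\<close> and the second otherwise.
      The right-hand side can be enumerated from the columns other than \<open>s\<close>.\<close>
    have iff: "star A s a \<longleftrightarrow> (\<exists>j. ?no j \<and> (\<exists>q. H ?B (pr (pr a j) q)))" for a
      using no IH by blast
    define F where "F = Join (- {s}) (column A)"
    \<comment> \<open>\<open>F\<close> keeps the later key columns, which \<open>?no\<close> asks;
      \<open>D\<close> erases them for \<open>H\<close>, whose oracle is
      \<open>others A K\<close>.\<close>
    define D where "D = (\<lambda>f k. if p1 k \<in> K then 0 else f k :: nat)"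
    have cK: "cp (\<lambda>f x. E f x \<in> K)" if "cf E" for E
      using cp_comp[of "\<lambda>f x. x \<in> K", OF _ that] K by (simp add: cp_def)
    have cD: "cf D" unfolding D_def by (intro cf_intros cK)
    have DF: "D F = ?B" using sK by (auto simp: D_def F_def Join_def fun_eq_iff split: prod.splits)
    \<comment> \<open>At \<open>n + n\<close> and \<open>n + n + 1\<close>, \<open>star\<close> says
      that the bit at \<open>n\<close> is 1 and 0, respectively. \<open>p1 w\<close> selects between
      the two, whence the output \<open>1 - p1 w\<close>.\<close>
    define W where "W = (\<lambda>f n w. p1 w < 2
      \<and> (\<forall>l<m. Suc s + l \<in> K \<longrightarrow>
            f (pr (Suc s + l) (entry (p1 (p2 w)) l div 2)) \<noteq> of_bool (even (entry (p1 (p2 w)) l)))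
      \<and> H (D f) (pr (pr (n + n + p1 w) (p1 (p2 w))) (p2 (p2 w))))"
    have WF: "W F n w \<longleftrightarrow> p1 w < 2 \<and> ?no (p1 (p2 w)) \<and> H ?B (pr (pr (n + n + p1 w) (p1 (p2 w))) (p2 (p2 w)))"
      for n w
      by (auto simp: W_def DF star_def) (auto simp: F_def Join_def)
    have 1: "cf (\<lambda>f z. pr (pr (p1 z + p1 z + p1 (p2 z)) (p1 (p2 (p2 z)))) (p2 (p2 (p2 z))))"
      by (intro cf_intros)
    have "cp (\<lambda>f z. W f (p1 z) (p2 z))" unfolding W_def
      by (intro cp_conj cp_comp[OF cp_subst[OF Suc.prems cD] 1] cp_ball cf_intros cK) simp_all
    from search_code[OF this] obtain c where
      c: "\<And>f x. eval c f x = (if \<exists>w. W f x w then Some (LEAST w. W f x w) else None)" by blast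
    have "cf (\<lambda>f x. 1 - p1 x)" by (intro cf_intros)
    then obtain d where d: "\<forall>f x. eval d f x = Some (1 - p1 x)" unfolding cf_def ..
    have "eval (Comp d c) F n = Some (column A s n)" for n
    proof -
      have st: "star A s (n + n) \<longleftrightarrow> column A s n = 1" "star A s (n + n + 1) \<longleftrightarrow> column A s n = 0"
        by (simp_all add: star_def)
      have "column A s n = 0 \<or> column A s n = 1" by (simp add: column_def char_fun_def)
      then obtain b where "b < 2" "star A s (n + n + b)"
        using st by (metis add.right_neutral one_less_numeral_iff semiring_norm(76) zero_less_numeral)
      then obtain j q where "?no j" "H ?B (pr (pr (n + n + b) j) q)" using iff by blast
      then have ex: "\<exists>w. W F n w"
        using \<open>b < 2\<close> by (intro exI[of _ "pr b (pr j q)"]) (simp add: WF)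
      define w where "w = (LEAST w. W F n w)"
      have "W F n w" unfolding w_def using ex by (rule LeastI_ex)
      then have "p1 w < 2" "star A s (n + n + p1 w)" using iff by (auto simp: WF)
      then have "column A s n = 1 - p1 w" using st by (auto simp: less_2_cases_iff)
      then show ?thesis using ex by (simp add: c d w_def)
    qed
    then have "eval (Comp d c) F = Some \<circ> column A s" by (simp add: fun_eq_iff)
    then have "column A s \<le>\<^sub>T F" unfolding turing_le_iff by blast
    with A show False by (simp add: computably_independent_def F_def)
  qed
qed

section \<open>A theorem in the style of Posner and Robinson\<close>

lemma prefix_agree:
  assumes "\<And>k. k < length \<sigma> \<Longrightarrow> \<sigma> ! k = g k" "\<sigma> = u @ w" "k < length u"
  shows "g k = u ! k"
  using assms(1)[of k] assms(2,3) by (simp add: nth_append)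

lemma limit_of_strings:
  fixes \<tau> :: "nat \<Rightarrow> nat list"
  assumes "\<And>s. \<exists>w. \<tau> (Suc s) = \<tau> s @ w \<and> w \<noteq> []"
  obtains g where "\<And>s k. k < length (\<tau> s) \<Longrightarrow> \<tau> s ! k = g k"
proof -
  have len: "s \<le> length (\<tau> s)" for s
  proof (induction s)
    case (Suc s)
    obtain w where "\<tau> (Suc s) = \<tau> s @ w" "w \<noteq> []" using assms by blast
    with Suc show ?case by (cases w) auto
  qed simp
  have ext: "\<tau> (s + d) ! k = \<tau> s ! k \<and> k < length (\<tau> (s + d))" if "k < length (\<tau> s)" for s d k
  proof (induction d)
    case (Suc d)
    obtain w where "\<tau> (Suc (s + d)) = \<tau> (s + d) @ w" using assms by blast
    with Suc show ?case by (simp add: nth_append)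
  qed (use that in simp)
  have "\<tau> s ! k = \<tau> (Suc k) ! k" if "k < length (\<tau> s)" for s k
  proof (cases "s \<le> Suc k")
    case True
    then show ?thesis using ext[OF that, of "Suc k - s"] by simp
  next
    case False
    have "k < length (\<tau> (Suc k))" using len[of "Suc k"] by simp
    from ext[OF this, of "s - Suc k"] False show ?thesis by simp
  qed
  with that[where g = "\<lambda>k. \<tau> (Suc k) ! k"] show thesis by blast
qed

text \<open>The real \<open>g\<close> is a concatenation of blocks \<open>j \<rho> b\<close>. The number \<open>j\<close> tells the holder of any
  one of the keys \<open>column A i\<close> whether a splitting above it exists; if so, \<open>\<rho>\<close> is one half of
  the least splitting, so that the key holder, but nobody else, finds the bit \<open>b\<close> of \<open>A\<close>.\<close>

definition block :: "nat set \<Rightarrow> nat set \<Rightarrow> baire \<Rightarrow> nat \<Rightarrow> nat list \<Rightarrow> nat list \<Rightarrow> bool" where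
  "block A K t s \<tau> \<tau>' \<longleftrightarrow> (\<exists>j.
     (\<forall>l<s. l \<in> K \<longrightarrow> star A l (entry j l)) \<and> \<not> split (others A K) (p2 s) (\<tau> @ [j])
       \<and> \<tau>' = (\<tau> @ [j]) @ [char_fun A s]
   \<or> (\<forall>l<s. l \<in> K \<longrightarrow> \<not> star A l (entry j l)) \<and> split (others A K) (p2 s) (\<tau> @ [j])
       \<and> (\<exists>\<rho>. length \<rho>
              = p1 (LEAST q. good (others A K) (p2 s) (length (\<tau> @ [j])) (lcode (\<tau> @ [j])) q)
          \<and> (\<exists>x v. v \<noteq> t x \<and> (\<forall>h. (\<forall>k<length ((\<tau> @ [j]) @ \<rho>). h k = ((\<tau> @ [j]) @ \<rho>) ! k)
                \<longrightarrow> Phi (p2 s) (others A K \<oplus> h) x = Some v))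
          \<and> \<tau>' = ((\<tau> @ [j]) @ \<rho>) @ [char_fun A s]))"

lemma ex_block:
  assumes "computably_independent A" and "cf (\<lambda>f x. of_bool (x \<in> K))"
  shows "\<exists>\<tau>'. block A K t s \<tau> \<tau>'"
proof -
  let ?B = "others A K"
  have "cp (\<lambda>f z. good f (p2 s) (length \<tau> + 1) (lcode (\<tau> @ [p1 z])) (p2 z))"
    by (intro cp_good cff_id cf_intros cf_lcode_snoc)
  \<comment> \<open>The candidate \<open>j\<close> is itself appended to the stem, so the common
    answer to the questions in \<open>j\<close> concerns splittings above a string that contains
    these questions.\<close>
  from key_choice[OF assms this, of s 0] obtain j where
    "(\<forall>l<s. l \<in> K \<longrightarrow> star A l (entry j l)) \<and> \<not> split ?B (p2 s) (\<tau> @ [j])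
     \<or> (\<forall>l<s. l \<in> K \<longrightarrow> \<not> star A l (entry j l)) \<and> split ?B (p2 s) (\<tau> @ [j])"
    by (auto simp: split_def)
  then show ?thesis
  proof
    assume "(\<forall>l<s. l \<in> K \<longrightarrow> star A l (entry j l)) \<and> \<not> split ?B (p2 s) (\<tau> @ [j])"
    then show ?thesis unfolding block_def by blast
  next
    assume no: "(\<forall>l<s. l \<in> K \<longrightarrow> \<not> star A l (entry j l)) \<and> split ?B (p2 s) (\<tau> @ [j])"
    then have "good ?B (p2 s) (length (\<tau> @ [j])) (lcode (\<tau> @ [j]))
        (LEAST q. good ?B (p2 s) (length (\<tau> @ [j])) (lcode (\<tau> @ [j])) q)"
      unfolding split_def by (metis LeastI_ex)
    from good_diagonalize[OF this, of t] no show ?thesis unfolding block_def by blast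
  qed
qed

lemma block_append: "block A K t s \<tau> \<tau>' \<Longrightarrow> \<exists>w. \<tau>' = \<tau> @ w \<and> w \<noteq> []"
  unfolding block_def by auto

lemma block_last: "block A K t s \<tau> \<tau>' \<Longrightarrow> \<tau>' \<noteq> [] \<and> last \<tau>' = char_fun A s"
  unfolding block_def by auto

text \<open>Where nothing splits, a successful functional would make \<open>t\<close> computable
  from the other columns. Where something splits, the half chosen in the block forces a value
  different from \<open>t\<close>.\<close>

lemma block_diagonalize:
  assumes "block A K t s \<tau> \<tau>'" and g: "\<And>k. k < length \<tau>' \<Longrightarrow> \<tau>' ! k = g k"
    and t: "\<not> t \<le>\<^sub>T others A K"
  shows "Phi (p2 s) (others A K \<oplus> g) \<noteq> Some \<circ> t"
proof
  let ?B = "others A K"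
  assume Phi: "Phi (p2 s) (?B \<oplus> g) = Some \<circ> t"
  from assms(1) obtain j where
    "\<not> split ?B (p2 s) (\<tau> @ [j]) \<and> \<tau>' = (\<tau> @ [j]) @ [char_fun A s]
     \<or> (\<exists>\<rho> x v. v \<noteq> t x \<and> (\<forall>h. (\<forall>k<length ((\<tau> @ [j]) @ \<rho>). h k = ((\<tau> @ [j]) @ \<rho>) ! k)
                \<longrightarrow> Phi (p2 s) (?B \<oplus> h) x = Some v) \<and> \<tau>' = ((\<tau> @ [j]) @ \<rho>) @ [char_fun A s])"
    unfolding block_def by blast
  then show False
  proof
    assume *: "\<not> split ?B (p2 s) (\<tau> @ [j]) \<and> \<tau>' = (\<tau> @ [j]) @ [char_fun A s]"
    then have "g k = (\<tau> @ [j]) ! k" if "k < length (\<tau> @ [j])" for k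
      using prefix_agree[OF g _ that] by blast
    with no_split_computable[OF _ this Phi] * t show False by blast
  next
    assume "\<exists>\<rho> x v. v \<noteq> t x \<and> (\<forall>h. (\<forall>k<length ((\<tau> @ [j]) @ \<rho>). h k = ((\<tau> @ [j]) @ \<rho>) ! k)
                \<longrightarrow> Phi (p2 s) (?B \<oplus> h) x = Some v) \<and> \<tau>' = ((\<tau> @ [j]) @ \<rho>) @ [char_fun A s]"
    then obtain \<rho> x v where *: "v \<noteq> t x" "\<tau>' = ((\<tau> @ [j]) @ \<rho>) @ [char_fun A s]"
      "\<And>h. (\<forall>k<length ((\<tau> @ [j]) @ \<rho>). h k = ((\<tau> @ [j]) @ \<rho>) ! k) \<Longrightarrow> Phi (p2 s) (?B \<oplus> h) x = Some v"
      by blast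
    have "\<forall>k<length ((\<tau> @ [j]) @ \<rho>). g k = ((\<tau> @ [j]) @ \<rho>) ! k"
      using prefix_agree[OF g *(2)] by blast
    from *(3)[OF this] Phi *(1) show False by simp
  qed
qed

text \<open>The disjunct \<open>star\<close> makes the search stop even where nothing splits; its
  result is then ignored. Otherwise the search finds the least splitting, whose first component is
  the length to skip. The 2 accounts for \<open>j\<close> and the final bit.\<close>

lemma block_length:
  assumes "block A K t s \<tau> \<tau>'" and g: "\<And>k. k < length \<tau>' \<Longrightarrow> \<tau>' ! k = g k"
    and i: "i \<in> K" "i < s" and p: "p = length \<tau>"
  shows "\<exists>q. star A i (entry (g p) i)
      \<or> good (others A K) (p2 s) (p + 1) (lcode (map g [0..<p + 1])) q"
    and "length \<tau>' = p + 2 + (if star A i (entry (g p) i) then 0 else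
      p1 (LEAST q. star A i (entry (g p) i)
        \<or> good (others A K) (p2 s) (p + 1) (lcode (map g [0..<p + 1])) q))"
proof -
  let ?B = "others A K"
  let ?L = "\<lambda>j. p1 (LEAST q. good ?B (p2 s) (length (\<tau> @ [j])) (lcode (\<tau> @ [j])) q)"
  from assms(1) obtain j where
    "(\<forall>l<s. l \<in> K \<longrightarrow> star A l (entry j l)) \<and> \<not> split ?B (p2 s) (\<tau> @ [j])
       \<and> \<tau>' = (\<tau> @ [j]) @ [char_fun A s]
     \<or> (\<forall>l<s. l \<in> K \<longrightarrow> \<not> star A l (entry j l)) \<and> split ?B (p2 s) (\<tau> @ [j])
       \<and> (\<exists>\<rho>. length \<rho> = ?L j \<and> \<tau>' = ((\<tau> @ [j]) @ \<rho>) @ [char_fun A s])"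
    unfolding block_def by blast
  then have "\<exists>w. star A i (entry j i) \<and> \<tau>' = (\<tau> @ [j]) @ w \<and> length w = 1
     \<or> \<not> star A i (entry j i) \<and> split ?B (p2 s) (\<tau> @ [j]) \<and> \<tau>' = (\<tau> @ [j]) @ w
       \<and> length w = ?L j + 1"
  proof (rule HOL.disjE)
    assume "(\<forall>l<s. l \<in> K \<longrightarrow> star A l (entry j l)) \<and> \<not> split ?B (p2 s) (\<tau> @ [j])
       \<and> \<tau>' = (\<tau> @ [j]) @ [char_fun A s]"
    then show ?thesis using i by (intro exI[of _ "[char_fun A s]"]) simp
  next
    assume no: "(\<forall>l<s. l \<in> K \<longrightarrow> \<not> star A l (entry j l)) \<and> split ?B (p2 s) (\<tau> @ [j])
       \<and> (\<exists>\<rho>. length \<rho> = ?L j \<and> \<tau>' = ((\<tau> @ [j]) @ \<rho>) @ [char_fun A s])"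
    then obtain \<rho> where "length \<rho> = ?L j" "\<tau>' = ((\<tau> @ [j]) @ \<rho>) @ [char_fun A s]" by blast
    with no show ?thesis using i by (intro exI[of _ "\<rho> @ [char_fun A s]"]) simp
  qed
  then obtain w where
    *: "star A i (entry j i) \<and> \<tau>' = (\<tau> @ [j]) @ w \<and> length w = 1
     \<or> \<not> star A i (entry j i) \<and> split ?B (p2 s) (\<tau> @ [j]) \<and> \<tau>' = (\<tau> @ [j]) @ w
       \<and> length w = ?L j + 1" ..
  then have \<tau>': "\<tau>' = (\<tau> @ [j]) @ w" by blast
  have gk: "g k = (\<tau> @ [j]) ! k" if "k < p + 1" for k
    using prefix_agree[OF g \<tau>'] that p by simp
  then have map: "map g [0..<p + 1] = \<tau> @ [j]"
    by (intro nth_equalityI) (simp_all add: p del: upt_Suc)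
  have gp: "g p = j" using gk[of p] by (simp add: p)
  have len: "length (\<tau> @ [j]) = p + 1" by (simp add: p)
  note cs = *[unfolded split_def len]
  show "\<exists>q. star A i (entry (g p) i) \<or> good ?B (p2 s) (p + 1) (lcode (map g [0..<p + 1])) q"
    unfolding map gp using cs by blast
  show "length \<tau>' = p + 2 + (if star A i (entry (g p) i) then 0 else
      p1 (LEAST q. star A i (entry (g p) i) \<or> good ?B (p2 s) (p + 1) (lcode (map g [0..<p + 1])) q))"
    unfolding map gp using cs len
    by (elim HOL.disjE conjE) simp_all
qed

text \<open>The starting points of the blocks are computed one from another by
  \<open>block_length\<close>, and bit \<open>m\<close> of \<open>A\<close> stands just before
  \<open>pos (Suc m)\<close>. Since block \<open>s\<close> answers to the keys below
  \<open>s\<close> only, the recursion starts from the constant \<open>pos (Suc i)\<close>, and the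
  bits up to \<open>i\<close> come from the table \<open>h\<close>.\<close>

lemma key_decodes:
  assumes b: "\<And>s. block A K (t s) s (\<tau> s) (\<tau> (Suc s))"
    and g: "\<And>s k. k < length (\<tau> s) \<Longrightarrow> \<tau> s ! k = g k" and i: "i \<in> K"
  shows "char_fun A \<le>\<^sub>T (others A K \<oplus> g) \<oplus> column A i"
proof -
  let ?B = "others A K"
  define F where "F = (?B \<oplus> g) \<oplus> column A i"
  let ?DB = "\<lambda>f. fleft (fleft f)" and ?DG = "\<lambda>f. fright (fleft f)" and ?DK = "\<lambda>f. fright f"
  have parts: "?DB F = ?B" "?DG F = g" "?DK F = column A i" by (simp_all add: F_def)
  define S where "S = (\<lambda>f p. fright f (entry (?DG f p) i div 2) = of_bool (even (entry (?DG f p) i)))"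
  have SF: "S F p \<longleftrightarrow> star A i (entry (g p) i)" for p by (simp add: S_def parts star_def)
  note cG = cf_comp[OF cff_fright[OF cff_fleft[OF cff_id]]] and cK = cf_comp[OF cff_fright[OF cff_id]]
  have cS: "cp (\<lambda>f x. S f (E f x))" if "cf E" for E
    unfolding S_def by (intro cf_intros cG cK that) simp
  define P where "P = (\<lambda>f z q. S f (p2 z)
    \<or> good (?DB f) (p2 (p1 z)) (p2 z + 1) (lcode (map (?DG f) [0..<p2 z + 1])) q)"
  have "cp (\<lambda>f z. P f (p1 z) (p2 z))"
    unfolding P_def by (intro cf_intros cS cp_good cf_lcode_map cff)
  from search_code[OF this] obtain c where
    c: "\<And>f z. eval c f z = (if \<exists>q. P f z q then Some (LEAST q. P f z q) else None)" by blast
  have "cf (\<lambda>f z. p2 (p1 z) + 2 + (if S f (p2 (p1 z)) then 0 else p1 (p2 z)))"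
    by (intro cf_intros cS)
  then obtain d where
    d: "\<forall>f z. eval d f z = Some (p2 (p1 z) + 2 + (if S f (p2 (p1 z)) then 0 else p1 (p2 z)))"
    unfolding cf_def ..
  define pos where "pos = (\<lambda>s. length (\<tau> s))"
  have next_pos: "eval (Comp d (Tuple (Tuple Fst Snd) c)) F (pr s (pos s)) = Some (pos (Suc s))"
    if "i < s" for s
    using block_length[where g = g, OF b[of s] g i that refl] by (simp add: c d P_def SF parts pos_def)
  obtain e where e: "\<forall>f x. eval e f x = Some (Suc i + p1 (p2 x))"
    using cf_add[OF cf_const cf_p1[OF cf_p2[OF cf_id]]] unfolding cf_def by blast
  obtain k0 where k0: "\<forall>f x. eval k0 f x = Some (pos (Suc i))"
    using cf_const unfolding cf_def by blast
  let ?pos = "Prec k0 (Comp (Comp d (Tuple (Tuple Fst Snd) c)) (Tuple e (Comp Snd Snd)))"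
  have run: "eval ?pos F (pr x k) = Some (pos (Suc i + k))" for x k
  proof (induction k)
    case 0 show ?case by (simp add: k0)
  next
    case (Suc k)
    then have "eval ?pos F (pr x (Suc k))
        = eval (Comp d (Tuple (Tuple Fst Snd) c)) F (pr (Suc i + k) (pos (Suc i + k)))"
      by (simp add: e)
    with next_pos[of "Suc i + k"] show ?case by simp
  qed
  have last: "g (pos (Suc m) - 1) = char_fun A m" for m
    using block_last[OF b[of m]] g[of "pos (Suc m) - 1" "Suc m"] by (auto simp: pos_def last_conv_nth)
  define h where "h = (\<lambda>m. if m < Suc i then char_fun A m else 0)"
  have ch: "cf (\<lambda>f x. h (E f x))" if "cf E" for E
    by (rule cf_eventually_const[OF _ that, of "Suc i"]) (simp add: h_def)
  have "cf (\<lambda>f z. if p1 z < Suc i then h (p1 z) else ?DG f (p2 z - 1))"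
    by (intro cf_intros ch cG)
  then obtain u where u: "\<forall>f z. eval u f z = Some (if p1 z < Suc i then h (p1 z) else ?DG f (p2 z - 1))"
    unfolding cf_def ..
  have "cf (\<lambda>f x. Suc x - Suc i)" by (intro cf_intros)
  then obtain w where w: "\<forall>f x. eval w f x = Some (Suc x - Suc i)" unfolding cf_def ..
  have "eval (Comp u (Tuple (Tuple Fst Snd) (Comp ?pos (Tuple (Tuple Fst Snd) w)))) F m
      = Some (char_fun A m)" for m
  proof -
    have "eval (Comp ?pos (Tuple (Tuple Fst Snd) w)) F m = Some (pos (Suc i + (Suc m - Suc i)))"
      using run[of m "Suc m - Suc i"] by (simp only: eval.simps w bind.bind_lunit prod.collapse prod_decode_inverse)
    moreover have "Suc i + (Suc m - Suc i) = Suc m" if "\<not> m < Suc i" using that by simp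
    ultimately show ?thesis using last[of m] by (simp add: u h_def parts del: eval.simps(8))
  qed
  then have "eval (Comp u (Tuple (Tuple Fst Snd) (Comp ?pos (Tuple (Tuple Fst Snd) w)))) F
      = Some \<circ> char_fun A" by (simp add: fun_eq_iff)
  then show ?thesis unfolding turing_le_iff F_def by blast
qed

text \<open>The same \<open>g\<close> serves every key in \<open>K\<close>, even if \<open>K\<close>
  is infinite, because each key is ignored by finitely many blocks only.\<close>

theorem posner_robinson:
  assumes A: "computably_independent A" and K: "cf (\<lambda>f x. of_bool (x \<in> K))"
    and T: "countable T" "\<And>t. t \<in> T \<Longrightarrow> \<not> t \<le>\<^sub>T others A K"
  obtains g where "\<And>t. t \<in> T \<Longrightarrow> \<not> t \<le>\<^sub>T others A K \<oplus> g"
    and "\<And>i. i \<in> K \<Longrightarrow> char_fun A \<le>\<^sub>T (others A K \<oplus> g) \<oplus> column A i"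
proof -
  \<comment> \<open>Stage \<open>pr a n\<close> plays the functional with index \<open>n\<close>
    against member number \<open>a\<close> of \<open>T\<close>.\<close>
  define t where "t = (\<lambda>s. from_nat_into T (p1 s))"
  have "\<exists>\<tau>. \<forall>s. True \<and> block A K (t s) s (\<tau> s) (\<tau> (Suc s))"
    using ex_block[OF A K] by (intro dependent_nat_choice) auto
  then obtain \<tau> where \<tau>: "\<And>s. block A K (t s) s (\<tau> s) (\<tau> (Suc s))" by blast
  obtain g where g: "\<And>s k. k < length (\<tau> s) \<Longrightarrow> \<tau> s ! k = g k"
    using limit_of_strings[of \<tau>] block_append[OF \<tau>] by blast
  show thesis
  proof
    fix x assume x: "x \<in> T"
    show "\<not> x \<le>\<^sub>T others A K \<oplus> g"
    proof
      assume "x \<le>\<^sub>T others A K \<oplus> g"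
      then obtain n where n: "Phi n (others A K \<oplus> g) = Some \<circ> x"
        unfolding turing_le_def ..
      let ?s = "pr (to_nat_on T x) n"
      have "t ?s = x" using T(1) x by (simp add: t_def)
      then show False
        using block_diagonalize[OF \<tau>[of ?s] g] n T(2)[OF x] by simp
    qed
  next
    fix i assume "i \<in> K"
    then show "char_fun A \<le>\<^sub>T (others A K \<oplus> g) \<oplus> column A i"
      using key_decodes[OF \<tau> g] by blast
  qed
qed

section \<open>Finite countermodels for non-theorems\<close>

inductive der :: "form set \<Rightarrow> form \<Rightarrow> bool" for \<Gamma> where
  ax: "p \<in> IPC \<Longrightarrow> der \<Gamma> p"
| hyp: "p \<in> \<Gamma> \<Longrightarrow> der \<Gamma> p"
| mp: "der \<Gamma> (Impl p q) \<Longrightarrow> der \<Gamma> p \<Longrightarrow> der \<Gamma> q"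

lemma der_empty: "der {} p \<Longrightarrow> p \<in> IPC"
  by (induction rule: der.induct) (auto intro: IPC.mp)

lemma deduction: "der (insert q \<Gamma>) p \<Longrightarrow> der \<Gamma> (Impl q p)"
proof (induction rule: der.induct)
  case (ax p)
  then show ?case by (meson IPC.K IPC.mp der.ax)
next
  case (hyp p)
  have "Impl q q \<in> IPC" by (meson IPC.K IPC.S IPC.mp)
  with hyp show ?case by (metis IPC.K der.simps insert_iff)
next
  case (mp p r)
  then show ?case by (meson IPC.S der.ax der.mp)
qed

text \<open>Consistent prime theories cut down to \<open>\<Sigma>\<close>. Closure under derivation
  is asked inside \<open>\<Sigma>\<close> only, so a finite \<open>\<Sigma>\<close> leaves finitely
  many worlds.\<close>

definition saturated :: "form set \<Rightarrow> form set \<Rightarrow> bool" where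
  "saturated \<Sigma> T \<longleftrightarrow> T \<subseteq> \<Sigma> \<and> (\<forall>p\<in>\<Sigma>. der T p \<longrightarrow> p \<in> T) \<and> \<not> der T Bot
     \<and> (\<forall>p q. Disj p q \<in> T \<longrightarrow> p \<in> T \<or> q \<in> T)"

text \<open>A maximal set that does not derive \<open>p\<close> derives \<open>Impl q p\<close> for
  each \<open>q\<close> of \<open>\<Sigma>\<close> outside it. If both members of a disjunction were
  outside, \<open>disjE\<close> would give \<open>p\<close>.\<close>

lemma saturated_extension:
  assumes \<Sigma>: "finite \<Sigma>" "\<And>p q. Disj p q \<in> \<Sigma> \<Longrightarrow> p \<in> \<Sigma> \<and> q \<in> \<Sigma>" and \<Gamma>: "\<Gamma> \<subseteq> \<Sigma>" "\<not> der \<Gamma> p"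
  obtains T where "\<Gamma> \<subseteq> T" "saturated \<Sigma> T" "\<not> der T p"
proof -
  define C where "C = {T. \<Gamma> \<subseteq> T \<and> T \<subseteq> \<Sigma> \<and> \<not> der T p}"
  have "finite C" using \<Sigma>(1) unfolding C_def by (auto intro: finite_subset[of _ "Pow \<Sigma>"])
  moreover have "\<Gamma> \<in> C" using \<Gamma> by (simp add: C_def)
  ultimately obtain T where T: "T \<in> C" "\<And>T'. T' \<in> C \<Longrightarrow> T \<subseteq> T' \<Longrightarrow> T' = T"
    using finite_has_maximal[of C] by blast
  have max: "der T (Impl q p)" if "q \<in> \<Sigma>" "q \<notin> T" for q
  proof (rule ccontr)
    assume "\<not> der T (Impl q p)"
    then have "insert q T \<in> C" using T(1) that(1) deduction by (auto simp: C_def)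
    from T(2)[OF this] that(2) show False by blast
  qed
  have np: "\<not> der T p" using T(1) by (simp add: C_def)
  have "saturated \<Sigma> T"
    unfolding saturated_def
  proof (intro HOL.conjI ballI impI allI)
    show "T \<subseteq> \<Sigma>" using T(1) by (simp add: C_def)
    show "q \<in> T" if "q \<in> \<Sigma>" "der T q" for q
      using max[OF that(1)] that(2) np der.mp by blast
    show "\<not> der T Bot" using np der.mp[OF der.ax[OF IPC.botE]] by blast
    show "a \<in> T \<or> b \<in> T" if "Disj a b \<in> T" for a b
    proof (rule ccontr)
      assume "\<not> (a \<in> T \<or> b \<in> T)"
      moreover have "Disj a b \<in> \<Sigma>" using that T(1) by (auto simp: C_def)
      note \<Sigma>(2)[OF this]
      ultimately have "der T (Impl a p)" "der T (Impl b p)" using max by blast+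
      from der.mp[OF der.mp[OF der.mp[OF der.ax[OF IPC.disjE] this(1)] this(2)] der.hyp[OF that]] np
      show False by blast
    qed
  qed
  with that T(1) np show thesis by (auto simp: C_def)
qed

primrec subforms :: "form \<Rightarrow> form set" where
  "subforms (Var i) = {Var i}"
| "subforms Bot = {Bot}"
| "subforms (Conj p q) = insert (Conj p q) (subforms p \<union> subforms q)"
| "subforms (Disj p q) = insert (Disj p q) (subforms p \<union> subforms q)"
| "subforms (Impl p q) = insert (Impl p q) (subforms p \<union> subforms q)"

lemma finite_subforms: "finite (subforms p)"
  by (induction p) auto

lemma subforms_refl: "p \<in> subforms p"
  by (cases p) auto

lemma subforms_closed:
  "Conj p q \<in> subforms r \<Longrightarrow> p \<in> subforms r \<and> q \<in> subforms r"
  "Disj p q \<in> subforms r \<Longrightarrow> p \<in> subforms r \<and> q \<in> subforms r"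
  "Impl p q \<in> subforms r \<Longrightarrow> p \<in> subforms r \<and> q \<in> subforms r"
  by (induction r) (use subforms_refl in auto)

text \<open>The worlds are the subsets of \<open>I\<close>. Those in \<open>N\<close> may force \<^const>\<open>Bot\<close>; the others form a
  simplicial complex.\<close>

primrec force :: "'v set \<Rightarrow> (nat \<Rightarrow> 'v set \<Rightarrow> bool) \<Rightarrow> ('v set \<Rightarrow> bool) \<Rightarrow> form \<Rightarrow> 'v set \<Rightarrow> bool"
where
  "force I V N (Var i) J = V i J"
| "force I V N Bot J = N J"
| "force I V N (Conj p q) J = (force I V N p J \<and> force I V N q J)"
| "force I V N (Disj p q) J = (force I V N p J \<or> force I V N q J)"
| "force I V N (Impl p q) J = (\<forall>K\<subseteq>I. J \<subseteq> K \<longrightarrow> force I V N p K \<longrightarrow> force I V N q K)"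

lemma force_mono:
  assumes "\<And>i J K. V i J \<Longrightarrow> J \<subseteq> K \<Longrightarrow> K \<subseteq> I \<Longrightarrow> V i K"
    and "\<And>J K. N J \<Longrightarrow> J \<subseteq> K \<Longrightarrow> K \<subseteq> I \<Longrightarrow> N K"
  shows "force I V N p J \<Longrightarrow> J \<subseteq> K \<Longrightarrow> K \<subseteq> I \<Longrightarrow> force I V N p K"
  using assms by (induction p) auto

lemma force_exploded:
  assumes "\<And>i J. N J \<Longrightarrow> V i J" and "\<And>J K. N J \<Longrightarrow> J \<subseteq> K \<Longrightarrow> N K"
  shows "N J \<Longrightarrow> force I V N p J"
  using assms by (induction p arbitrary: J) auto

lemma finite_chain_Union:
  assumes "finite C" "C \<noteq> {}" "\<And>a b. a \<in> C \<Longrightarrow> b \<in> C \<Longrightarrow> a \<subseteq> b \<or> b \<subseteq> a"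
  shows "\<Union>C \<in> C"
  using assms
proof (induction rule: finite_ne_induct)
  case (insert x C)
  then have "\<Union>C \<in> C" by blast
  with insert.prems have "x \<subseteq> \<Union>C \<or> \<Union>C \<subseteq> x" by blast
  with \<open>\<Union>C \<in> C\<close> show ?case by (auto simp: Un_absorb1 Un_absorb2)
qed simp

text \<open>A Kripke model is unravelled into the complex of chains of worlds, each chain being mapped to
  its maximum. Three differently coloured copies are taken so that the minimal non-faces
  \<open>e k\<close> separate the vertices.\<close>

theorem IPC_countermodel:
  assumes "\<phi> \<notin> IPC"
  obtains I :: "(form set \<times> nat) set" and e V m where
    "finite I" "\<And>k. e k \<subseteq> I" "\<And>k. k \<ge> m \<Longrightarrow> e k = e m"
    "\<And>u. u \<in> I \<Longrightarrow> \<exists>k::nat. u \<in> e k"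
    "\<And>u v. u \<in> I \<Longrightarrow> v \<in> I \<Longrightarrow> u \<noteq> v \<Longrightarrow> \<exists>k. u \<in> e k \<and> v \<notin> e k"
    "\<And>i J K. V i J \<Longrightarrow> J \<subseteq> K \<Longrightarrow> V i K" "\<And>i k J. e k \<subseteq> J \<Longrightarrow> V i J"
    "\<not> force I V (\<lambda>J. \<exists>k. e k \<subseteq> J) \<phi> {}"
proof -
  let ?\<Sigma> = "subforms \<phi>"
  note \<Sigma> = finite_subforms[of \<phi>] subforms_closed(2)[of _ _ \<phi>]
  obtain T0 where T0: "saturated ?\<Sigma> T0" "\<not> der T0 \<phi>"
    using saturated_extension[OF \<Sigma>, of "{}" \<phi>] assms der_empty by blast
  define W where "W = {T. saturated ?\<Sigma> T \<and> T0 \<subseteq> T}"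
  have finW: "finite W"
    using finite_subforms[of \<phi>] unfolding W_def saturated_def
    by (auto intro: finite_subset[of _ "Pow ?\<Sigma>"])
  define I where "I = W \<times> {0, 1, 2::nat}"
  have finI: "finite I" using finW by (simp add: I_def)
  \<comment> \<open>Faces are to be the sets of pairwise adjacent vertices, that is, the chains of
    worlds in a single colour; \<open>P\<close> then consists of the minimal non-faces.\<close>
  define adj where "adj = (\<lambda>u v :: form set \<times> nat. snd u = snd v \<and> (fst u \<subseteq> fst v \<or> fst v \<subseteq> fst u))"
  define P where "P = {{u, v} |u v. u \<in> I \<and> v \<in> I \<and> \<not> adj u v}"
  have "P \<subseteq> Pow I" by (auto simp: P_def)
  then have "finite P" using finI finite_subset by blast
  then obtain xs where xs: "set xs = P" using finite_list by blast
  have colour: "{(T, c), (T, c')} \<in> P" if "T \<in> W" "c \<noteq> c'" "c \<in> {0,1,2}" "c' \<in> {0,1,2}" for T c c'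
    using that unfolding P_def I_def adj_def by fastforce
  have "T0 \<in> W" using T0 by (simp add: W_def)
  then have "P \<noteq> {}" using colour[of T0 0 1] by auto
  with xs have ne: "xs \<noteq> []" by auto
  \<comment> \<open>The list of non-faces is continued by its last entry, since every column of
    \<open>A\<close> must be assigned one.\<close>
  define e where "e = (\<lambda>k. xs ! min k (length xs - 1))"
  have e_in: "e k \<in> P" for k using ne unfolding e_def xs[symmetric] by (intro nth_mem) (cases xs, auto simp: min_def)
  have e_onto: "\<exists>k. e k = p" if p: "p \<in> P" for p
  proof -
    obtain k where "k < length xs" "p = xs ! k" using p xs by (auto simp: set_conv_nth)
    moreover from this have "min k (length xs - 1) = k" by linarith
    ultimately show ?thesis unfolding e_def by metis
  qed
  define N where "N = (\<lambda>J. \<exists>k. e k \<subseteq> J)"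
  have N_iff: "N J \<longleftrightarrow> (\<exists>u\<in>J. \<exists>v\<in>J. \<not> adj u v)" if "J \<subseteq> I" for J
  proof
    assume "N J"
    then obtain k where "e k \<subseteq> J" by (auto simp: N_def)
    with e_in[of k] show "\<exists>u\<in>J. \<exists>v\<in>J. \<not> adj u v" unfolding P_def by blast
  next
    assume "\<exists>u\<in>J. \<exists>v\<in>J. \<not> adj u v"
    then obtain u v where "u \<in> J" "v \<in> J" "\<not> adj u v" by blast
    moreover from this that have "{u, v} \<in> P" unfolding P_def by blast
    then obtain k where "e k = {u, v}" using e_onto by blast
    ultimately have "e k \<subseteq> J" by simp
    then show "N J" unfolding N_def ..
  qed
  have sep: "\<exists>k. u \<in> e k \<and> v \<notin> e k" if "u \<in> I" "v \<in> I" "u \<noteq> v" for u v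
  proof -
    obtain T c where u: "u = (T, c)" "T \<in> W" "c \<in> {0,1,2}" using \<open>u \<in> I\<close> by (auto simp: I_def)
    \<comment> \<open>This is why there are three colours: a vertex of
      \<open>{(T, c), (T, c')}\<close> other than \<open>u\<close> has colour \<open>c'\<close>,
      which must also differ from the colour of \<open>v\<close>.\<close>
    obtain c' where c': "c' \<in> {0,1,2}" "c' \<noteq> c" "c' \<noteq> snd v"
    proof -
      have "\<exists>c'\<in>{0,1,2::nat}. c' \<noteq> c \<and> c' \<noteq> snd v" using u(3) by auto
      with that show thesis by blast
    qed
    have "{(T, c), (T, c')} \<in> P" using colour u c' by metis
    with e_onto obtain k where "e k = {(T, c), (T, c')}" by metis
    then show ?thesis using u(1) c'(3) \<open>u \<noteq> v\<close> by (intro exI[of _ k]) auto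
  qed
  \<comment> \<open>For a nonempty face this union is the largest world of the chain; the empty face
    is sent to the root \<open>T0\<close>.\<close>
  define th where "th = (\<lambda>J :: (form set \<times> nat) set. T0 \<union> \<Union>(fst ` J))"
  define V where "V = (\<lambda>i J. N J \<or> Var i \<in> th J)"
  have th_mono: "th J \<subseteq> th K" if "J \<subseteq> K" for J K using that by (auto simp: th_def)
  have thW: "th J \<in> W" if "J \<subseteq> I" "\<not> N J" for J
  proof (cases "J = {}")
    case True
    then show ?thesis using \<open>T0 \<in> W\<close> by (simp add: th_def)
  next
    case False
    have "\<Union>(fst ` J) \<in> fst ` J"
    proof (rule finite_chain_Union)
      show "finite (fst ` J)" using that(1) finI finite_subset by blast
      show "fst ` J \<noteq> {}" using False by simp
      fix a b assume "a \<in> fst ` J" "b \<in> fst ` J"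
      then obtain u v where uv: "u \<in> J" "a = fst u" "v \<in> J" "b = fst v" by blast
      with that(2) N_iff[OF that(1)] have "adj u v" by blast
      with uv show "a \<subseteq> b \<or> b \<subseteq> a" unfolding adj_def by blast
    qed
    then have "\<Union>(fst ` J) \<in> W" using that(1) by (auto simp: I_def)
    then show ?thesis by (simp add: th_def W_def Un_absorb1)
  qed
  have der_th: "p \<in> th J" if "J \<subseteq> I" "\<not> N J" "der (th J) p" "p \<in> ?\<Sigma>" for J p
    using thW[OF that(1,2)] that(3,4) by (auto simp: W_def saturated_def)
  have N_up: "N K" if "N J" "J \<subseteq> K" for J K using that by (auto simp: N_def)
  have exploded: "force I V N p J" if "N J" for p J
    using that by (rule force_exploded[where N = N, rotated 2]) (auto simp: V_def intro: N_up)
  have truth: "force I V N p J \<longleftrightarrow> p \<in> th J" if "p \<in> ?\<Sigma>" "J \<subseteq> I" "\<not> N J" for p J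
    using that
  proof (induction p arbitrary: J)
    case (Var i)
    then show ?case by (simp add: V_def)
  next
    case Bot
    have "Bot \<notin> th J" using thW[OF Bot.prems(2,3)] der.hyp by (auto simp: W_def saturated_def)
    with Bot show ?case by simp
  next
    case (Conj p q)
    note sub = subforms_closed(1)[OF Conj.prems(1)]
    have "Conj p q \<in> th J \<longleftrightarrow> p \<in> th J \<and> q \<in> th J"
      using der_th[OF Conj.prems(2,3) der.mp[OF der.mp[OF der.ax[OF IPC.conjI[of p q]]]]]
        der_th[OF Conj.prems(2,3) der.mp[OF der.ax[OF IPC.conjE1[of p q]]]]
        der_th[OF Conj.prems(2,3) der.mp[OF der.ax[OF IPC.conjE2[of p q]]]] sub Conj.prems(1) der.hyp
      by blast
    with Conj sub show ?case by simp
  next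
    case (Disj p q)
    note sub = subforms_closed(2)[OF Disj.prems(1)]
    have "p \<in> th J \<or> q \<in> th J \<Longrightarrow> Disj p q \<in> th J"
      using der_th[OF Disj.prems(2,3) der.mp[OF der.ax[OF IPC.disjI1[of p q]]] Disj.prems(1)]
        der_th[OF Disj.prems(2,3) der.mp[OF der.ax[OF IPC.disjI2[of q p]]] Disj.prems(1)] der.hyp
      by blast
    moreover have "Disj p q \<in> th J \<Longrightarrow> p \<in> th J \<or> q \<in> th J"
      using thW[OF Disj.prems(2,3)] by (auto simp: W_def saturated_def)
    ultimately show ?case using Disj sub by auto
  next
    case (Impl p q)
    note sub = subforms_closed(3)[OF Impl.prems(1)]
    show ?case
    proof
      assume imp: "Impl p q \<in> th J"
      show "force I V N (Impl p q) J"
        unfolding force.simps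
      proof (intro allI impI)
        fix K assume K: "K \<subseteq> I" "J \<subseteq> K" "force I V N p K"
        show "force I V N q K"
        proof (cases "N K")
          case False
          with Impl.IH(1) K sub have "p \<in> th K" by blast
          moreover have "Impl p q \<in> th K" using imp th_mono[OF K(2)] by blast
          ultimately have "q \<in> th K"
            using der_th[OF K(1) False der.mp[OF der.hyp der.hyp]] sub by blast
          with Impl.IH(2) K(1) False sub show ?thesis by blast
        qed (rule exploded)
      qed
    next
      assume f: "force I V N (Impl p q) J"
      show "Impl p q \<in> th J"
      proof (rule ccontr)
        assume "Impl p q \<notin> th J"
        then have "\<not> der (insert p (th J)) q"
          using deduction der_th[OF Impl.prems(2,3)] Impl.prems(1) by blast
        moreover have "insert p (th J) \<subseteq> ?\<Sigma>"
          using thW[OF Impl.prems(2,3)] sub by (auto simp: W_def saturated_def)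
        ultimately obtain T where T: "insert p (th J) \<subseteq> T" "saturated ?\<Sigma> T" "\<not> der T q"
          using saturated_extension[OF \<Sigma>] by blast
        \<comment> \<open>The new world \<open>T\<close> is put on top of the chain
          \<open>J\<close>. To obtain a face again it needs the colour of \<open>J\<close>, and any
          colour if \<open>J\<close> is empty.\<close>
        obtain c where c: "c \<in> {0,1,2}" "\<forall>u\<in>J. snd u = c"
        proof (cases "J = {}")
          case True
          with that[of 0] show thesis by simp
        next
          case False
          then obtain u where u: "u \<in> J" by blast
          then have "\<forall>v\<in>J. snd v = snd u"
            using Impl.prems(3) N_iff[OF Impl.prems(2)] unfolding adj_def by metis
          moreover have "u \<in> W \<times> {0,1,2}" using u Impl.prems(2) unfolding I_def by blast
          then have "snd u \<in> {0,1,2}" by (simp only: mem_Times_iff)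
          ultimately show thesis using that by blast
        qed
        define K where "K = insert (T, c) J"
        have TW: "T \<in> W" using T thW[OF Impl.prems(2,3)] by (auto simp: W_def)
        have KI: "K \<subseteq> I" using TW c(1) Impl.prems(2) by (auto simp: K_def I_def)
        have below: "fst u \<subseteq> T" if "u \<in> J" for u using that T(1) by (auto simp: th_def)
        have "\<not> N K"
        proof
          assume "N K"
          then obtain u v where "u \<in> K" "v \<in> K" "\<not> adj u v" using N_iff[OF KI] by blast
          moreover have "\<not> (u \<in> J \<and> v \<in> J)" using \<open>\<not> adj u v\<close> Impl.prems(3) N_iff[OF Impl.prems(2)] by blast
          ultimately show False using c(2) below unfolding K_def adj_def
            by (metis fst_conv insert_iff order_refl snd_conv)
        qed
        have thK: "th K = T" using T(1) by (auto simp: th_def K_def)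
        have "p \<in> th K" using T(1) thK by blast
        then have "force I V N p K" using Impl.IH(1) sub KI \<open>\<not> N K\<close> by blast
        then have "force I V N q K" using f KI unfolding force.simps K_def by blast
        then have "q \<in> T" using Impl.IH(2) sub KI \<open>\<not> N K\<close> thK by blast
        with T(3) der.hyp show False by blast
      qed
    qed
  qed
  have "\<not> N {}" using N_iff[of "{}"] by simp
  then have "\<not> force I V N \<phi> {}"
    using truth[OF subforms_refl, of "{}"] T0(2) der.hyp by (auto simp: th_def)
  show thesis
  proof (rule that[of I e "length xs - 1" V])
    show "finite I" by (rule finI)
    show "e k \<subseteq> I" for k using e_in[of k] by (auto simp: P_def)
    show "e k = e (length xs - 1)" if "k \<ge> length xs - 1" for k
      using that by (simp add: e_def)
    show "\<exists>k. u \<in> e k" if "u \<in> I" for u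
    proof -
      obtain T c where u: "u = (T, c)" "T \<in> W" "c \<in> {0,1,2}" using \<open>u \<in> I\<close> by (auto simp: I_def)
      then have "(T, if c = 0 then 1 else 0) \<in> I" "(T, if c = 0 then 1 else 0) \<noteq> u" by (auto simp: I_def)
      with sep that show ?thesis by metis
    qed
    show "\<exists>k. u \<in> e k \<and> v \<notin> e k" if "u \<in> I" "v \<in> I" "u \<noteq> v" for u v
      by (rule sep[OF that])
    show "V i K" if "V i J" "J \<subseteq> K" for i J K
      using that N_up th_mono unfolding V_def by blast
    show "V i J" if "e k \<subseteq> J" for i k J
      using that by (auto simp: V_def N_def)
    show "\<not> force I V (\<lambda>J. \<exists>k. e k \<subseteq> J) \<phi> {}"
      using \<open>\<not> force I V N \<phi> {}\<close> unfolding N_def .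
  qed
qed

section \<open>The complex inside the Medvedev lattice\<close>

lemma cf_table:
  assumes "finite S"
  obtains h' :: "nat \<Rightarrow> nat" where "\<And>s. s \<in> S \<Longrightarrow> h' s = h s" "\<And>F. cf F \<Longrightarrow> cf (\<lambda>f x. h' (F f x))"
proof -
  obtain m where m: "\<forall>s\<in>S. s < m" using assms finite_nat_set_iff_bounded by blast
  define h' where "h' = (\<lambda>s. if s < m then h s else 0)"
  have "cf (\<lambda>f x. h' (F f x))" if "cf F" for F
    by (rule cf_eventually_const[OF _ that, of m]) (simp add: h'_def)
  moreover have "h' s = h s" if "s \<in> S" for s using m that by (simp add: h'_def)
  ultimately show thesis using that by blast
qed

lemma column_le: "column A j \<le>\<^sub>T char_fun A"
proof -
  have "cf (\<lambda>f n. f (pr j n))" by (intro cf_intros)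
  from turing_le_cf[OF this, of "char_fun A"] show ?thesis by (simp add: column_def[abs_def])
qed

lemma column_le_Join:
  assumes "j \<in> J" shows "column A j \<le>\<^sub>T Join J (column A)"
proof -
  have "cf (\<lambda>f n. f (pr j n))" by (intro cf_intros)
  from turing_le_cf[OF this, of "Join J (column A)"] assms show ?thesis by (simp add: Join_def)
qed

lemma Join_le:
  assumes K: "cf (\<lambda>f x. of_bool (x \<in> K))" and F: "\<And>j n. j \<notin> K \<Longrightarrow> F (pr j n) = column A j n"
  shows "others A K \<le>\<^sub>T F"
proof -
  have "cp (\<lambda>f x. p1 x \<in> K)" using cp_comp[of "\<lambda>f x. x \<in> K", OF _ cf_p1[OF cf_id]] K by (simp add: cp_def)
  then have "cf (\<lambda>f x. if p1 x \<in> K then 0 else f x)" by (intro cf_intros)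
  from turing_le_cf[OF this, of F]
  have "(\<lambda>x. if p1 x \<in> K then 0 else F x) \<le>\<^sub>T F" .
  moreover have "(\<lambda>x. if p1 x \<in> K then 0 else F x) = others A K"
  proof
    fix x
    show "(if p1 x \<in> K then 0 else F x) = others A K x"
      using F[of "p1 x" "p2 x"] by (simp add: Join_def split: prod.split)
  qed
  ultimately show ?thesis by simp
qed

section \<open>Vertices as functions and worlds as upward closed mass problems\<close>

locale medvedev_model =
  fixes A :: "nat set" and E B D :: "baire set"
    and I :: "'v set" and e :: "nat \<Rightarrow> 'v set" and V :: "nat \<Rightarrow> 'v set \<Rightarrow> bool" and m :: nat
  assumes countable_E: "countable E" and B_E: "\<not> B \<le>\<^sub>M E" and D_def: "D = mp_imp E B"
    and indep: "computably_independent A" and E_A: "\<And>f. f \<in> E \<Longrightarrow> \<not> f \<le>\<^sub>T char_fun A"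
    and finite_I: "finite I" and e_I: "\<And>k. e k \<subseteq> I" and e_const: "\<And>k. k \<ge> m \<Longrightarrow> e k = e m"
    and e_ne: "\<And>k. e k \<noteq> {}" and e_cover: "\<And>u. u \<in> I \<Longrightarrow> \<exists>k. u \<in> e k"
    and e_sep: "\<And>u v. u \<in> I \<Longrightarrow> v \<in> I \<Longrightarrow> u \<noteq> v \<Longrightarrow> \<exists>k. u \<in> e k \<and> v \<notin> e k"
    and V_mono: "\<And>i J K. V i J \<Longrightarrow> J \<subseteq> K \<Longrightarrow> V i K" and V_exploded: "\<And>i k J. e k \<subseteq> J \<Longrightarrow> V i J"
begin

definition keys :: "'v \<Rightarrow> nat set" where "keys u = {k. u \<in> e k}"

lemma cf_keys: "cf (\<lambda>f x. of_bool (x \<in> keys u))"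
proof (rule cf_eventually_const[where m = m and h = "\<lambda>x. of_bool (x \<in> keys u)" and F = "\<lambda>f x. x"])
  show "of_bool (n \<in> keys u) = of_bool (m \<in> keys u)" if "n \<ge> m" for n
    using e_const[OF that] by (simp add: keys_def)
qed (rule cf_id)

lemma ex_point:
  "\<exists>g. (\<forall>t\<in>E \<union> column A ` keys u. \<not> t \<le>\<^sub>T others A (keys u) \<oplus> g)
     \<and> (\<forall>i\<in>keys u. char_fun A \<le>\<^sub>T (others A (keys u) \<oplus> g) \<oplus> column A i)"
proof -
  have "others A (keys u) \<le>\<^sub>T char_fun A"
    by (rule Join_le[OF cf_keys]) (simp add: column_def)
  then have "\<not> t \<le>\<^sub>T others A (keys u)" if "t \<in> E" for t
    using E_A[OF that] turing_le_trans by blast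
  moreover have "\<not> column A i \<le>\<^sub>T others A (keys u)" if i: "i \<in> keys u" for i
  proof -
    have "others A (keys u) \<le>\<^sub>T Join (- {i}) (column A)"
    proof (rule Join_le[OF cf_keys])
      fix j n assume "j \<notin> keys u"
      with i have "j \<noteq> i" by blast
      then show "Join (- {i}) (column A) (pr j n) = column A j n" by (simp add: Join_def)
    qed
    with indep show ?thesis unfolding computably_independent_def using turing_le_trans by blast
  qed
  ultimately have *: "\<not> t \<le>\<^sub>T others A (keys u)" if "t \<in> E \<union> column A ` keys u" for t
    using that by blast
  have "countable (E \<union> column A ` keys u)" using countable_E by simp
  show ?thesis
  proof (rule posner_robinson[OF indep cf_keys \<open>countable _\<close> *])
    fix g assume "\<And>t. t \<in> E \<union> column A ` keys u \<Longrightarrow> \<not> t \<le>\<^sub>T others A (keys u) \<oplus> g"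
      "\<And>i. i \<in> keys u \<Longrightarrow> char_fun A \<le>\<^sub>T (others A (keys u) \<oplus> g) \<oplus> column A i"
    then show ?thesis by (intro exI[of _ g]) simp
  qed
qed

definition point :: "'v \<Rightarrow> nat \<Rightarrow> nat" where
  "point u = others A (keys u) \<oplus>
    (SOME g. (\<forall>t\<in>E \<union> column A ` keys u. \<not> t \<le>\<^sub>T others A (keys u) \<oplus> g)
     \<and> (\<forall>i\<in>keys u. char_fun A \<le>\<^sub>T (others A (keys u) \<oplus> g) \<oplus> column A i))"

lemma point_props:
  "t \<in> E \<Longrightarrow> \<not> t \<le>\<^sub>T point u" "i \<in> keys u \<Longrightarrow> \<not> column A i \<le>\<^sub>T point u"
  "i \<in> keys u \<Longrightarrow> char_fun A \<le>\<^sub>T point u \<oplus> column A i"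
  using someI_ex[OF ex_point[of u], folded point_def] by simp_all

lemma column_le_point: "i \<notin> keys u \<Longrightarrow> column A i \<le>\<^sub>T point u"
  unfolding point_def using turing_le_trans[OF column_le_Join turing_le_fjoin1] by blast

text \<open>Modulo \<open>Q\<close>, the cones above the points are disjoint, and each of them behaves like a single
  degree: its elements compute exactly the columns that the point computes.\<close>

definition Q :: "baire set" where
  "Q = {f. f \<in> upper_cone E \<or> (\<forall>j. column A j \<le>\<^sub>T f)}"

definition X :: "'v \<Rightarrow> baire set" where "X u = {f. point u \<le>\<^sub>T f \<and> f \<notin> Q}"

text \<open>\<open>Q\<close> is kept in every \<open>b J\<close> for the sake of upward closure: an
  oracle above a member of \<open>X u\<close> may leave \<open>X u\<close>, but then it is in
  \<open>Q\<close>.\<close>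

definition b :: "'v set \<Rightarrow> baire set" where
  "b J = ((\<Union>u\<in>I. X u) \<union> Q) - (\<Union>u\<in>J. X u)"

definition a :: "nat \<Rightarrow> baire set" where
  "a i = {f. column A i \<le>\<^sub>T f \<or> f \<in> upper_cone E}"

lemma cone_up: "f \<in> upper_cone E \<Longrightarrow> f \<le>\<^sub>T g \<Longrightarrow> g \<in> upper_cone E"
  unfolding upper_cone_def using turing_le_trans by blast

lemma Q_up: "f \<in> Q \<Longrightarrow> f \<le>\<^sub>T g \<Longrightarrow> g \<in> Q"
  unfolding Q_def using cone_up turing_le_trans by blast

lemma a_up: "f \<in> a i \<Longrightarrow> f \<le>\<^sub>T g \<Longrightarrow> g \<in> a i"
  unfolding a_def using cone_up turing_le_trans by blast

lemma Q_a: "Q \<subseteq> a i"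
  unfolding Q_def a_def by blast

lemma X_up: "f \<in> X u \<Longrightarrow> f \<le>\<^sub>T g \<Longrightarrow> g \<in> X u \<or> g \<in> Q"
  unfolding X_def using turing_le_trans by blast

text \<open>The join property of the points is used here: if \<open>f\<close> also computed column
  \<open>i\<close>, it would compute \<open>A\<close> and hence all columns, so it would be in
  \<open>Q\<close>.\<close>

lemma X_not_a: assumes "f \<in> X u" "u \<in> e i" shows "f \<notin> a i"
proof
  assume "f \<in> a i"
  then have "column A i \<le>\<^sub>T f" using assms(1) by (auto simp: a_def X_def Q_def)
  with assms(1) have "point u \<oplus> column A i \<le>\<^sub>T f" by (simp add: X_def turing_le_fjoin)
  then have "char_fun A \<le>\<^sub>T f" using point_props(3)[of i u] assms(2) turing_le_trans
    by (auto simp: keys_def)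
  then have "f \<in> Q" unfolding Q_def using column_le turing_le_trans by blast
  with assms(1) show False by (simp add: X_def)
qed

lemma X_a: "f \<in> X u \<Longrightarrow> u \<notin> e i \<Longrightarrow> f \<in> a i"
  unfolding X_def a_def using column_le_point[of i u] turing_le_trans by (auto simp: keys_def)

text \<open>A non-face that contains \<open>u\<close> but not \<open>v\<close> provides a column
  computed above \<open>v\<close> and nowhere in \<open>X u\<close>.\<close>

lemma X_disjoint: assumes "u \<in> I" "v \<in> I" "f \<in> X u" "f \<in> X v" shows "u = v"
proof (rule ccontr)
  assume "u \<noteq> v"
  then obtain k where "u \<in> e k" "v \<notin> e k" using e_sep assms(1,2) by blast
  with X_not_a[OF assms(3)] X_a[OF assms(4)] show False by blast
qed

text \<open>Some non-face contains \<open>u\<close>, so \<open>point u\<close> misses a column and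
  stays outside \<open>Q\<close>.\<close>

lemma point_X: assumes "u \<in> I" shows "point u \<in> X u"
proof -
  obtain k where "k \<in> keys u" using e_cover[OF assms] by (auto simp: keys_def)
  then have "point u \<notin> Q" using point_props[where u = u] by (auto simp: Q_def upper_cone_def)
  then show ?thesis by (simp add: X_def turing_le_refl)
qed

lemma Q_b: "J \<subseteq> I \<Longrightarrow> Q \<subseteq> b J"
  by (auto simp: b_def X_def)

lemma E_b: "J \<subseteq> I \<Longrightarrow> E \<subseteq> b J"
proof
  fix f assume "J \<subseteq> I" "f \<in> E"
  moreover from this have "f \<in> upper_cone E" unfolding upper_cone_def using turing_le_refl by blast
  ultimately show "f \<in> b J" using Q_b unfolding Q_def by blast
qed

lemma b_ne: "J \<subseteq> I \<Longrightarrow> b J \<noteq> {}"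
  using Q_b column_le unfolding Q_def by blast

lemma X_b: assumes "u \<in> I" "f \<in> X u" "J \<subseteq> I" "u \<notin> J" shows "f \<in> b J"
  using assms X_disjoint by (auto simp: b_def)

lemma b_cases: assumes "f \<in> b J" obtains "f \<in> Q" | v where "v \<in> I" "v \<notin> J" "f \<in> X v"
  using assms by (auto simp: b_def)

lemma b_up: assumes "f \<in> b J" "J \<subseteq> I" "f \<le>\<^sub>T g" shows "g \<in> b J"
  using assms(1)
proof (cases rule: b_cases)
  case 1
  then show ?thesis using Q_up assms(2,3) Q_b by blast
next
  case (2 v)
  then show ?thesis using X_up assms(2,3) X_b Q_b by blast
qed

lemma b_antimono: "J \<subseteq> K \<Longrightarrow> b K \<subseteq> b J"
  by (auto simp: b_def)

text \<open>Outside \<open>Q\<close>, a member lies above a vertex not in \<open>J\<close>, hence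
  not in \<open>e k\<close>, and such a vertex computes column \<open>k\<close>. This makes
  non-faces force falsum.\<close>

lemma b_e: assumes "e k \<subseteq> J" "J \<subseteq> I" shows "b J \<subseteq> a k"
proof
  fix f assume "f \<in> b J"
  then show "f \<in> a k"
    by (cases rule: b_cases) (use Q_a X_a assms(1) in blast)+
qed

lemma fjoin_absorb: "f \<oplus> (f \<oplus> h) \<le>\<^sub>T f \<oplus> h"
  by (simp add: turing_le_fjoin turing_le_fjoin1 turing_le_refl)

text \<open>If \<open>f \<oplus> h\<close> were in \<open>X u\<close> with \<open>u\<close> in
  \<open>J\<close> but not in \<open>K\<close>, it would be in \<open>b K\<close> and could replace
  \<open>g\<close>: then \<open>f \<oplus> (f \<oplus> h)\<close> is in \<open>Z\<close>, and so is
  \<open>f \<oplus> h\<close>, which computes it. But \<open>Z\<close> misses \<open>X u\<close>.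
  The lemma is applied to \<open>b J\<close> and to \<open>a i\<close> as \<open>Z\<close>.\<close>

lemma b_difference:
  assumes "K \<subseteq> I" "J \<subseteq> I" "h \<in> b {}"
    and Z: "\<And>g g'. g \<in> Z \<Longrightarrow> g \<le>\<^sub>T g' \<Longrightarrow> g' \<in> Z" "\<And>u. u \<in> J \<Longrightarrow> X u \<inter> Z = {}"
    and f: "\<forall>g\<in>b K. f \<oplus> g \<in> Z"
  shows "f \<oplus> h \<in> b (J - K)"
proof -
  have "f \<oplus> h \<in> b {}" using b_up[OF assms(3) _ turing_le_fjoin2] by blast
  moreover have False if "u \<in> J" "u \<notin> K" "f \<oplus> h \<in> X u" for u
  proof -
    have "f \<oplus> h \<in> b K" using X_b that assms(1,2) by blast
    then have "f \<oplus> h \<in> Z" using f Z(1) fjoin_absorb by blast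
    with Z(2) that show False by blast
  qed
  ultimately show ?thesis by (auto simp: b_def)
qed

end

section \<open>Finite strings that decide the component of an output\<close>

lemma prepend_code:
  "\<exists>d. \<forall>f w. (\<forall>x. eval c f x = Some w) \<longrightarrow> eval d f = Some \<circ> (w \<^bold>\<frown> f)"
proof -
  have "cf (\<lambda>f x. if p1 x = 0 then p2 x else f (p1 x - 1))" by (intro cf_intros)
  then obtain e where e: "\<forall>f x. eval e f x = Some (if p1 x = 0 then p2 x else f (p1 x - 1))"
    unfolding cf_def ..
  have "eval (Comp e (Tuple (Tuple Fst Snd) c)) f = Some \<circ> (w \<^bold>\<frown> f)" if "\<forall>x. eval c f x = Some w" for f w
  proof
    show "eval (Comp e (Tuple (Tuple Fst Snd) c)) f x = (Some \<circ> (w \<^bold>\<frown> f)) x" for x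
      using that by (cases x) (simp_all add: e)
  qed
  then show ?thesis by blast
qed

text \<open>A packet \<open>w \<^bold>\<frown> n \<^bold>\<frown> f\<close> consists of the functional \<open>g \<mapsto> Phi n (f \<oplus> g)\<close> and a string,
  coded by \<open>w\<close>, that determines its first three values; \<open>extend\<close> appends \<open>g\<close> to the string.\<close>

definition settled :: "baire \<Rightarrow> nat \<Rightarrow> nat \<Rightarrow> nat option" where
  "settled q w x = bPhi (ftail q \<oplus> entry (p1 w)) (p2 w) (q 0) x"

definition value3 :: "baire \<Rightarrow> nat \<Rightarrow> nat" where
  "value3 p x = enc_opt (settled (ftail p) (p 0) x) - 1"

definition extend :: "baire \<Rightarrow> baire \<Rightarrow> nat \<Rightarrow> nat" where
  "extend p g k = (if k < p2 (p 0) then entry (p1 (p 0)) k else g (k - p2 (p 0)))"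

lemma cf_settled:
  assumes "cf W" "cf X" shows "cf (\<lambda>f x. enc_opt (settled f (W f x) (X f x)))"
proof -
  have h: "cf (\<lambda>f z. p2 z div 2)" by (intro cf_intros) simp
  have "cf (\<lambda>f z. if even (p2 z) then f (Suc (p2 z div 2)) else entry (p1 (W f (p1 z))) (p2 z div 2))"
    by (intro cf_intros h cf_comp[OF assms(1)])
  then have "cf (\<lambda>f z. (ftail f \<oplus> entry (p1 (W f (p1 z)))) (p2 z))"
    unfolding fjoin_def ftail_def .
  from cf_bPhi[where D = "\<lambda>f x. ftail f \<oplus> entry (p1 (W f x))", OF this cf_p2[OF assms(1)]
      cf_oracle[OF cf_const[of 0]] assms(2)]
  show ?thesis unfolding settled_def .
qed

lemma cf_value3: "cf value3"
proof -
  have "cf (\<lambda>p x. enc_opt (settled (ftail p) (p 0) x))"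
    using cf_param[where D = "\<lambda>f x. ftail f" and E = "\<lambda>f x. pr (f 0) x"
      and H = "\<lambda>f z. enc_opt (settled f (p1 z) (p2 z))"]
    by (simp add: cf_settled cf_intros cf_comp[OF cff_ftail[OF cff_id]])
  then show ?thesis unfolding value3_def[abs_def] by (intro cf_intros)
qed

lemma cff_value3: "cf D \<Longrightarrow> cf (\<lambda>f x. value3 (D f) k)"
  by (rule cff_value[OF cf_subst[OF cf_value3]])

lemma cff_extend: "cf D \<Longrightarrow> cf D' \<Longrightarrow> cf (\<lambda>f. extend (D f) (D' f))"
proof -
  assume D: "cf D" "cf D'"
  have w: "cf (\<lambda>f x. D f 0)" by (rule cff_value[OF D(1)])
  have "cf (\<lambda>f k. if k < p2 (D f 0) then entry (p1 (D f 0)) k else D' f (k - p2 (D f 0)))"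
    by (intro cf_intros w cf_comp[OF D(2)])
  then show ?thesis by (simp add: extend_def[abs_def])
qed

lemma extend_le: "extend p g \<le>\<^sub>T g"
proof -
  have "cf (\<lambda>g k. if k < p2 (p 0) then entry (p1 (p 0)) k else g (k - p2 (p 0)))" by (intro cf_intros)
  from turing_le_cf[OF this, of g] show ?thesis by (simp add: extend_def[abs_def])
qed

lemma le_extend: "g \<le>\<^sub>T extend p g"
proof -
  have "cf (\<lambda>f k. f (k + p2 (p 0)))" by (intro cf_intros)
  from turing_le_cf[OF this, of "extend p g"] show ?thesis by (simp add: extend_def)
qed

lemma settled_extend:
  assumes "settled q w x = Some y" shows "Phi (q 0) (ftail q \<oplus> extend (w \<^bold>\<frown> q) g) x = Some y"
proof -
  have "bPhi (ftail q \<oplus> entry (p1 w)) (p2 w) (q 0) x = bPhi (ftail q \<oplus> extend (w \<^bold>\<frown> q) g) (p2 w) (q 0) x"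
    by (rule bPhi_fjoin_cong) (simp add: extend_def)
  with assms show ?thesis by (intro bPhi_sound[of _ "p2 w"]) (simp add: settled_def)
qed

lemma ex_settled:
  assumes "Phi (q 0) (ftail q \<oplus> g) = Some \<circ> o'"
  shows "\<exists>w. \<forall>x<3. settled q w x \<noteq> None"
proof -
  have "\<exists>s. bPhi (ftail q \<oplus> g) s (q 0) x \<noteq> None" for x
    using bPhi_complete[of "q 0" "ftail q \<oplus> g" x "o' x"] assms by auto
  then obtain s where s: "\<forall>x<3. bPhi (ftail q \<oplus> g) s (q 0) x \<noteq> None"
    using common_bound[of 3 "\<lambda>x s. bPhi (ftail q \<oplus> g) s (q 0) x \<noteq> None"] bPhi_mono by blast
  have "bPhi (ftail q \<oplus> entry (lcode (map g [0..<s]))) s (q 0) x = bPhi (ftail q \<oplus> g) s (q 0) x" for x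
    by (rule bPhi_fjoin_cong) simp
  with s show ?thesis by (intro exI[of _ "pr (lcode (map g [0..<s])) s"]) (simp add: settled_def)
qed

text \<open>A deciding string is known to exist only; by searching for one the packet is obtained
  uniformly from the functional.\<close>

lemma packet_code:
  "\<exists>d. \<forall>q. (\<exists>w. \<forall>x<3. settled q w x \<noteq> None) \<longrightarrow>
     (\<exists>w. (\<forall>x<3. settled q w x \<noteq> None) \<and> eval d q = Some \<circ> (w \<^bold>\<frown> q))"
proof -
  have "cp (\<lambda>f z. \<forall>x<3. enc_opt (settled f (p2 z) x) \<noteq> 0)"
    by (intro cp_ball cf_settled cf_intros)
  from search_code[where P = "\<lambda>f z w. \<forall>x<3. enc_opt (settled f w x) \<noteq> 0", OF this] obtain c where c:
    "\<And>f x. eval c f x = (if \<exists>w. \<forall>x<3. enc_opt (settled f w x) \<noteq> 0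
       then Some (LEAST w. \<forall>x<3. enc_opt (settled f w x) \<noteq> 0) else None)" by blast
  obtain d where d: "\<forall>f w. (\<forall>x. eval c f x = Some w) \<longrightarrow> eval d f = Some \<circ> (w \<^bold>\<frown> f)"
    using prepend_code ..
  have "\<exists>w. (\<forall>x<3. settled q w x \<noteq> None) \<and> eval d q = Some \<circ> (w \<^bold>\<frown> q)"
    if ex: "\<exists>w. \<forall>x<3. settled q w x \<noteq> None" for q
  proof -
    define w where "w = (LEAST w. \<forall>x<3. settled q w x \<noteq> None)"
    have "\<forall>x<3. settled q w x \<noteq> None" unfolding w_def using ex by (rule LeastI_ex)
    moreover have "eval c q x = Some w" for x using ex by (simp add: c w_def)
    ultimately show ?thesis using d by blast
  qed
  then show ?thesis by blast
qed

context medvedev_model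
begin

section \<open>Mass problems for sets of worlds\<close>

definition P :: "baire set" where
  "P = {i \<^bold>\<frown> g |i g. column A i \<le>\<^sub>T g \<or> g \<in> upper_cone E}"

definition PD :: "baire set" where "PD = mp_meet P D"

definition enc :: "'v set \<Rightarrow> nat" where "enc = to_nat_on (Pow I)"
definition dec :: "nat \<Rightarrow> 'v set" where "dec = from_nat_into (Pow I)"

lemma dec_enc: "J \<subseteq> I \<Longrightarrow> dec (enc J) = J"
  unfolding dec_def enc_def using finite_I by (simp add: countable_finite)

text \<open>A finite meet of problems \<open>b J\<close>, tagged by codes so that a program sees
  from one value which \<open>b J\<close> it was given.\<close>

definition Bs :: "'v set set \<Rightarrow> baire set" where
  "Bs \<X> = {enc J \<^bold>\<frown> f |J f. J \<in> \<X> \<and> J \<subseteq> I \<and> f \<in> b J}"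

text \<open>The meet with \<open>PD\<close> moves the problem into the interval below
  \<open>PD\<close>, which represents the factor.\<close>

definition M :: "'v set set \<Rightarrow> baire set" where "M \<X> = mp_meet (Bs \<X>) PD"

lemma M_PD: "M \<X> \<le>\<^sub>M PD"
  unfolding M_def by (rule mp_meet_lb2)

lemma M_mono: "\<X> \<subseteq> \<Y> \<Longrightarrow> M \<Y> \<le>\<^sub>M M \<X>"
  by (rule medvedev_le_subset) (auto simp: M_def mp_meet_def Bs_def)

lemma M_b: "K \<in> \<X> \<Longrightarrow> K \<subseteq> I \<Longrightarrow> M \<X> \<le>\<^sub>M b K"
  by (rule medvedev_le_cf[of "\<lambda>f. 0 \<^bold>\<frown> enc K \<^bold>\<frown> f"])
    (auto intro!: cff cf_const simp: M_def mp_meet_def Bs_def)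

lemma table:
  fixes h :: "'v set \<Rightarrow> nat"
  obtains t where "\<And>J. J \<subseteq> I \<Longrightarrow> t (enc J) = h J" "\<And>F. cf F \<Longrightarrow> cf (\<lambda>f x. t (F f x))"
proof -
  have "finite (enc ` Pow I)" using finite_I by simp
  from cf_table[OF this, of "\<lambda>s. h (dec s)"] obtain t where
    "\<And>s. s \<in> enc ` Pow I \<Longrightarrow> t s = h (dec s)" "\<And>F. cf F \<Longrightarrow> cf (\<lambda>f x. t (F f x))" by metis
  then show thesis by (intro that[of t]) (simp_all add: dec_enc)
qed

lemma table2:
  fixes h :: "'v set \<Rightarrow> 'v set \<Rightarrow> nat"
  obtains t where "\<And>J K. J \<subseteq> I \<Longrightarrow> K \<subseteq> I \<Longrightarrow> t (pr (enc J) (enc K)) = h J K"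
    "\<And>F. cf F \<Longrightarrow> cf (\<lambda>f x. t (F f x))"
proof -
  have "finite ((\<lambda>(J, K). pr (enc J) (enc K)) ` (Pow I \<times> Pow I))" using finite_I by simp
  from cf_table[OF this, of "\<lambda>s. h (dec (p1 s)) (dec (p2 s))"] obtain t where
    t: "\<And>s. s \<in> (\<lambda>(J, K). pr (enc J) (enc K)) ` (Pow I \<times> Pow I) \<Longrightarrow> t s = h (dec (p1 s)) (dec (p2 s))"
    "\<And>F. cf F \<Longrightarrow> cf (\<lambda>f x. t (F f x))" by metis
  have "t (pr (enc J) (enc K)) = h J K" if "J \<subseteq> I" "K \<subseteq> I" for J K
    using t(1)[of "pr (enc J) (enc K)"] that by (force simp: dec_enc)
  with t(2) that show thesis by blast
qed

lemma M_Un: "mp_meet (M \<X>) (M \<Y>) \<le>\<^sub>M M (\<X> \<union> \<Y>)"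
proof -
  obtain t where t: "\<And>J. J \<subseteq> I \<Longrightarrow> t (enc J) = (if J \<in> \<X> then 0 else 1::nat)"
    "\<And>F. cf F \<Longrightarrow> cf (\<lambda>f x. t (F f x))" using table[of "\<lambda>J. if J \<in> \<X> then 0 else 1"] by blast
  have "mp_meet (M \<X>) (M \<Y>) \<le>\<^sub>M Bs (\<X> \<union> \<Y>)"
  proof (rule medvedev_le_cf[of "\<lambda>f. t (f 0) \<^bold>\<frown> 0 \<^bold>\<frown> f"])
    show "cf (\<lambda>f. t (f 0) \<^bold>\<frown> 0 \<^bold>\<frown> f)"
      by (intro cff_prepend t(2) cf_oracle cf_const cf_id)
    show "t (f 0) \<^bold>\<frown> 0 \<^bold>\<frown> f \<in> mp_meet (M \<X>) (M \<Y>)" if f: "f \<in> Bs (\<X> \<union> \<Y>)" for f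
    proof -
      obtain J g where J: "f = enc J \<^bold>\<frown> g" "J \<in> \<X> \<union> \<Y>" "J \<subseteq> I" "g \<in> b J"
        using f unfolding Bs_def by blast
      then have "J \<in> \<X> \<Longrightarrow> f \<in> Bs \<X>" "J \<in> \<Y> \<Longrightarrow> f \<in> Bs \<Y>" unfolding Bs_def by blast+
      with J show ?thesis by (auto simp: t(1) mp_meet_def M_def)
    qed
  qed
  then show ?thesis unfolding M_def[of "\<X> \<union> \<Y>"]
    by (intro mp_meet_greatest) (meson M_PD medvedev_le_trans mp_meet_lb1)+
qed

text \<open>The join of members of \<open>b J\<close> and \<open>b K\<close> is in both problems by
  upward closure, hence in \<open>b (J \<union> K)\<close>; and \<open>J \<union> K\<close> is in
  both families since these are closed upwards. An input that comes from \<open>PD\<close> is passed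
  on unchanged.\<close>

lemma M_Int:
  assumes "\<And>J K. J \<in> \<X> \<Longrightarrow> J \<subseteq> K \<Longrightarrow> K \<subseteq> I \<Longrightarrow> K \<in> \<X>" "\<And>J K. J \<in> \<Y> \<Longrightarrow> J \<subseteq> K \<Longrightarrow> K \<subseteq> I \<Longrightarrow> K \<in> \<Y>"
  shows "M (\<X> \<inter> \<Y>) \<le>\<^sub>M mp_join (M \<X>) (M \<Y>)"
proof -
  obtain t where t: "\<And>J K. J \<subseteq> I \<Longrightarrow> K \<subseteq> I \<Longrightarrow> t (pr (enc J) (enc K)) = enc (J \<union> K)"
    "\<And>F. cf F \<Longrightarrow> cf (\<lambda>f x. t (F f x))" using table2[of "\<lambda>J K. enc (J \<union> K)"] by blast
  let ?F = "\<lambda>f. if fleft f 0 \<noteq> 0 then fleft f else if fright f 0 \<noteq> 0 then fright f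
    else 0 \<^bold>\<frown> t (pr (fleft f 1) (fright f 1)) \<^bold>\<frown> (ftail (ftail (fleft f)) \<oplus> ftail (ftail (fright f)))"
  note l = cff_fleft[OF cff_id] and r = cff_fright[OF cff_id]
  have v: "cf (\<lambda>f x. fleft f k)" "cf (\<lambda>f x. fright f k)" for k
    by (rule cff_value[OF l] cff_value[OF r])+
  have "cf ?F"
    by (rule cff_if[OF cp_not[OF cp_eq[OF v(1) cf_const]] l] cff_if[OF cp_not[OF cp_eq[OF v(2) cf_const]] r]
      cff_prepend cf_const t(2) cf_pair v cff_fjoin cff_ftail l r)+
  then show ?thesis
  proof (rule medvedev_le_cf)
    fix x assume "x \<in> mp_join (M \<X>) (M \<Y>)"
    then obtain f g where fg: "f \<in> M \<X>" "g \<in> M \<Y>" "x = f \<oplus> g" unfolding mp_join_def by blast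
    show "?F x \<in> M (\<X> \<inter> \<Y>)"
    proof (cases "f 0 \<noteq> 0 \<or> g 0 \<noteq> 0")
      case True
      moreover have "h \<in> M (\<X> \<inter> \<Y>)" if "h \<in> M \<Z>" "h 0 \<noteq> 0" for h \<Z>
        using that by (auto simp: M_def mp_meet_def)
      ultimately show ?thesis using fg by auto
    next
      case False
      then obtain J f' K g' where J: "f = 0 \<^bold>\<frown> enc J \<^bold>\<frown> f'" "J \<in> \<X>" "J \<subseteq> I" "f' \<in> b J"
        and K: "g = 0 \<^bold>\<frown> enc K \<^bold>\<frown> g'" "K \<in> \<Y>" "K \<subseteq> I" "g' \<in> b K"
        using fg(1,2) by (auto simp: M_def mp_meet_def Bs_def)
      have "f' \<oplus> g' \<in> b J" "f' \<oplus> g' \<in> b K"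
        using b_up[OF J(4,3) turing_le_fjoin1] b_up[OF K(4,3) turing_le_fjoin2] .
      then have "f' \<oplus> g' \<in> b (J \<union> K)" by (auto simp: b_def)
      moreover have sub: "J \<union> K \<subseteq> I" using J(3) K(3) by blast
      moreover have "J \<union> K \<in> \<X> \<inter> \<Y>"
        using assms(1)[OF J(2) Un_upper1 sub] assms(2)[OF K(2) Un_upper2 sub] by blast
      ultimately have "enc (J \<union> K) \<^bold>\<frown> (f' \<oplus> g') \<in> Bs (\<X> \<inter> \<Y>)"
        unfolding Bs_def by blast
      moreover have "?F x = 0 \<^bold>\<frown> enc (J \<union> K) \<^bold>\<frown> (f' \<oplus> g')"
        using J(1,3) K(1,3) fg(3) t(1) by simp
      ultimately show ?thesis unfolding M_def mp_meet_def by auto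
    qed
  qed
qed

lemma PD_exploded: "PD \<le>\<^sub>M Bs {J. \<exists>k. e k \<subseteq> J}"
proof -
  obtain t where t: "\<And>J. J \<subseteq> I \<Longrightarrow> t (enc J) = (SOME k. e k \<subseteq> J)"
    "\<And>F. cf F \<Longrightarrow> cf (\<lambda>f x. t (F f x))" using table[of "\<lambda>J. SOME k. e k \<subseteq> J"] by blast
  have "P \<le>\<^sub>M Bs {J. \<exists>k. e k \<subseteq> J}"
  proof (rule medvedev_le_cf[of "\<lambda>f. t (f 0) \<^bold>\<frown> ftail f"])
    show "cf (\<lambda>f. t (f 0) \<^bold>\<frown> ftail f)"
      by (intro cff_prepend cff_ftail t(2) cf_oracle cf_const cf_id)
    fix f assume "f \<in> Bs {J. \<exists>k. e k \<subseteq> J}"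
    then obtain J g where J: "f = enc J \<^bold>\<frown> g" "\<exists>k. e k \<subseteq> J" "J \<subseteq> I" "g \<in> b J" unfolding Bs_def by blast
    have "e (t (enc J)) \<subseteq> J" using J(2) unfolding t(1)[OF J(3)] by (rule someI_ex)
    then have "g \<in> a (t (enc J))" using b_e J(3,4) by blast
    then have "t (enc J) \<^bold>\<frown> g \<in> P" unfolding P_def a_def by blast
    then show "t (f 0) \<^bold>\<frown> ftail f \<in> P" using J(1) by simp
  qed
  then show ?thesis unfolding PD_def using mp_meet_lb1 medvedev_le_trans by blast
qed

end

lemma prepend_inject: "i \<^bold>\<frown> f = j \<^bold>\<frown> g \<Longrightarrow> i = j \<and> f = g"
  by (metis fparts_simps(3) old.nat.simps(4))

context medvedev_model
begin

text \<open>Two values identify the component and the code of a face; a third one is needed for the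
  index of a column. Hence the three values fixed by a packet.\<close>

lemma M_cases:
  assumes "o' \<in> M \<X>"
  obtains (face) J f where "J \<in> \<X>" "J \<subseteq> I" "f \<in> b J" "o' = 0 \<^bold>\<frown> enc J \<^bold>\<frown> f"
    | (column) i f where "f \<in> a i" "o' = 1 \<^bold>\<frown> 0 \<^bold>\<frown> i \<^bold>\<frown> f"
    | (imp) d where "d \<in> D" "o' = 1 \<^bold>\<frown> 1 \<^bold>\<frown> d"
  using assms unfolding M_def mp_meet_def Bs_def PD_def P_def a_def by blast

text \<open>In the following, \<open>p = w \<^bold>\<frown> n \<^bold>\<frown> f\<close> is a packet and \<open>g \<mapsto> Phi n (f \<oplus> g)\<close> reduces
  \<open>M \<X>\<close> to \<open>b K\<close>. As \<open>b K\<close> is closed upwards, the string coded by \<open>w\<close> decides for all of \<open>b K\<close>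
  simultaneously to which component of \<open>M \<X>\<close> the result belongs.\<close>

definition packet :: "'v set \<Rightarrow> 'v set set \<Rightarrow> baire \<Rightarrow> bool" where
  "packet K \<X> p \<longleftrightarrow> (\<forall>x<3. settled (ftail p) (p 0) x \<noteq> None)
     \<and> (\<forall>g\<in>b K. \<exists>o'\<in>M \<X>. Phi (p 1) (ftail (ftail p) \<oplus> g) = Some \<circ> o')"

lemma packet_run:
  assumes p: "packet K \<X> p" and K: "K \<subseteq> I" and g: "g \<in> b K"
  obtains o' where "o' \<in> M \<X>" "Phi (p 1) (ftail (ftail p) \<oplus> extend p g) = Some \<circ> o'"
    "o' \<le>\<^sub>T ftail (ftail p) \<oplus> g" "\<And>x. x < 3 \<Longrightarrow> o' x = value3 p x"
proof -
  have "extend p g \<in> b K" using b_up[OF g K le_extend] .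
  with p obtain o' where o': "o' \<in> M \<X>" "Phi (p 1) (ftail (ftail p) \<oplus> extend p g) = Some \<circ> o'"
    unfolding packet_def by blast
  have pp: "p 0 \<^bold>\<frown> ftail p = p" "ftail p 0 = p 1"
    by (auto simp: ftail_def fun_eq_iff split: nat.split)
  have "o' x = value3 p x" if x: "x < 3" for x
  proof -
    obtain y where y: "settled (ftail p) (p 0) x = Some y" using p x unfolding packet_def by blast
    from settled_extend[OF this, of g] o'(2) have "o' x = y" by (simp add: pp)
    with y show ?thesis by (simp add: value3_def)
  qed
  moreover have "extend p g \<le>\<^sub>T ftail (ftail p) \<oplus> g"
    using extend_le turing_le_fjoin2 turing_le_trans by blast
  then have "o' \<le>\<^sub>T ftail (ftail p) \<oplus> g"
    using o'(2) turing_le_def turing_le_trans turing_le_fjoin turing_le_fjoin1 by blast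
  ultimately show thesis using that o' by blast
qed

lemma prepend_shift: "(i \<^bold>\<frown> f) 0 = i" "(i \<^bold>\<frown> f) 1 = f 0" "(i \<^bold>\<frown> f) 2 = f 1"
  by (simp_all add: numeral_2_eq_2)

lemma packet_face:
  assumes p: "packet K \<X> p" and K: "K \<subseteq> I" and v: "value3 p 0 = 0"
  obtains J where "J \<in> \<X>" "J \<subseteq> I" "value3 p 1 = enc J" "\<forall>g\<in>b K. ftail (ftail p) \<oplus> g \<in> b J"
proof -
  have *: "\<exists>J\<in>\<X>. J \<subseteq> I \<and> value3 p 1 = enc J \<and> ftail (ftail p) \<oplus> g \<in> b J" if g: "g \<in> b K" for g
  proof -
    obtain o' where o': "o' \<in> M \<X>" "o' \<le>\<^sub>T ftail (ftail p) \<oplus> g" "\<And>x. x < 3 \<Longrightarrow> o' x = value3 p x"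
      using packet_run[OF p K g] by blast
    have "o' 0 = 0" "o' 1 = value3 p 1" using o'(3)[of 0] o'(3)[of 1] v by simp_all
    from o'(1) show ?thesis
    proof (cases rule: M_cases)
      case (face J f)
      have "f \<le>\<^sub>T ftail (ftail p) \<oplus> g"
        using o'(2) face(4) turing_le_prepend turing_le_trans by metis
      then show ?thesis using face b_up \<open>o' 1 = value3 p 1\<close> by (auto simp: prepend_shift)
    qed (use \<open>o' 0 = 0\<close> in simp_all)
  qed
  obtain g where "g \<in> b K" using b_ne[OF K] by blast
  from *[OF this] obtain J where J: "J \<in> \<X>" "J \<subseteq> I" "value3 p 1 = enc J" by blast
  have "ftail (ftail p) \<oplus> g \<in> b J" if "g \<in> b K" for g
    using *[OF that] J(2,3) dec_enc by metis
  with that J show thesis by blast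
qed

lemma packet_column:
  assumes p: "packet K \<X> p" and K: "K \<subseteq> I" and v: "value3 p 0 \<noteq> 0" "value3 p 1 = 0"
  shows "\<forall>g\<in>b K. ftail (ftail p) \<oplus> g \<in> a (value3 p 2)"
proof
  fix g assume g: "g \<in> b K"
  obtain o' where o': "o' \<in> M \<X>" "o' \<le>\<^sub>T ftail (ftail p) \<oplus> g" "\<And>x. x < 3 \<Longrightarrow> o' x = value3 p x"
    using packet_run[OF p K g] by blast
  have v': "o' 0 \<noteq> 0" "o' 1 = 0" "o' 2 = value3 p 2" using o'(3)[of 0] o'(3)[of 1] o'(3)[of 2] v by simp_all
  from o'(1) show "ftail (ftail p) \<oplus> g \<in> a (value3 p 2)"
  proof (cases rule: M_cases)
    case (column i f)
    have "f \<le>\<^sub>T ftail (ftail p) \<oplus> g"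
      using o'(2) column(2) turing_le_prepend turing_le_trans by metis
    moreover have "i = value3 p 2" using v'(3) column(2) by (simp add: prepend_shift numeral_2_eq_2)
    ultimately show ?thesis using column(1) a_up by blast
  qed (use v' in \<open>simp_all add: prepend_shift\<close>)
qed

text \<open>A proof of \<open>E \<rightarrow> (E \<rightarrow> B) = E \<rightarrow> B\<close> on
  packets: each \<open>g\<close> in \<open>E\<close> is in \<open>b K\<close>, the packet run on
  \<open>g\<close> yields an element of \<open>D\<close>, and this is applied to the same
  \<open>g\<close> again. The index \<open>n\<close> is the same for all packets.\<close>

lemma packet_imp:
  obtains n where "\<And>K \<X> p. \<lbrakk>packet K \<X> p; K \<subseteq> I; value3 p 0 \<noteq> 0; value3 p 1 \<noteq> 0\<rbrakk>
    \<Longrightarrow> n \<^bold>\<frown> p \<in> D"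
proof -
  let ?p = "\<lambda>f. fleft f" and ?g = "\<lambda>f. fright f"
  have l: "cf (\<lambda>f. fleft f)" and r: "cf (\<lambda>f. fright f)" by (rule cff_fleft[OF cff_id] cff_fright[OF cff_id])+
  have "cf (\<lambda>f. ftail (ftail (fleft f)) \<oplus> extend (fleft f) (fright f))"
    by (intro cff_fjoin cff_ftail cff_extend l r)
  from phi_code[OF this cff_value[OF l, of 1]] obtain c where
    c: "\<forall>f. eval c f = Phi (fleft f 1) (ftail (ftail (fleft f)) \<oplus> extend (fleft f) (fright f))" ..
  obtain d where d: "\<forall>f g. eval c f = Some \<circ> g \<longrightarrow> eval d f = Some \<circ> (g \<oplus> f)" using join_code ..
  \<comment> \<open>The left half is now an output in the component \<open>D\<close>: two tags, then
    an index at position 2, then its oracle. The argument \<open>g\<close> comes from the saved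
    input on the right.\<close>
  have "cf (\<lambda>f. ftail (ftail (ftail (fleft f))) \<oplus> fright (fright f))"
    by (intro cff_fjoin cff_ftail cff_fright l r)
  from phi_code[OF this cff_value[OF l, of 2]] obtain c' where
    c': "\<forall>f. eval c' f = Phi (fleft f 2) (ftail (ftail (ftail (fleft f))) \<oplus> fright (fright f))" ..
  obtain n where n: "\<forall>f. Phi n f = eval (subst_oracle c' d) f" using index_code ..
  have "n \<^bold>\<frown> p \<in> D" if p: "packet K \<X> p" "K \<subseteq> I" "value3 p 0 \<noteq> 0" "value3 p 1 \<noteq> 0" for K \<X> p
  proof -
    have "\<exists>h\<in>B. Phi n (p \<oplus> g) = Some \<circ> h" if g: "g \<in> E" for g
    proof -
      have "g \<in> b K" using E_b p(2) g by blast
      then obtain o' where o': "o' \<in> M \<X>" "Phi (p 1) (ftail (ftail p) \<oplus> extend p g) = Some \<circ> o'"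
        "\<And>x. x < 3 \<Longrightarrow> o' x = value3 p x"
        using packet_run[OF p(1,2)] by blast
      have v: "o' 0 \<noteq> 0" "o' 1 \<noteq> 0" using o'(3)[of 0] o'(3)[of 1] p(3,4) by simp_all
      from o'(1) obtain d' where d': "d' \<in> D" "o' = 1 \<^bold>\<frown> 1 \<^bold>\<frown> d'"
        by (cases rule: M_cases) (use v in \<open>simp_all add: prepend_shift\<close>)
      then obtain k f where kf: "d' = k \<^bold>\<frown> f" "\<forall>g\<in>E. \<exists>h\<in>B. Phi k (f \<oplus> g) = Some \<circ> h"
        unfolding D_def mp_imp_def by blast
      have "eval c (p \<oplus> g) = Some \<circ> o'" using o'(2) c by simp
      then have "eval d (p \<oplus> g) = Some \<circ> (o' \<oplus> (p \<oplus> g))" using d by blast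
      from eval_subst_oracle[OF this, of c'] have "Phi n (p \<oplus> g) = Phi k (f \<oplus> g)"
        using n c' d'(2) kf(1) by (simp add: numeral_2_eq_2)
      with kf(2) g show ?thesis by simp
    qed
    then show ?thesis unfolding D_def mp_imp_def by blast
  qed
  with that show thesis by blast
qed

text \<open>The string of the packet fixes the component for all of \<open>b K\<close>. An answer in
  \<open>b J\<close> becomes one in \<open>b (J - K)\<close> by \<open>b_difference\<close>, and
  \<open>J - K\<close> together with \<open>K\<close> covers \<open>J\<close>. An answer through
  column \<open>i\<close> is treated like the non-face \<open>e i\<close>, and one through
  \<open>D\<close> stays in \<open>D\<close>. The member of \<open>b {}\<close> is the
  \<open>h\<close> of \<open>b_difference\<close>.\<close>

lemma M_imp_b:
  assumes K: "K \<subseteq> I" and up: "\<And>J J'. J \<in> \<X> \<Longrightarrow> J \<subseteq> J' \<Longrightarrow> J' \<subseteq> I \<Longrightarrow> J' \<in> \<X>"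
    and exploded: "\<And>k J. e k \<subseteq> J \<Longrightarrow> J \<subseteq> I \<Longrightarrow> J \<in> \<X>"
  shows "M {N. N \<union> K \<in> \<X>} \<le>\<^sub>M mp_join (b {}) (mp_imp (b K) (M \<X>))"
proof -
  obtain n where n: "\<And>K \<X> p. \<lbrakk>packet K \<X> p; K \<subseteq> I; value3 p 0 \<noteq> 0; value3 p 1 \<noteq> 0\<rbrakk> \<Longrightarrow> n \<^bold>\<frown> p \<in> D"
    using packet_imp by blast
  obtain t where t: "\<And>J. J \<subseteq> I \<Longrightarrow> t (enc J) = enc (J - K)"
    "\<And>F. cf F \<Longrightarrow> cf (\<lambda>f x. t (F f x))" using table[of "\<lambda>J. enc (J - K)"] by blast
  \<comment> \<open>The index of a column is unbounded, so \<open>table\<close> does not apply; that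
    \<open>e\<close> is eventually constant replaces it.\<close>
  have s: "cf (\<lambda>f x. enc (e (F f x) - K))" if "cf F" for F
    by (rule cf_eventually_const[where m = m and h = "\<lambda>i. enc (e i - K)" and F = F, OF _ that])
      (use e_const in metis)
  obtain d where d: "\<forall>q. (\<exists>w. \<forall>x<3. settled q w x \<noteq> None) \<longrightarrow>
     (\<exists>w. (\<forall>x<3. settled q w x \<noteq> None) \<and> eval d q = Some \<circ> (w \<^bold>\<frown> q))" using packet_code ..
  have l: "cf (\<lambda>f. fleft f)" and r: "cf (\<lambda>f. fright f)" by (rule cff_fleft[OF cff_id] cff_fright[OF cff_id])+
  obtain d1 where d1: "\<forall>f. eval d1 f = eval d (fright f)" using subst_code[OF r] ..
  obtain d2 where d2: "\<forall>f g. eval d1 f = Some \<circ> g \<longrightarrow> eval d2 f = Some \<circ> (g \<oplus> f)" using join_code ..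
  let ?fh = "\<lambda>f. ftail (ftail (fleft f)) \<oplus> fleft (fright f)"
  let ?out = "\<lambda>f. if value3 (fleft f) 0 = 0 then 0 \<^bold>\<frown> t (value3 (fleft f) 1) \<^bold>\<frown> ?fh f
    else if value3 (fleft f) 1 = 0 then 0 \<^bold>\<frown> enc (e (value3 (fleft f) 2) - K) \<^bold>\<frown> ?fh f
    else 1 \<^bold>\<frown> 1 \<^bold>\<frown> n \<^bold>\<frown> fleft f"
  note v = cff_value3[OF l]
  have fh: "cf ?fh" by (intro cff_fjoin cff_ftail cff_fleft l r)
  have "cf ?out"
    by (rule cff_if[OF cp_eq[OF v cf_const]] cff_prepend t(2) s v fh l cf_const)+
  then obtain c where c: "\<forall>f x. eval c f x = Some (?out f x)" unfolding cf_def ..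
  have "\<exists>o'\<in>M {N. N \<union> K \<in> \<X>}. eval (subst_oracle c d2) F = Some \<circ> o'"
    if F: "F \<in> mp_join (b {}) (mp_imp (b K) (M \<X>))" for F
  proof -
    obtain h k f where h: "h \<in> b {}" "F = h \<oplus> (k \<^bold>\<frown> f)"
      and kf: "\<forall>g\<in>b K. \<exists>o'\<in>M \<X>. Phi k (f \<oplus> g) = Some \<circ> o'"
      using F unfolding mp_join_def mp_imp_def by blast
    let ?q = "k \<^bold>\<frown> f"
    obtain g o' where "g \<in> b K" "Phi k (f \<oplus> g) = Some \<circ> o'" using b_ne[OF K] kf by blast
    then have "\<exists>w. \<forall>x<3. settled ?q w x \<noteq> None" using ex_settled[of ?q g o'] by simp
    then obtain w where w: "\<forall>x<3. settled ?q w x \<noteq> None" "eval d ?q = Some \<circ> (w \<^bold>\<frown> ?q)"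
      using d by blast
    define p where "p = w \<^bold>\<frown> ?q"
    have p: "packet K \<X> p" using w(1) kf by (simp add: packet_def p_def)
    have tp: "ftail (ftail p) = f" by (simp add: p_def)
    have "eval d1 F = Some \<circ> p" using d1 h(2) w(2) by (simp add: p_def)
    then have "eval d2 F = Some \<circ> (p \<oplus> F)" using d2 by blast
    from eval_subst_oracle[OF this, of c]
    have ev: "eval (subst_oracle c d2) F = Some \<circ> ?out (p \<oplus> F)" using c by (simp add: fun_eq_iff)
    have in_M: "0 \<^bold>\<frown> enc (J - K) \<^bold>\<frown> (f \<oplus> h) \<in> M {N. N \<union> K \<in> \<X>}"
      if "J \<in> \<X>" "J \<subseteq> I" "f \<oplus> h \<in> b (J - K)" for J
    proof -
      have "(J - K) \<union> K \<in> \<X>" using up[OF that(1), of "(J - K) \<union> K"] that(2) K by blast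
      then have "enc (J - K) \<^bold>\<frown> (f \<oplus> h) \<in> Bs {N. N \<union> K \<in> \<X>}" using that(2,3) unfolding Bs_def by blast
      then show ?thesis unfolding M_def mp_meet_def by blast
    qed
    consider "value3 p 0 = 0" | "value3 p 0 \<noteq> 0" "value3 p 1 = 0" | "value3 p 0 \<noteq> 0" "value3 p 1 \<noteq> 0"
      by blast
    then have "?out (p \<oplus> F) \<in> M {N. N \<union> K \<in> \<X>}"
    proof cases
      case 1
      then obtain J where J: "J \<in> \<X>" "J \<subseteq> I" "value3 p 1 = enc J" "\<forall>g\<in>b K. f \<oplus> g \<in> b J"
        using packet_face[OF p K] unfolding tp by blast
      have "f \<oplus> h \<in> b (J - K)"
      proof (rule b_difference[OF K J(2) h(1) _ _ J(4)])
        show "g' \<in> b J" if "g \<in> b J" "g \<le>\<^sub>T g'" for g g' using b_up[OF that(1) J(2) that(2)] .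
        show "X u \<inter> b J = {}" if "u \<in> J" for u using that by (auto simp: b_def)
      qed
      from in_M[OF J(1,2) this] show ?thesis using 1 J(2,3) t(1) h(2) by (simp add: tp)
    next
      case 2
      let ?i = "value3 p 2"
      have "f \<oplus> h \<in> b (e ?i - K)"
      proof (rule b_difference[OF K e_I h(1)])
        show "g' \<in> a ?i" if "g \<in> a ?i" "g \<le>\<^sub>T g'" for g g' using a_up[OF that] .
        show "X u \<inter> a ?i = {}" if "u \<in> e ?i" for u using X_not_a that by blast
        show "\<forall>g\<in>b K. f \<oplus> g \<in> a ?i" using packet_column[OF p K 2] unfolding tp .
      qed
      from in_M[OF exploded[OF order_refl e_I] e_I this] show ?thesis using 2 h(2) by (simp add: tp)
    next
      case 3
      then have "1 \<^bold>\<frown> n \<^bold>\<frown> p \<in> PD" using n[OF p K] unfolding PD_def mp_meet_def by blast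
      then have "1 \<^bold>\<frown> 1 \<^bold>\<frown> n \<^bold>\<frown> p \<in> M {N. N \<union> K \<in> \<X>}" unfolding M_def mp_meet_def by blast
      then show ?thesis using 3 by simp
    qed
    with ev show ?thesis by blast
  qed
  then show ?thesis unfolding medvedev_le_iff by blast
qed

text \<open>All points are in \<open>b {}\<close>, and one component serves them all. A face
  \<open>J\<close> must be empty, as the point of a vertex in \<open>J\<close> is not in
  \<open>b J\<close>; column \<open>i\<close> fails at the point of a vertex in \<open>e i\<close>;
  and \<open>D\<close> would contain a computable function, which would give
  \<open>B \<le>\<^sub>M E\<close>.\<close>

lemma M_le_b_empty:
  assumes "M \<X> \<le>\<^sub>M b {}" shows "{} \<in> \<X>"
proof -
  obtain c where c: "\<forall>g\<in>b {}. \<exists>o'\<in>M \<X>. eval c g = Some \<circ> o'"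
    using assms unfolding medvedev_le_iff by blast
  obtain d where d: "\<forall>f. eval d f = eval c (fright f)" using subst_code[OF cff_fright[OF cff_id]] ..
  obtain k where k: "\<forall>f. Phi k f = eval d f" using index_code ..
  define z where "z = (\<lambda>x::nat. 0::nat)"
  have kz: "\<forall>g\<in>b {}. \<exists>o'\<in>M \<X>. Phi k (z \<oplus> g) = Some \<circ> o'" using c by (simp add: k d)
  let ?q = "k \<^bold>\<frown> z"
  obtain g o' where "g \<in> b {}" "Phi k (z \<oplus> g) = Some \<circ> o'" using b_ne[of "{}"] kz by blast
  then have "\<exists>w. \<forall>x<3. settled ?q w x \<noteq> None" using ex_settled[of ?q g o'] by simp
  then obtain w where w: "\<forall>x<3. settled ?q w x \<noteq> None" by blast
  define p where "p = w \<^bold>\<frown> ?q"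
  have p: "packet {} \<X> p" using w kz by (simp add: packet_def p_def)
  have tp: "ftail (ftail p) = z" by (simp add: p_def)
  have z_le: "z \<oplus> f \<le>\<^sub>T f" for f
  proof -
    have "cf (\<lambda>f. z \<oplus> f)" by (rule cff_fjoin[OF _ cff_id]) (unfold z_def, rule cf_const)
    from turing_le_cf[OF this] show ?thesis .
  qed
  have point: "point u \<in> b {}" if "u \<in> I" for u using X_b[OF that point_X[OF that]] by blast
  consider "value3 p 0 = 0" | "value3 p 0 \<noteq> 0" "value3 p 1 = 0" | "value3 p 0 \<noteq> 0" "value3 p 1 \<noteq> 0"
    by blast
  then show ?thesis
  proof cases
    case 1
    then obtain J where J: "J \<in> \<X>" "J \<subseteq> I" "\<forall>g\<in>b {}. z \<oplus> g \<in> b J"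
      using packet_face[OF p] unfolding tp by blast
    have False if "u \<in> J" for u
    proof -
      have u: "u \<in> I" using J(2) that by blast
      have "point u \<in> b J" using b_up[OF _ J(2) z_le] J(3) point[OF u] by blast
      with point_X[OF u] that show False by (auto simp: b_def)
    qed
    then have "J = {}" by blast
    with J(1) show ?thesis by simp
  next
    case 2
    obtain u where u: "u \<in> e (value3 p 2)" using e_ne by blast
    then have uI: "u \<in> I" using e_I by blast
    have "z \<oplus> point u \<in> a (value3 p 2)"
      using packet_column[OF p _ 2] point[OF uI] unfolding tp by blast
    then have "point u \<in> a (value3 p 2)" using a_up z_le by blast
    with X_not_a[OF point_X[OF uI] u] show ?thesis by blast
  next
    case 3
    obtain n where "n \<^bold>\<frown> p \<in> D" using packet_imp p 3 by (metis empty_subsetI)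
    then have n: "\<forall>g\<in>E. \<exists>h\<in>B. Phi n (p \<oplus> g) = Some \<circ> h" unfolding D_def mp_imp_def
      by (auto dest!: prepend_inject)
    have "cf (\<lambda>f. p \<oplus> f)"
      unfolding p_def z_def by (intro cff_fjoin cff_prepend cff_id cf_const)
    from subst_code[OF this] obtain c' where c': "\<forall>f. eval c' f = eval (code_of n) (p \<oplus> f)" by blast
    have "B \<le>\<^sub>M E" unfolding medvedev_le_iff using n c' unfolding Phi_def by (intro exI[of _ c']) simp
    with B_E show ?thesis by blast
  qed
qed

end

section \<open>Evaluation in a factor\<close>

text \<open>Computes with representatives of classes. They may lie outside the interval below
  \<open>x\<close>, so the arguments of \<open>imp\<close> are moved into it, as in the
  quotient.\<close>

primrec interval_value :: "'a brouwer \<Rightarrow> 'a \<Rightarrow> (nat \<Rightarrow> 'a) \<Rightarrow> form \<Rightarrow> 'a" where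
  "interval_value B x v (Var i) = v i"
| "interval_value B x v Bot = x"
| "interval_value B x v (Conj p q) = join B (interval_value B x v p) (interval_value B x v q)"
| "interval_value B x v (Disj p q) = meet B (interval_value B x v p) (interval_value B x v q)"
| "interval_value B x v (Impl p q) =
     imp B (meet B (interval_value B x v p) x) (meet B (interval_value B x v q) x)"

context brouwer_algebra
begin

lemma interval_value_closed:
  "x \<in> carrier B \<Longrightarrow> (\<And>i. v i \<in> carrier B) \<Longrightarrow> interval_value B x v p \<in> carrier B"
  by (induction p) auto

lemma value_of_quotient:
  assumes x: "x \<in> carrier B" and v: "\<And>i. v i \<in> carrier B"
  shows "value_of (B /\<^sub>B x) (\<lambda>i. filter_rel B x `` {v i}) p = filter_rel B x `` {interval_value B x v p}"
proof (induction p)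
  case Bot
  have "(one B, x) \<in> filter_rel B x"
    using x one_greatest[OF x] meet_idem[OF x] meet_commute[of "one B" x]
    by (simp add: filter_rel_iff[OF x] le_iff_meet)
  from equiv_class_eq[OF equiv_filter_rel[OF x] this] show ?case
    by (simp add: quotient_def Let_def)
next
  case (Conj p q)
  have "lift2 (filter_rel B x) (join B) (filter_rel B x `` {a}) (filter_rel B x `` {b})
      = filter_rel B x `` {join B a b}" if "a \<in> carrier B" "b \<in> carrier B" for a b
    using x by (intro lift2_class[OF x that, where k = "join B"]) (auto simp: distrib)
  with Conj interval_value_closed[OF x v] show ?case by (simp add: quotient_def Let_def)
next
  case (Disj p q)
  have "meet B (meet B a b) x = meet B (meet B a x) (meet B b x)"
    if "a \<in> carrier B" "b \<in> carrier B" for a b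
    using that x by (metis closed(2) meet_assoc meet_commute meet_idem)
  then have "lift2 (filter_rel B x) (meet B) (filter_rel B x `` {a}) (filter_rel B x `` {b})
      = filter_rel B x `` {meet B a b}" if "a \<in> carrier B" "b \<in> carrier B" for a b
    by (intro lift2_class[OF x that, where k = "meet B"]) auto
  with Disj interval_value_closed[OF x v] show ?case by (simp add: quotient_def Let_def)
next
  case (Impl p q)
  have "meet B (imp B (meet B a x) (meet B b x)) x = imp B (meet B a x) (meet B b x)"
    if "a \<in> carrier B" "b \<in> carrier B" for a b
  proof -
    have "le B (imp B (meet B a x) (meet B b x)) x"
      using that x by (intro le_trans[OF imp_le meet_lb2]) auto
    then show ?thesis using that x by (simp add: le_iff_meet)
  qed
  then have "lift2 (filter_rel B x) (\<lambda>a b. imp B (meet B a x) (meet B b x))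
        (filter_rel B x `` {a}) (filter_rel B x `` {b})
      = filter_rel B x `` {imp B (meet B a x) (meet B b x)}" if "a \<in> carrier B" "b \<in> carrier B" for a b
    using x by (intro lift2_class[OF x that, where k = "imp B"]) auto
  with Impl interval_value_closed[OF x v] show ?case by (simp add: quotient_def Let_def)
qed simp

end

primrec mp_value :: "baire set \<Rightarrow> (nat \<Rightarrow> baire set) \<Rightarrow> form \<Rightarrow> baire set" where
  "mp_value X v (Var i) = v i"
| "mp_value X v Bot = X"
| "mp_value X v (Conj p q) = mp_join (mp_value X v p) (mp_value X v q)"
| "mp_value X v (Disj p q) = mp_meet (mp_value X v p) (mp_value X v q)"
| "mp_value X v (Impl p q) = mp_imp (mp_meet (mp_value X v p) X) (mp_meet (mp_value X v q) X)"

lemma interval_value_Medvedev: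
  "interval_value Medvedev (degree X) (\<lambda>i. degree (v i)) p = degree (mp_value X v p)"
  by (induction p) simp_all

lemma Th_Medvedev_factor:
  assumes "p \<in> Th (Medvedev /\<^sub>B degree X)"
  shows "mp_meet (mp_value X v p) X \<le>\<^sub>M UNIV"
proof -
  interpret brouwer_algebra Medvedev by (rule brouwer_algebra_Medvedev)
  let ?R = "filter_rel Medvedev (degree X)"
  have x: "degree X \<in> carrier Medvedev" by simp
  have "?R `` {degree (v i)} \<in> carrier (Medvedev /\<^sub>B degree X)" for i
    by (simp add: Defs.quotient_def Let_def quotientI)
  moreover have "\<forall>w. (\<forall>i. w i \<in> carrier (Medvedev /\<^sub>B degree X))
      \<longrightarrow> value_of (Medvedev /\<^sub>B degree X) w p = zero (Medvedev /\<^sub>B degree X)"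
    using assms by (simp only: Th_def mem_Collect_eq)
  ultimately have
    "value_of (Medvedev /\<^sub>B degree X) (\<lambda>i. ?R `` {degree (v i)}) p = zero (Medvedev /\<^sub>B degree X)"
    by simp
  then have "?R `` {degree (mp_value X v p)} = ?R `` {degree UNIV}"
    using value_of_quotient[OF x, of "\<lambda>i. degree (v i)" p]
    by (simp add: interval_value_Medvedev Defs.quotient_def Let_def)
  then have "(degree (mp_value X v p), degree UNIV) \<in> ?R"
    using eq_equiv_class_iff[OF equiv_filter_rel[OF x], of "degree (mp_value X v p)" "degree UNIV"] by simp
  then have "mp_meet (mp_value X v p) X \<le>\<^sub>M mp_meet UNIV X"
    by (simp add: filter_rel_iff[OF x] degree_eq_iff)
  then show ?thesis using mp_meet_lb1 medvedev_le_trans by blast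
qed

lemma IPC_Th_factor: "p \<in> IPC \<Longrightarrow> p \<in> Th (Medvedev /\<^sub>B degree X)"
proof -
  assume p: "p \<in> IPC"
  interpret Q: brouwer_algebra "Medvedev /\<^sub>B degree X"
    by (rule brouwer_algebra.brouwer_algebra_quotient[OF brouwer_algebra_Medvedev]) simp
  show ?thesis unfolding Th_def using Q.IPC_sound[OF p] by blast
qed

section \<open>The countermodel\<close>

context medvedev_model
begin

text \<open>The root of the model is \<open>b {}\<close>.\<close>

definition le_above :: "baire set \<Rightarrow> baire set \<Rightarrow> bool" (infix "\<sqsubseteq>" 50) where
  "Y \<sqsubseteq> Z \<longleftrightarrow> Y \<le>\<^sub>M mp_join (b {}) Z"

lemma le_aboveI: "Y \<le>\<^sub>M Z \<Longrightarrow> Y \<sqsubseteq> Z"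
  unfolding le_above_def using mp_join_ub2 medvedev_le_trans by blast

lemma le_above_trans: "Y \<sqsubseteq> Z \<Longrightarrow> Z \<sqsubseteq> Z' \<Longrightarrow> Y \<sqsubseteq> Z'"
  unfolding le_above_def using mp_join_least[OF mp_join_ub1] medvedev_le_trans by blast

lemma le_above_join: "Y \<sqsubseteq> Z \<Longrightarrow> Y' \<sqsubseteq> Z \<Longrightarrow> mp_join Y Y' \<sqsubseteq> Z"
  unfolding le_above_def by (rule mp_join_least)

lemma le_above_join_mono: "Y \<sqsubseteq> Z \<Longrightarrow> Y' \<sqsubseteq> Z' \<Longrightarrow> mp_join Y Y' \<sqsubseteq> mp_join Z Z'"
  by (rule le_above_join; rule le_above_trans; assumption?) (intro le_aboveI mp_join_ub1 mp_join_ub2)+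

lemma le_above_meet: "Y \<sqsubseteq> Z \<Longrightarrow> Y \<sqsubseteq> Z' \<Longrightarrow> Y \<sqsubseteq> mp_meet Z Z'"
  unfolding le_above_def using mp_meet_greatest mp_distrib_join medvedev_le_trans by blast

definition worlds :: "form \<Rightarrow> 'v set set" where
  "worlds p = {J. J \<subseteq> I \<and> force I V (\<lambda>J. \<exists>k. e k \<subseteq> J) p J}"

lemma worlds_up:
  assumes "J \<in> worlds p" "J \<subseteq> K" "K \<subseteq> I" shows "K \<in> worlds p"
proof -
  have "force I V (\<lambda>J. \<exists>k. e k \<subseteq> J) p K"
  proof (rule force_mono)
    show "force I V (\<lambda>J. \<exists>k. e k \<subseteq> J) p J" using assms(1) by (simp add: worlds_def)
    show "V i K'" if "V i J'" "J' \<subseteq> K'" for i J' K' using V_mono[OF that] .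
  qed (use assms in blast)+
  with assms(3) show ?thesis by (simp add: worlds_def)
qed

lemma worlds_exploded:
  assumes "e k \<subseteq> J" "J \<subseteq> I" shows "J \<in> worlds p"
proof -
  have "force I V (\<lambda>J. \<exists>k. e k \<subseteq> J) p J"
    by (rule force_exploded) (use assms V_exploded in blast)+
  with assms(2) show ?thesis by (simp add: worlds_def)
qed

definition val :: "form \<Rightarrow> baire set" where
  "val p = mp_meet (mp_value PD (\<lambda>i. M (worlds (Var i))) p) PD"

lemma val_Conj: "val (Conj p q) \<le>\<^sub>M mp_join (val p) (val q)" "mp_join (val p) (val q) \<le>\<^sub>M val (Conj p q)"
  unfolding val_def mp_value.simps
  by (rule mp_distrib, intro mp_join_least mp_meet_mono mp_join_ub1 mp_join_ub2 medvedev_le_refl)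

lemma val_Disj: "val (Disj p q) \<le>\<^sub>M val p" "val (Disj p q) \<le>\<^sub>M val q"
    "mp_meet (val p) (val q) \<le>\<^sub>M val (Disj p q)"
  unfolding val_def mp_value.simps
  by (meson medvedev_le_refl medvedev_le_trans mp_meet_greatest mp_meet_lb1 mp_meet_lb2)+

lemma val_PD: "val p \<le>\<^sub>M PD"
  unfolding val_def by (rule mp_meet_lb2)

lemma val_Impl: "val (Impl p q) \<le>\<^sub>M mp_imp (val p) (val q)" "mp_imp (val p) (val q) \<le>\<^sub>M val (Impl p q)"
proof -
  have "mp_imp (val p) (val q) \<le>\<^sub>M val q" unfolding mp_residuation[symmetric] by (rule mp_join_ub2)
  then have "mp_imp (val p) (val q) \<le>\<^sub>M PD" using val_PD medvedev_le_trans by blast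
  then show "mp_imp (val p) (val q) \<le>\<^sub>M val (Impl p q)"
    by (simp add: val_def mp_meet_greatest medvedev_le_refl)
  show "val (Impl p q) \<le>\<^sub>M mp_imp (val p) (val q)" by (simp add: val_def mp_meet_lb1)
qed

text \<open>An implication from a finite meet of problems \<open>b K\<close> is the join of the
  implications from its parts. \<open>M_imp_b\<close> treats each part, and \<open>M_Int\<close>
  turns the join into an intersection.\<close>

lemma M_Inter_imp:
  assumes "finite \<K>" "\<And>K. K \<in> \<K> \<Longrightarrow> K \<subseteq> I"
    and "\<And>K. K \<in> \<K> \<Longrightarrow> mp_imp (b K) (M (worlds q)) \<sqsubseteq> U"
  shows "M {N. N \<subseteq> I \<and> (\<forall>K\<in>\<K>. N \<union> K \<in> worlds q)} \<sqsubseteq> U"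
  using assms
proof (induction rule: finite_induct)
  case empty
  have "M {N. N \<subseteq> I \<and> (\<forall>K\<in>{}. N \<union> K \<in> worlds q)} \<le>\<^sub>M b {}" by (rule M_b) simp_all
  then show ?case unfolding le_above_def using mp_join_ub1 medvedev_le_trans by blast
next
  case (insert K \<K>)
  let ?X = "{N. N \<union> K \<in> worlds q}" and ?Y = "{N. N \<subseteq> I \<and> (\<forall>K\<in>\<K>. N \<union> K \<in> worlds q)}"
  have KI: "K \<subseteq> I" using insert.prems(1) by blast
  have "M ?X \<le>\<^sub>M mp_join (b {}) (mp_imp (b K) (M (worlds q)))"
    by (rule M_imp_b[OF KI worlds_up worlds_exploded])
  then have 1: "M ?X \<sqsubseteq> U"
    by (intro le_above_trans[OF _ insert.prems(2)[of K]]) (simp_all add: le_above_def)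
  have 2: "M ?Y \<sqsubseteq> U" using insert.IH insert.prems by blast
  have "M (?X \<inter> ?Y) \<le>\<^sub>M mp_join (M ?X) (M ?Y)"
  proof (rule M_Int)
    show "J' \<in> ?X" if "J \<in> ?X" "J \<subseteq> J'" "J' \<subseteq> I" for J J'
      using that KI worlds_up[of "J \<union> K" q "J' \<union> K"] by blast
    fix J J' assume J: "J \<in> ?Y" "J \<subseteq> J'" "J' \<subseteq> I"
    have "J' \<union> L \<in> worlds q" if L: "L \<in> \<K>" for L
    proof (rule worlds_up)
      show "J \<union> L \<in> worlds q" using J(1) L by simp
      show "J \<union> L \<subseteq> J' \<union> L" using J(2) by blast
      show "J' \<union> L \<subseteq> I" using J(3) L insert.prems(1) by simp
    qed
    with J(3) show "J' \<in> ?Y" by simp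
  qed
  then have "M (?X \<inter> ?Y) \<sqsubseteq> U" by (rule le_above_trans[OF le_aboveI le_above_join[OF 1 2]])
  moreover have "?X \<inter> ?Y = {N. N \<subseteq> I \<and> (\<forall>K\<in>insert K \<K>. N \<union> K \<in> worlds q)}" by blast
  ultimately show ?case by simp
qed

text \<open>The truth lemma, up to joining with \<open>b {}\<close>. Conjunction rests on
  \<open>M_Int\<close>, disjunction on \<open>M_Un\<close>; for implication the premise is split
  into the finitely many \<open>b K\<close> with \<open>K\<close> in
  \<open>worlds p\<close>.\<close>

lemma val_worlds: "val p \<sqsubseteq> M (worlds p) \<and> M (worlds p) \<sqsubseteq> val p"
proof (induction p)
  case (Var i)
  show ?case unfolding val_def mp_value.simps
    by (auto intro!: le_aboveI mp_meet_lb1 mp_meet_greatest M_PD medvedev_le_refl)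
next
  case Bot
  have "Bs (worlds Bot) = Bs {J. \<exists>k. e k \<subseteq> J}"
    unfolding Bs_def worlds_def force.simps by blast
  then have "PD \<le>\<^sub>M M (worlds Bot)"
    unfolding M_def using PD_exploded by (intro mp_meet_greatest medvedev_le_refl) simp
  then have "val Bot \<le>\<^sub>M M (worlds Bot)" using val_PD medvedev_le_trans by blast
  moreover have "M (worlds Bot) \<le>\<^sub>M val Bot"
    unfolding val_def by (simp add: mp_meet_greatest M_PD)
  ultimately show ?case using le_aboveI by blast
next
  case (Conj p q)
  have w: "worlds (Conj p q) = worlds p \<inter> worlds q" by (auto simp: worlds_def)
  have "mp_join (M (worlds p)) (M (worlds q)) \<le>\<^sub>M M (worlds p \<inter> worlds q)"
    by (intro mp_join_least M_mono) auto
  moreover have "M (worlds p \<inter> worlds q) \<le>\<^sub>M mp_join (M (worlds p)) (M (worlds q))"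
    by (rule M_Int) (use worlds_up in blast)+
  ultimately show ?case
    unfolding w using Conj val_Conj[of p q] le_aboveI le_above_trans le_above_join_mono by meson
next
  case (Disj p q)
  have w: "worlds (Disj p q) = worlds p \<union> worlds q" by (auto simp: worlds_def)
  have "val (Disj p q) \<sqsubseteq> mp_meet (M (worlds p)) (M (worlds q))"
    using Disj val_Disj(1,2)[of p q] le_aboveI le_above_trans le_above_meet by meson
  moreover have "M (worlds p \<union> worlds q) \<sqsubseteq> mp_meet (val p) (val q)"
    using Disj M_mono[of "worlds p" "worlds p \<union> worlds q"] M_mono[of "worlds q" "worlds p \<union> worlds q"]
      le_aboveI le_above_trans le_above_meet by (meson Un_upper1 Un_upper2)
  ultimately show ?case
    unfolding w using M_Un val_Disj(3) le_aboveI le_above_trans by meson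
next
  case (Impl p q)
  let ?U = "mp_imp (val p) (val q)"
  have sub: "worlds p \<inter> worlds (Impl p q) \<subseteq> worlds q" by (auto simp: worlds_def)
  have "M (worlds p \<inter> worlds (Impl p q)) \<le>\<^sub>M mp_join (M (worlds p)) (M (worlds (Impl p q)))"
    by (rule M_Int) (use worlds_up in blast)+
  then have "M (worlds q) \<sqsubseteq> mp_join (M (worlds p)) (M (worlds (Impl p q)))"
    using M_mono[OF sub] medvedev_le_trans le_aboveI by blast
  moreover have "mp_join (M (worlds p)) (M (worlds (Impl p q))) \<sqsubseteq> mp_join (val p) (M (worlds (Impl p q)))"
    using Impl.IH(1) le_aboveI[OF medvedev_le_refl] le_above_join_mono by blast
  ultimately have "val q \<sqsubseteq> mp_join (val p) (M (worlds (Impl p q)))"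
    using Impl.IH(2) le_above_trans by blast
  then have "val q \<le>\<^sub>M mp_join (val p) (mp_join (b {}) (M (worlds (Impl p q))))"
    unfolding le_above_def
    by (meson medvedev_le_trans mp_join_least mp_join_ub1 mp_join_ub2)
  then have "?U \<sqsubseteq> M (worlds (Impl p q))" unfolding le_above_def mp_residuation .
  moreover have "M (worlds (Impl p q)) \<sqsubseteq> ?U"
  proof -
    \<comment> \<open>\<open>K\<close> forces \<open>p\<close>, so \<open>b K\<close> lies above
      \<open>M (worlds p)\<close> and thus above \<open>val p\<close>; a larger premise makes the
      implication smaller.\<close>
    have "mp_imp (b K) (M (worlds q)) \<sqsubseteq> ?U" if K: "K \<in> worlds p" for K
    proof -
      have KI: "K \<subseteq> I" using K by (simp add: worlds_def)
      have y: "b {} \<le>\<^sub>M b K" by (rule medvedev_le_subset) (simp add: b_antimono)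
      have "val p \<le>\<^sub>M mp_join (b {}) (M (worlds p))" using Impl.IH(1) by (simp add: le_above_def)
      also have "\<dots> \<le>\<^sub>M b K" by (rule mp_join_least[OF y M_b[OF K KI]])
      finally (medvedev_le_trans) have p: "val p \<le>\<^sub>M b K" .
      have "M (worlds q) \<le>\<^sub>M mp_join (b {}) (val q)" using Impl.IH(2) by (simp add: le_above_def)
      also have "\<dots> \<le>\<^sub>M mp_join (b {}) (mp_join (val p) ?U)"
        by (rule mp_join_mono[OF medvedev_le_refl mp_modus_ponens])
      also (medvedev_le_trans) have "\<dots> \<le>\<^sub>M mp_join (b K) (mp_join (b {}) ?U)"
        using p by (meson medvedev_le_trans mp_join_least mp_join_ub1 mp_join_ub2)
      finally (medvedev_le_trans) show ?thesis unfolding le_above_def mp_residuation .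
    qed
    moreover have "finite (worlds p)"
      using finite_I by (auto simp: worlds_def intro: finite_subset[of _ "Pow I"])
    ultimately have above: "M {N. N \<subseteq> I \<and> (\<forall>K\<in>worlds p. N \<union> K \<in> worlds q)} \<sqsubseteq> ?U"
      by (intro M_Inter_imp) (auto simp: worlds_def)
    have "{N. N \<subseteq> I \<and> (\<forall>K\<in>worlds p. N \<union> K \<in> worlds q)} \<subseteq> worlds (Impl p q)"
    proof
      fix N assume N: "N \<in> {N. N \<subseteq> I \<and> (\<forall>K\<in>worlds p. N \<union> K \<in> worlds q)}"
      have "K \<in> worlds q" if "K \<in> worlds p" "N \<subseteq> K" for K
      proof -
        have "N \<union> K \<in> worlds q" using N that(1) by simp
        moreover have "N \<union> K = K" using that(2) by blast
        ultimately show ?thesis by simp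
      qed
      with N show "N \<in> worlds (Impl p q)" by (simp add: worlds_def)
    qed
    from le_above_trans[OF le_aboveI[OF M_mono[OF this]] above] show ?thesis .
  qed
  ultimately show ?case
    using le_above_trans[OF le_aboveI[OF val_Impl(1)]] le_above_trans[OF _ le_aboveI[OF val_Impl(2)]]
    by blast
qed

lemma Th_forced:
  assumes "p \<in> Th (Medvedev /\<^sub>B degree PD)" shows "force I V (\<lambda>J. \<exists>k. e k \<subseteq> J) p {}"
proof -
  have "val p \<le>\<^sub>M UNIV" unfolding val_def by (rule Th_Medvedev_factor[OF assms])
  then have "val p \<le>\<^sub>M b {}" using medvedev_le_subset[of "b {}" UNIV] medvedev_le_trans by blast
  moreover have "M (worlds p) \<le>\<^sub>M mp_join (b {}) (val p)" using val_worlds by (simp add: le_above_def)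
  ultimately have "M (worlds p) \<le>\<^sub>M b {}"
    using mp_join_least[OF medvedev_le_refl] medvedev_le_trans by blast
  from M_le_b_empty[OF this] show ?thesis by (simp add: worlds_def)
qed

end

theorem theorem5p2:
  fixes \<B> \<E> \<D> :: "(nat \<Rightarrow> nat) set" and A :: "nat set"
  assumes "countable \<E>"
    and "\<not> \<B> \<le>\<^sub>M \<E>"
    and "\<D> = mp_imp \<E> \<B>"
    and "computably_independent A"
    and "\<And>f. f \<in> \<E> \<Longrightarrow> \<not> f \<le>\<^sub>T char_fun A"
  shows "Th (Medvedev /\<^sub>B degree (mp_meet
           {i \<^bold>\<frown> g |i g. column A i \<le>\<^sub>T g \<or> g \<in> upper_cone \<E>} \<D>)) = IPC"
proof (rule equalityI)
  show "Th (Medvedev /\<^sub>B degree (mp_meet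
      {i \<^bold>\<frown> g |i g. column A i \<le>\<^sub>T g \<or> g \<in> upper_cone \<E>} \<D>)) \<subseteq> IPC"
  proof (rule subsetI, rule ccontr)
    fix \<phi> assume Th: "\<phi> \<in> Th (Medvedev /\<^sub>B degree (mp_meet
      {i \<^bold>\<frown> g |i g. column A i \<le>\<^sub>T g \<or> g \<in> upper_cone \<E>} \<D>))" and "\<phi> \<notin> IPC"
    show False
    proof (rule IPC_countermodel[OF \<open>\<phi> \<notin> IPC\<close>])
      fix I :: "(form set \<times> nat) set" and e :: "nat \<Rightarrow> (form set \<times> nat) set" and V m
      assume "finite I" "\<And>k. e k \<subseteq> I" "\<And>k. k \<ge> m \<Longrightarrow> e k = e m"
        "\<And>u. u \<in> I \<Longrightarrow> \<exists>k. u \<in> e k"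
        "\<And>u v. u \<in> I \<Longrightarrow> v \<in> I \<Longrightarrow> u \<noteq> v \<Longrightarrow> \<exists>k. u \<in> e k \<and> v \<notin> e k"
        "\<And>i J K. V i J \<Longrightarrow> J \<subseteq> K \<Longrightarrow> V i K"
        and V: "\<And>i k J. e k \<subseteq> J \<Longrightarrow> V i J"
        and not_forced: "\<not> force I V (\<lambda>J. \<exists>k. e k \<subseteq> J) \<phi> {}"
      \<comment> \<open>An empty non-face would let the root force every formula.\<close>
      have "e k \<noteq> {}" for k
      proof
        assume ek: "e k = {}"
        have "force I V (\<lambda>J. \<exists>k. e k \<subseteq> J) \<phi> {}"
          by (rule force_exploded) (use ek V in blast)+
        with not_forced show False ..
      qed
      interpret medvedev_model A \<E> \<B> \<D> I e V m
        by (rule medvedev_model.intro) fact+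
      have "PD = mp_meet {i \<^bold>\<frown> g |i g. column A i \<le>\<^sub>T g \<or> g \<in> upper_cone \<E>} \<D>"
        unfolding PD_def P_def ..
      with Th have "\<phi> \<in> Th (Medvedev /\<^sub>B degree PD)" by simp
      from Th_forced[OF this] not_forced show False by contradiction
    qed
  qed
qed (blast intro: IPC_Th_factor)

end
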